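(* Let $N\ge 1$ and $1<p_1,\dots,p_N<\infty$ be such that $\frac1{p_i}+\frac1{p_j}\le 1$ for every $i\neq j$. Then the projective tensor product $X=\ell_{p_1}\hat\otimes\cdots\hat\otimes\ell_{p_N}$ is primary.
   Context: $\hat\otimes$ denotes the (completed) projective tensor product of Banach spaces. A Banach space $X$ is primary if whenever $X=Y\oplus Z$ (a topological direct sum of closed subspaces), $X$ is isomorphic (linearly homeomorphic) to $Y$ or to $Z$. *)

theory Defs
  imports "HOL-Analysis.Analysis" "HOL-Library.Function_Algebras"
begin

(* A normed space over a scalar field 'k, on the points of a library normed space 'x.
   The library classes only carry real scalars; the multiplication by 'k is extra data.
   The sort {real_normed_field, heine_borel} used for 'k in the theorem contains real and
   complex, and (a complete commutative field extension of the reals with multiplicative norm)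
   nothing else up to isomorphism. *)
locale normed_space_over = vector_space smul
  for smul :: "'k::real_normed_field \<Rightarrow> 'x::real_normed_vector \<Rightarrow> 'x" +
  assumes norm_smul: "norm (smul c x) = norm c * norm x"
    and smul_of_real: "smul (of_real r) x = r *\<^sub>R x"

definition linear_on ::
  "('k \<Rightarrow> 'a::ab_group_add \<Rightarrow> 'a) \<Rightarrow> ('k \<Rightarrow> 'b::ab_group_add \<Rightarrow> 'b) \<Rightarrow> 'a set \<Rightarrow> ('a \<Rightarrow> 'b) \<Rightarrow> bool"
  where "linear_on s1 s2 S f \<longleftrightarrow>
    (\<forall>x\<in>S. \<forall>y\<in>S. f (x + y) = f x + f y) \<and> (\<forall>c. \<forall>x\<in>S. f (s1 c x) = s2 c (f x))"

definition isomorphic :: "('k \<Rightarrow> 'x::real_normed_vector \<Rightarrow> 'x) \<Rightarrow> 'x set \<Rightarrow> 'x set \<Rightarrow> bool"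
  where "isomorphic smul Y Z \<longleftrightarrow> (\<exists>f g. homeomorphism Y Z f g \<and> linear_on smul smul Y f)"

definition topological_direct_sum ::
  "('k::field \<Rightarrow> 'x::real_normed_vector \<Rightarrow> 'x) \<Rightarrow> 'x set \<Rightarrow> 'x set \<Rightarrow> 'x set \<Rightarrow> bool"
  where "topological_direct_sum smul X Y Z \<longleftrightarrow>
    module.subspace smul Y \<and> closed Y \<and> module.subspace smul Z \<and> closed Z \<and>
    (\<exists>g. homeomorphism (Y \<times> Z) X (\<lambda>(y, z). y + z) g)"

definition primary :: "('k::field \<Rightarrow> 'x::real_normed_vector \<Rightarrow> 'x) \<Rightarrow> 'x set \<Rightarrow> bool"
  where "primary smul X \<longleftrightarrow>
    (\<forall>Y Z. topological_direct_sum smul X Y Z \<longrightarrow> isomorphic smul X Y \<or> isomorphic smul X Z)"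

definition pointwise_scale :: "'k::field \<Rightarrow> ('a \<Rightarrow> 'k) \<Rightarrow> 'a \<Rightarrow> 'k"
  where "pointwise_scale c f = (\<lambda>a. c * f a)"

definition lp :: "real \<Rightarrow> (nat \<Rightarrow> 'k::real_normed_field) set"
  where "lp p = {x. summable (\<lambda>n. norm (x n) powr p)}"

definition lp_norm :: "real \<Rightarrow> (nat \<Rightarrow> 'k::real_normed_field) \<Rightarrow> real"
  where "lp_norm p x = (\<Sum>n. norm (x n) powr p) powr (1 / p)"

(* Forms on the product of the spaces E i, i \<in> I, that are linear in each variable;
   no continuity is required. *)
definition multilinear_form ::
  "('k::field \<Rightarrow> 'v::ab_group_add \<Rightarrow> 'v) \<Rightarrow> 'i set \<Rightarrow> ('i \<Rightarrow> 'v set) \<Rightarrow> (('i \<Rightarrow> 'v) \<Rightarrow> 'k) \<Rightarrow> bool"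
  where "multilinear_form s I E A \<longleftrightarrow>
    (\<forall>x\<in>Pi\<^sub>E I E. \<forall>i\<in>I. linear_on s (*) (E i) (\<lambda>v. A (x(i := v))))"

(* The algebraic tensor product is realised, as usual, inside the space of functionals on
   multilinear forms: the elementary tensor of x is the evaluation of forms at x. Two finite
   sums of elementary tensors thus coincide iff no multilinear form separates them. *)
definition elementary_tensor ::
  "('k::field \<Rightarrow> 'v::ab_group_add \<Rightarrow> 'v) \<Rightarrow> 'i set \<Rightarrow> ('i \<Rightarrow> 'v set) \<Rightarrow> ('i \<Rightarrow> 'v) \<Rightarrow>
    (('i \<Rightarrow> 'v) \<Rightarrow> 'k) \<Rightarrow> 'k"
  where "elementary_tensor s I E x = (\<lambda>A. if multilinear_form s I E A then A x else 0)"

definition algebraic_tensor ::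
  "('k::field \<Rightarrow> 'v::ab_group_add \<Rightarrow> 'v) \<Rightarrow> 'i set \<Rightarrow> ('i \<Rightarrow> 'v set) \<Rightarrow>
    ((('i \<Rightarrow> 'v) \<Rightarrow> 'k) \<Rightarrow> 'k) set"
  where "algebraic_tensor s I E = module.span pointwise_scale (elementary_tensor s I E ` Pi\<^sub>E I E)"

(* Scalar coefficients are absorbed into one of the factors, so I is meant to be nonempty. *)
definition projective_norm ::
  "('k::field \<Rightarrow> 'v::ab_group_add \<Rightarrow> 'v) \<Rightarrow> 'i set \<Rightarrow> ('i \<Rightarrow> 'v set) \<Rightarrow> ('i \<Rightarrow> 'v \<Rightarrow> real) \<Rightarrow>
    ((('i \<Rightarrow> 'v) \<Rightarrow> 'k) \<Rightarrow> 'k) \<Rightarrow> real"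
  where "projective_norm s I E nrm u =
    Inf {\<Sum>k<n. \<Prod>i\<in>I. nrm i (y k i) | (n::nat) y.
           (\<forall>k<n. y k \<in> Pi\<^sub>E I E) \<and> u = (\<Sum>k<n. elementary_tensor s I E (y k))}"

(* X, a closed subspace of the Banach space 'x, is a completion of the algebraic tensor product
   under the projective norm: the latter has a linear isometric copy that is dense in X.
   Completions are unique up to linear isometry; quantifying over all X and 'x avoids the choice
   of a particular one. *)
definition is_projective_tensor_product ::
  "('k::field \<Rightarrow> 'v::ab_group_add \<Rightarrow> 'v) \<Rightarrow> 'i set \<Rightarrow> ('i \<Rightarrow> 'v set) \<Rightarrow> ('i \<Rightarrow> 'v \<Rightarrow> real) \<Rightarrow>
    ('k \<Rightarrow> 'x::banach \<Rightarrow> 'x) \<Rightarrow> 'x set \<Rightarrow> bool"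
  where "is_projective_tensor_product s I E nrm smul X \<longleftrightarrow>
    (\<exists>j. linear_on pointwise_scale smul (algebraic_tensor s I E) j \<and>
         (\<forall>u\<in>algebraic_tensor s I E. norm (j u) = projective_norm s I E nrm u) \<and>
         X = closure (j ` algebraic_tensor s I E))"

end

theory Submission
  imports Defs
begin

text \<open>
  Let \<open>T\<close> be an operator on \<open>X\<close>. For every \<open>\<epsilon> > 0\<close> there are infinite sets \<open>A\<^sub>i\<close> of indices and
  a scalar \<open>\<mu>\<close> such that the compression of \<open>T\<close> to the span of the \<open>e\<^sub>\<alpha>\<close> with
  \<open>\<alpha> \<in> \<Prod> A\<^sub>i\<close> is within \<open>\<epsilon>\<close> of \<open>\<mu>\<close> times the identity. To see this, take limits of the matrix entries
  of \<open>T\<close> along a nonprincipal ultrafilter in the coordinates where the two multi-indices agree.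
  The order of these limits does not matter: otherwise the main triangle projection would be bounded on
  \<open>\<ell>\<^sub>p \<otimes> \<ell>\<^sub>q\<close> for two of the exponents, which fails because \<open>1/p + 1/q \<le> 1\<close>. By Moebius inversion
  over the sets \<open>S\<close> of coordinates, \<open>T\<close> is then a sum of operators \<open>1 \<otimes> M\<^sub>S\<close>, where the entries of
  \<open>M\<^sub>S\<close> tend to zero when any coordinate tends to infinity, unless \<open>S\<close> is empty. Passing to sparse sets \<open>A\<^sub>i\<close>
  makes the entries of all \<open>M\<^sub>S\<close>, \<open>S \<noteq> {}\<close>, absolutely summable with sum at most \<open>\<epsilon>\<close>.

  Consequently, for a projection \<open>P\<close> the identity of \<open>X\<close> factors through \<open>P\<close> or \<open>1 - P\<close>. To conclude with
  Pelczynski's decomposition method, split the index set into infinitely many infinite blocks: the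
  block diagonal part \<open>D\<close> of \<open>X\<close> is complemented, and every operator on \<open>X\<close> acts blockwise on it, so that \<open>D\<close>
  plays the role of an infinite direct sum of copies of \<open>X\<close>.
\<close>

section \<open>Elementary tensors and the universal property\<close>

text \<open>The tensors of unit vectors need not form an unconditional basis of \<open>X\<close>, so
  \<open>X\<close> cannot be compressed to an arbitrary set of multi-indices. What is available acts
  factor by factor: reindexing along injections, truncation, sign changes. Averaging over signs
  gives one further tool, passage to the diagonal (\<open>sign_diagonal\<close>). It bounds block
  diagonal operators, and it shows that the entries whose two multi-indices agree in two coordinates
  form a Schur multiplier in these coordinates. The failure of the triangle projection is made
  quantitative by the matrices \<open>haar k\<close> of size \<open>2 ^ k\<close>. On vectors of
  ones, the bound for their bilinear form is a constant times
  \<open>k powr (1 - 1 / p) * 2 ^ k\<close>, whereas the entries above the diagonal add up to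
  \<open>k * 2 ^ k / 4\<close> and all entries to 0. The gain is \<open>k powr (1 / p)\<close>.
  Entries vanish in the limit when only one of the two multi-indices moves, because
  \<open>1 < p i\<close>: along one coordinate, m entries have absolute sum at most a constant times
  a power of m with exponent below 1.\<close>

lemma sum_fun_apply: "(\<Sum>k\<in>F. f k) x = (\<Sum>k\<in>F. f k x)"
  by (induction F rule: infinite_finite_induct) auto

lemma linear_onD:
  assumes "linear_on s1 s2 S f"
  shows "x \<in> S \<Longrightarrow> y \<in> S \<Longrightarrow> f (x + y) = f x + f y" "x \<in> S \<Longrightarrow> f (s1 c x) = s2 c (f x)"
  using assms by (auto simp: linear_on_def)

lemma vector_space_pointwise_scale: "vector_space (pointwise_scale :: 'k::field \<Rightarrow> ('a \<Rightarrow> 'k) \<Rightarrow> 'a \<Rightarrow> 'k)"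
  by unfold_locales (auto simp: pointwise_scale_def algebra_simps fun_eq_iff)

interpretation ptw: vector_space "pointwise_scale :: 'k::field \<Rightarrow> ('a \<Rightarrow> 'k) \<Rightarrow> 'a \<Rightarrow> 'k"
  by (rule vector_space_pointwise_scale)

text \<open>Makes the scalars an admissible target of the universal property, which produces the
  coordinate functionals.\<close>

lemma normed_space_over_mult: "normed_space_over ((*) :: 'k::real_normed_field \<Rightarrow> 'k \<Rightarrow> 'k)"
  by unfold_locales (auto simp: algebra_simps norm_mult scaleR_conv_of_real)

text \<open>The vector-valued version of \<open>multilinear_form\<close>, as the universal property
  requires.\<close>

definition multilinear_map ::
  "('k::field \<Rightarrow> 'v::ab_group_add \<Rightarrow> 'v) \<Rightarrow> ('k \<Rightarrow> 'y::ab_group_add \<Rightarrow> 'y) \<Rightarrow> 'i set \<Rightarrow> ('i \<Rightarrow> 'v set) \<Rightarrow>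
    (('i \<Rightarrow> 'v) \<Rightarrow> 'y) \<Rightarrow> bool"
  where "multilinear_map s t I E A \<longleftrightarrow>
    (\<forall>x\<in>Pi\<^sub>E I E. \<forall>i\<in>I. linear_on s t (E i) (\<lambda>v. A (x(i := v))))"

lemma multilinear_mapD:
  assumes "multilinear_map s t I E A" "x \<in> Pi\<^sub>E I E" "i \<in> I"
  shows "v \<in> E i \<Longrightarrow> w \<in> E i \<Longrightarrow> A (x(i := v + w)) = A (x(i := v)) + A (x(i := w))"
    "v \<in> E i \<Longrightarrow> A (x(i := s c v)) = t c (A (x(i := v)))"
  using assms by (auto simp: multilinear_map_def linear_on_def)

lemma multilinear_form_eq: "multilinear_form s I E A \<longleftrightarrow> multilinear_map s (*) I E A"
  by (simp add: multilinear_form_def multilinear_map_def)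

lemma PiE_upd: "x \<in> Pi\<^sub>E I E \<Longrightarrow> i \<in> I \<Longrightarrow> v \<in> E i \<Longrightarrow> x(i := v) \<in> Pi\<^sub>E I E"
  by (auto simp: PiE_iff extensional_def)

text \<open>The factors stay abstract here; sequence spaces enter with \<open>lp_tensor\<close>. The
  map \<open>j\<close> is the witness of \<open>is_projective_tensor_product\<close>.\<close>

locale projective_tensor = normed_space_over smul + fac: vector_space s
  for smul :: "'k::real_normed_field \<Rightarrow> 'x::banach \<Rightarrow> 'x"
    and s :: "'k \<Rightarrow> 'v::ab_group_add \<Rightarrow> 'v" +
  fixes I :: "'i set" and E :: "'i \<Rightarrow> 'v set" and nrm :: "'i \<Rightarrow> 'v \<Rightarrow> real"
    and X :: "'x set" and j :: "((('i \<Rightarrow> 'v) \<Rightarrow> 'k) \<Rightarrow> 'k) \<Rightarrow> 'x"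
  assumes fin: "finite I" and ne: "I \<noteq> {}"
    and subE: "\<And>i. i \<in> I \<Longrightarrow> fac.subspace (E i)"
    and nrm_nonneg: "\<And>i v. 0 \<le> nrm i v"
    and nrm_scale: "\<And>i c v. i \<in> I \<Longrightarrow> v \<in> E i \<Longrightarrow> nrm i (s c v) = norm c * nrm i v"
    and j_lin: "linear_on pointwise_scale smul (algebraic_tensor s I E) j"
    and j_norm: "\<And>u. u \<in> algebraic_tensor s I E \<Longrightarrow> norm (j u) = projective_norm s I E nrm u"
    and X_def: "X = closure (j ` algebraic_tensor s I E)"
begin

abbreviation "alg \<equiv> algebraic_tensor s I E"
abbreviation "el \<equiv> elementary_tensor s I E"
abbreviation "PE \<equiv> Pi\<^sub>E I E"

definition tau :: "('i \<Rightarrow> 'v) \<Rightarrow> 'x" where "tau x = j (el x)"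

text \<open>The cost of one elementary tensor in the infimum that defines
  \<open>projective_norm\<close>.\<close>

definition wt :: "('i \<Rightarrow> 'v) \<Rightarrow> real" where "wt x = (\<Prod>i\<in>I. nrm i (x i))"

lemma wt_nonneg: "0 \<le> wt x"
  unfolding wt_def by (intro prod_nonneg) (auto simp: nrm_nonneg)

lemma E_closed:
  assumes "i \<in> I"
  shows "0 \<in> E i" "v \<in> E i \<Longrightarrow> w \<in> E i \<Longrightarrow> v + w \<in> E i" "v \<in> E i \<Longrightarrow> s c v \<in> E i"
  using subE[OF assms] by (auto simp: fac.subspace_def)

lemma alg_subspace: "ptw.subspace alg"
  unfolding algebraic_tensor_def by (rule ptw.subspace_span)

lemma el_in_alg: "x \<in> PE \<Longrightarrow> el x \<in> alg"
  unfolding algebraic_tensor_def by (intro ptw.span_base) auto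

text \<open>An elementary tensor is set to 0 on forms that are not multilinear, so evaluation at
  every form is linear in each variable.\<close>

lemma el_multilinear: "multilinear_map s pointwise_scale I E el"
proof -
  have "linear_on s pointwise_scale (E i) (\<lambda>v. el (x(i := v)))" if "x \<in> PE" "i \<in> I" for x i
    unfolding linear_on_def elementary_tensor_def
    using that by (auto simp: multilinear_form_eq fun_eq_iff pointwise_scale_def multilinear_mapD)
  then show ?thesis unfolding multilinear_map_def by blast
qed

lemma el_scale:
  assumes "x \<in> PE" "i \<in> I" shows "el (x(i := s c (x i))) = pointwise_scale c (el x)"
  using multilinear_mapD(2)[OF el_multilinear assms, of "x i" c] assms by (auto simp: PiE_iff)

text \<open>Coefficients are absorbed into one factor \<open>i\<close>, which exists as
  \<open>I\<close> is nonempty. In particular the infimum in \<open>projective_norm\<close> is over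
  a nonempty set.\<close>

lemma alg_rep:
  assumes "u \<in> alg"
  shows "\<exists>(n::nat) y. (\<forall>k<n. y k \<in> PE) \<and> u = (\<Sum>k<n. el (y k))"
proof -
  obtain i where i: "i \<in> I" using ne by auto
  from assms show ?thesis unfolding algebraic_tensor_def
  proof (induction rule: ptw.span_induct_alt)
    case base
    show ?case by (intro exI[of _ 0]) auto
  next
    case (step c z u)
    then obtain x and n :: nat and y where x: "x \<in> PE" "z = el x" and y: "\<forall>k<n. y k \<in> PE" "u = (\<Sum>k<n. el (y k))"
      by blast
    let ?x = "x(i := s c (x i))"
    have "?x \<in> PE" using x i by (intro PiE_upd E_closed) auto
    moreover have "el ?x = pointwise_scale c z" using el_scale[OF x(1) i] x by simp
    ultimately show ?case using y
      by (intro exI[of _ "Suc n"] exI[of _ "y(n := ?x)"]) (auto simp: add.commute less_Suc_eq)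
  qed
qed

lemma pn_le:
  assumes "\<And>k. k < (n::nat) \<Longrightarrow> y k \<in> PE"
  shows "projective_norm s I E nrm (\<Sum>k<n. el (y k)) \<le> (\<Sum>k<n. wt (y k))"
  unfolding projective_norm_def wt_def
proof (rule cInf_lower)
  show "bdd_below {\<Sum>k<n. \<Prod>i\<in>I. nrm i (y k i) |(n::nat) y. (\<forall>k<n. y k \<in> PE) \<and> u = (\<Sum>k<n. el (y k))}" for u
    by (rule bdd_belowI[of _ 0]) (auto intro!: sum_nonneg prod_nonneg simp: nrm_nonneg)
qed (use assms in auto)

lemma pn_approx:
  assumes "u \<in> alg" "projective_norm s I E nrm u < r"
  shows "\<exists>(n::nat) y. (\<forall>k<n. y k \<in> PE) \<and> u = (\<Sum>k<n. el (y k)) \<and> (\<Sum>k<n. wt (y k)) < r"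
proof -
  have "{\<Sum>k<n. \<Prod>i\<in>I. nrm i (y k i) | (n::nat) y. (\<forall>k<n. y k \<in> PE) \<and> u = (\<Sum>k<n. el (y k))} \<noteq> {}"
    using alg_rep[OF assms(1)] by blast
  from cInf_lessD[OF this] assms(2) show ?thesis
    unfolding projective_norm_def wt_def by blast
qed

lemma tau_multilinear: "multilinear_map s smul I E tau"
proof -
  have "linear_on s smul (E i) (\<lambda>v. tau (x(i := v)))" if "x \<in> PE" "i \<in> I" for x i
    unfolding linear_on_def tau_def
    using that by (auto simp: multilinear_mapD[OF el_multilinear] linear_onD[OF j_lin] el_in_alg PiE_upd)
  then show ?thesis unfolding multilinear_map_def by blast
qed

lemma norm_tau_le: "x \<in> PE \<Longrightarrow> norm (tau x) \<le> wt x"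
  using pn_le[of 1 "\<lambda>_. x"] j_norm[OF el_in_alg, of x] unfolding tau_def by simp

lemma j_sum: "(\<And>k. k \<in> F \<Longrightarrow> u k \<in> alg) \<Longrightarrow> j (\<Sum>k\<in>F. u k) = (\<Sum>k\<in>F. j (u k))"
proof (induction F rule: infinite_finite_induct)
  case (insert k F)
  have "j (u k + sum u F) = j (u k) + j (sum u F)"
    using insert.prems by (intro linear_onD(1)[OF j_lin] ptw.subspace_sum[OF alg_subspace]) auto
  then show ?case using insert by (simp only: sum.insert insert_iff simp_thms)
next
  have 0: "0 \<in> alg" using alg_subspace by (rule ptw.subspace_0)
  have "j 0 = 0" using linear_onD(1)[OF j_lin 0 0] by simp
  then show "j (sum u {}) = (\<Sum>k\<in>{}. j (u k))" by simp
  case (infinite F)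
  then show ?case using \<open>j 0 = 0\<close> by (simp only: sum.infinite not_False_eq_True)
qed

lemma continuous_smul:
  assumes "f \<longlonglongrightarrow> l" shows "(\<lambda>n. smul c (f n)) \<longlonglongrightarrow> smul c l"
proof (rule LIM_zero_cancel)
  have "norm (smul c (f n) - smul c l) = norm c * norm (f n - l)" for n
    by (metis norm_smul scale_right_diff_distrib)
  moreover have "(\<lambda>n. norm c * norm (f n - l)) \<longlonglongrightarrow> 0"
    using assms by (intro tendsto_mult_right_zero tendsto_norm_zero LIM_zero)
  ultimately show "(\<lambda>n. smul c (f n) - smul c l) \<longlonglongrightarrow> 0"
    by (subst tendsto_norm_zero_iff[symmetric]) simp
qed

lemma X_subspace: "subspace X"
proof -
  have sm: "smul c x \<in> j ` alg" if "x \<in> j ` alg" for c x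
  proof -
    from that obtain a where a: "a \<in> alg" "x = j a" by auto
    show ?thesis unfolding a(2) linear_onD(2)[OF j_lin a(1), symmetric]
      by (intro imageI ptw.subspace_scale[OF alg_subspace] a)
  qed
  have pl: "x + y \<in> j ` alg" if "x \<in> j ` alg" "y \<in> j ` alg" for x y
  proof -
    from that obtain a b where a: "a \<in> alg" "x = j a" "b \<in> alg" "y = j b" by auto
    show ?thesis unfolding a(2,4) linear_onD(1)[OF j_lin a(1,3), symmetric]
      by (intro imageI ptw.subspace_add[OF alg_subspace] a)
  qed
  have 0: "0 \<in> j ` alg"
  proof -
    have "j 0 = 0" using j_sum[of "{} :: nat set" "\<lambda>_. 0"] by (simp only: sum.empty empty_iff)
    then show ?thesis using imageI[OF ptw.subspace_0[OF alg_subspace], of j] by simp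
  qed
  show ?thesis unfolding subspace_def X_def
  proof (intro conjI ballI allI)
    show "0 \<in> closure (j ` alg)" by (rule subsetD[OF closure_subset 0])
    fix x y c assume "x \<in> closure (j ` alg)"
    then obtain f where f: "\<forall>n. f n \<in> j ` alg" "f \<longlonglongrightarrow> x" unfolding closure_sequential by blast
    show "smul c x \<in> closure (j ` alg)"
      unfolding closure_sequential
      by (intro exI[of _ "\<lambda>n. smul c (f n)"] conjI allI sm continuous_smul f(1)[rule_format] f(2))
    assume "y \<in> closure (j ` alg)"
    then obtain g where g: "\<forall>n. g n \<in> j ` alg" "g \<longlonglongrightarrow> y" unfolding closure_sequential by blast
    show "x + y \<in> closure (j ` alg)"
      unfolding closure_sequential
      by (intro exI[of _ "\<lambda>n. f n + g n"] conjI allI pl tendsto_add f(1)[rule_format] g(1)[rule_format] f(2) g(2))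
  qed
qed

lemma closed_X: "closed X" by (simp add: X_def)

lemma alg_in_X: "u \<in> alg \<Longrightarrow> j u \<in> X"
  unfolding X_def by (rule subsetD[OF closure_subset imageI])

lemma tau_in_X: "x \<in> PE \<Longrightarrow> tau x \<in> X"
  unfolding tau_def by (intro alg_in_X el_in_alg)

text \<open>Density of the finite sums of elementary tensors. Scalar multiples have no case of their
  own because \<open>alg_rep\<close> absorbs them.\<close>

lemma X_induct:
  assumes u: "u \<in> X" and tau: "\<And>x. x \<in> PE \<Longrightarrow> tau x \<in> C"
    and zero: "0 \<in> C" and add: "\<And>a b. a \<in> C \<Longrightarrow> b \<in> C \<Longrightarrow> a + b \<in> C"
    and lim: "\<And>f l. (\<And>n. f n \<in> C) \<Longrightarrow> (\<And>n. f n \<in> X) \<Longrightarrow> f \<longlonglongrightarrow> l \<Longrightarrow> l \<in> X \<Longrightarrow> l \<in> C"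
  shows "u \<in> C"
proof -
  have 1: "j a \<in> C" if a: "a \<in> alg" for a
  proof -
    obtain n y where y: "\<forall>k<n. y k \<in> PE" "a = (\<Sum>k<(n::nat). el (y k))" using alg_rep[OF a] by blast
    have "j a = (\<Sum>k<n. tau (y k))" unfolding y(2) tau_def using y by (intro j_sum el_in_alg) auto
    moreover have "(\<Sum>k<m. tau (y k)) \<in> C" if "m \<le> n" for m
      using that
    proof (induction m)
      case (Suc m)
      then have "tau (y m) \<in> C" using tau y(1) by simp
      with Suc show ?case by (auto intro: add)
    qed (simp add: zero)
    ultimately show ?thesis by auto
  qed
  obtain f where f: "\<forall>n. f n \<in> j ` alg" "f \<longlonglongrightarrow> u" using u unfolding X_def closure_sequential by blast
  have "\<And>n. f n \<in> C" "\<And>n. f n \<in> X" using f(1) 1 alg_in_X by (metis (no_types) image_iff)+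
  then show ?thesis using lim f(2) u by blast
qed

text \<open>Two sums of elementary tensors are equal iff no multilinear form separates them. If
  their images under \<open>B\<close> differed by w, a functional g with \<open>g w = 1\<close>
  would turn \<open>B\<close> into a separating form. That g is merely algebraic, which suffices as
  forms carry no continuity.\<close>

lemma well_defined:
  fixes B :: "('i \<Rightarrow> 'v) \<Rightarrow> 'y::ab_group_add"
  assumes t: "vector_space t" and B: "multilinear_map s t I E B"
    and y: "\<forall>k<n. y k \<in> PE" and z: "\<forall>k<m. z k \<in> PE"
    and eq: "(\<Sum>k<(n::nat). el (y k)) = (\<Sum>k<(m::nat). el (z k))"
  shows "(\<Sum>k<n. B (y k)) = (\<Sum>k<m. B (z k))"
proof (rule ccontr)
  assume "(\<Sum>k<n. B (y k)) \<noteq> (\<Sum>k<m. B (z k))"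
  define w where "w = (\<Sum>k<n. B (y k)) - (\<Sum>k<m. B (z k))"
  have "w \<noteq> 0" unfolding w_def using \<open>_ \<noteq> _\<close> by simp
  interpret t: vector_space t by (rule t)
  interpret k: vector_space "(*) :: 'k \<Rightarrow> 'k \<Rightarrow> 'k" by unfold_locales (auto simp: algebra_simps)
  interpret tk: vector_space_pair t "(*) :: 'k \<Rightarrow> 'k \<Rightarrow> 'k" by unfold_locales
  have "t.independent {w}" using \<open>w \<noteq> 0\<close> by (simp)
  from tk.linear_independent_extend[OF this, of "\<lambda>_. 1"] obtain g
    where g: "Vector_Spaces.linear t (*) g" "g w = 1" by auto
  interpret g: Vector_Spaces.linear t "(*)" g by (rule g)
  have A: "multilinear_form s I E (\<lambda>x. g (B x))"
    unfolding multilinear_form_def linear_on_def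
    by (auto simp: multilinear_mapD[OF B] g.add g.scale)
  have "(\<Sum>k<n. el (y k) (\<lambda>x. g (B x))) = (\<Sum>k<m. el (z k) (\<lambda>x. g (B x)))"
    using eq by (metis sum_fun_apply)
  then have "(\<Sum>k<n. g (B (y k))) = (\<Sum>k<m. g (B (z k)))"
    using A by (simp add: elementary_tensor_def)
  then have "g w = 0" unfolding w_def by (simp add: g.diff g.sum)
  with g show False by simp
qed

lemma sum_append:
  "(\<Sum>k<n + m. f (if k < n then y k else z (k - n))) = (\<Sum>k<(n::nat). f (y k)) + (\<Sum>k<m. f (z k))"
  by (induction m) (auto simp: add.assoc)

lemma X_closed:
  shows "0 \<in> X" "u \<in> X \<Longrightarrow> v \<in> X \<Longrightarrow> u + v \<in> X" "u \<in> X \<Longrightarrow> smul c u \<in> X"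
    "u \<in> X \<Longrightarrow> v \<in> X \<Longrightarrow> u - v \<in> X" "u \<in> X \<Longrightarrow> - u \<in> X"
    "(\<And>k. k \<in> F \<Longrightarrow> f k \<in> X) \<Longrightarrow> (\<Sum>k\<in>F. f k) \<in> X"
  by (auto intro: subspace_0[OF X_subspace] subspace_add[OF X_subspace] subspace_scale[OF X_subspace]
      subspace_diff[OF X_subspace] subspace_neg[OF X_subspace] subspace_sum[OF X_subspace])

text \<open>\<open>well_defined\<close> gives the map on finite sums, where it is bounded by
  \<open>C\<close> times the projective norm. It is therefore Lipschitz on the dense image of
  \<open>j\<close> and extends to the closure by uniform continuity.\<close>

theorem universal:
  fixes t :: "'k \<Rightarrow> 'y::{real_normed_vector, complete_space} \<Rightarrow> 'y"
  assumes t: "normed_space_over t" and B: "multilinear_map s t I E B"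
    and bd: "\<And>x. x \<in> PE \<Longrightarrow> norm (B x) \<le> C * wt x" and C: "0 \<le> C"
  obtains F where "linear_on smul t X F" "\<And>u. u \<in> X \<Longrightarrow> norm (F u) \<le> C * norm u"
    "\<And>x. x \<in> PE \<Longrightarrow> F (tau x) = B x"
proof -
  interpret t: normed_space_over t by (rule t)
  define h where "h u = (SOME w. \<exists>(n::nat) y. (\<forall>k<n. y k \<in> PE) \<and> u = (\<Sum>k<n. el (y k)) \<and> w = (\<Sum>k<n. B (y k)))" for u
  have h_eq: "h (\<Sum>k<n. el (y k)) = (\<Sum>k<n. B (y k))" if y: "\<forall>k<n. y k \<in> PE" for n :: nat and y
  proof -
    let ?u = "\<Sum>k<n. el (y k)"
    have "\<exists>w. \<exists>(n::nat) y. (\<forall>k<n. y k \<in> PE) \<and> ?u = (\<Sum>k<n. el (y k)) \<and> w = (\<Sum>k<n. B (y k))"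
      using y by blast
    from someI_ex[OF this] obtain m :: nat and z where z: "\<forall>k<m. z k \<in> PE" "?u = (\<Sum>k<m. el (z k))" "h ?u = (\<Sum>k<m. B (z k))"
      unfolding h_def by blast
    show ?thesis unfolding z(3) by (rule well_defined[OF t.vector_space_axioms B z(1) y z(2)[symmetric]])
  qed
  have h_add: "h (u + v) = h u + h v" if u: "u \<in> alg" and v: "v \<in> alg" for u v
  proof -
    obtain n :: nat and y where y: "\<forall>k<n. y k \<in> PE" "u = (\<Sum>k<n. el (y k))" using alg_rep[OF u] by blast
    obtain m :: nat and z where z: "\<forall>k<m. z k \<in> PE" "v = (\<Sum>k<m. el (z k))" using alg_rep[OF v] by blast
    let ?y = "\<lambda>k. if k < n then y k else z (k - n)"
    have uv: "u + v = (\<Sum>k<n+m. el (?y k))" unfolding y(2) z(2) by (rule sum_append[symmetric, where f=el and y=y and z=z])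
    have "\<forall>k<n+m. ?y k \<in> PE" using y(1) z(1) by simp
    then have "h (u + v) = (\<Sum>k<n+m. B (?y k))" unfolding uv by (rule h_eq)
    also have "\<dots> = h u + h v" unfolding y(2) z(2) h_eq[OF y(1)] h_eq[OF z(1)] by (rule sum_append[where f=B and y=y and z=z])
    finally show ?thesis .
  qed
  obtain i where i: "i \<in> I" using ne by auto
  have h_scale: "h (pointwise_scale c u) = t c (h u)" if u: "u \<in> alg" for u c
  proof -
    obtain n :: nat and y where y: "\<forall>k<n. y k \<in> PE" "u = (\<Sum>k<n. el (y k))" using alg_rep[OF u] by blast
    let ?y = "\<lambda>k. (y k)(i := s c (y k i))"
    have y': "\<forall>k<n. ?y k \<in> PE"
      using y(1) i by (simp add: PiE_upd E_closed PiE_mem[of _ I E i])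
    have cu: "pointwise_scale c u = (\<Sum>k<n. el (?y k))"
      unfolding y(2) ptw.scale_sum_right using el_scale[OF _ i] y(1) by (intro sum.cong) auto
    have "h (pointwise_scale c u) = (\<Sum>k<n. B (?y k))" unfolding cu by (rule h_eq[OF y'])
    also have "\<dots> = (\<Sum>k<n. t c (B (y k)))"
    proof (intro sum.cong refl)
      fix k assume "k \<in> {..<n}"
      then have "y k \<in> PE" using y(1) by simp
      then show "B (?y k) = t c (B (y k))"
        using multilinear_mapD(2)[OF B _ i, of "y k" "y k i" c] PiE_mem[OF _ i] by auto
    qed
    also have "\<dots> = t c (h u)" unfolding y(2) h_eq[OF y(1)] t.scale_sum_right ..
    finally show ?thesis .
  qed
  have h_bound: "norm (h u) \<le> C * norm (j u)" if u: "u \<in> alg" for u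
  proof (rule field_le_epsilon)
    fix e :: real assume e: "0 < e"
    \<comment> \<open>The slack is divided by \<open>C + 1\<close> so that \<open>C = 0\<close> is
      covered too.\<close>
    have "projective_norm s I E nrm u < norm (j u) + e / (C + 1)" using e C by (simp add: j_norm[OF u])
    from pn_approx[OF u this] obtain n :: nat and y where y: "\<forall>k<n. y k \<in> PE" "u = (\<Sum>k<n. el (y k))"
      and l: "(\<Sum>k<n. wt (y k)) < norm (j u) + e / (C + 1)" by blast
    have "norm (h u) \<le> (\<Sum>k<n. norm (B (y k)))" unfolding y(2) h_eq[OF y(1)] by (rule norm_sum)
    also have "\<dots> \<le> (\<Sum>k<n. C * wt (y k))" using y(1) by (intro sum_mono bd) auto
    also have "\<dots> = C * (\<Sum>k<n. wt (y k))" by (simp add: sum_distrib_left)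
    also have "\<dots> \<le> C * (norm (j u) + e / (C + 1))" using C l by (intro mult_left_mono) auto
    also have "\<dots> \<le> C * norm (j u) + e"
      using C e by (simp add: field_simps)
    finally show "norm (h u) \<le> C * norm (j u) + e" .
  qed
  have j_diff: "j (u - v) = j u - j v" and h_diff: "h (u - v) = h u - h v" and diff: "u - v \<in> alg"
    if u: "u \<in> alg" and v: "v \<in> alg" for u v
  proof -
    show d: "u - v \<in> alg" by (rule ptw.subspace_diff[OF alg_subspace u v])
    have "j u = j (u - v) + j v" using linear_onD(1)[OF j_lin d v] by (simp only: diff_add_cancel)
    then show "j (u - v) = j u - j v" by simp
    have "h u = h (u - v) + h v" using h_add[OF d v] by (simp only: diff_add_cancel)
    then show "h (u - v) = h u - h v" by simp
  qed
  \<comment> \<open>No injectivity of \<open>j\<close> is claimed: \<open>h_bound\<close> shows that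
    \<open>h\<close> is constant on the fibres of \<open>j\<close>.\<close>
  define g0 where "g0 x = h (SOME u. u \<in> alg \<and> j u = x)" for x
  have g0: "g0 (j u) = h u" if u: "u \<in> alg" for u
  proof -
    define v where "v = (SOME v. v \<in> alg \<and> j v = j u)"
    have v: "v \<in> alg" "j v = j u" using someI[of "\<lambda>v. v \<in> alg \<and> j v = j u" u] u unfolding v_def by auto
    have "norm (h v - h u) \<le> C * norm (j v - j u)"
      unfolding h_diff[OF v(1) u, symmetric] j_diff[OF v(1) u, symmetric] by (rule h_bound[OF diff[OF v(1) u]])
    then show ?thesis using v(2) by (simp add: g0_def v_def)
  qed
  have "C-lipschitz_on (j ` alg) g0"
  proof (rule lipschitz_onI[OF _ C])
    fix x y assume "x \<in> j ` alg" "y \<in> j ` alg"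
    then obtain u v where uv: "u \<in> alg" "x = j u" "v \<in> alg" "y = j v" by auto
    show "dist (g0 x) (g0 y) \<le> C * dist x y"
      unfolding dist_norm uv(2,4) g0[OF uv(1)] g0[OF uv(3)] h_diff[OF uv(1,3), symmetric] j_diff[OF uv(1,3), symmetric]
      by (rule h_bound[OF diff[OF uv(1,3)]])
  qed
  then have "uniformly_continuous_on (j ` alg) g0" by (rule lipschitz_on_uniformly_continuous)
  then obtain F where F: "uniformly_continuous_on X F" and Fg: "\<And>x. x \<in> j ` alg \<Longrightarrow> g0 x = F x"
    unfolding X_def using uniformly_continuous_on_extension_on_closure by metis
  have Fh: "F (j u) = h u" if "u \<in> alg" for u using Fg[OF imageI[OF that]] g0[OF that] by simp
  have cont: "continuous_on X F" using F by (rule uniformly_continuous_imp_continuous)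
  have seq: "(\<lambda>n. F (f n)) \<longlonglongrightarrow> F l" if "f \<longlonglongrightarrow> l" "l \<in> X" "\<And>n. f n \<in> X" for f :: "nat \<Rightarrow> 'x" and l
    by (rule continuous_on_tendsto_compose[OF cont that(1,2)]) (simp add: that(3))
  have Fapp: "\<exists>a. (\<forall>n. a n \<in> alg) \<and> (\<lambda>n. j (a n)) \<longlonglongrightarrow> x \<and> (\<lambda>n. h (a n)) \<longlonglongrightarrow> F x" if x: "x \<in> X" for x
  proof -
    obtain f where f: "\<forall>n. f n \<in> j ` alg" "f \<longlonglongrightarrow> x" using x unfolding X_def closure_sequential by blast
    then have "\<forall>n. \<exists>a. a \<in> alg \<and> f n = j a" by blast
    then obtain a where a: "\<And>n. a n \<in> alg" "\<And>n. f n = j (a n)" by metis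
    have "f = (\<lambda>n. j (a n))" using a(2) by blast
    with f(2) have ja: "(\<lambda>n. j (a n)) \<longlonglongrightarrow> x" by simp
    then have "(\<lambda>n. F (j (a n))) \<longlonglongrightarrow> F x"
      by (rule seq) (simp_all add: x alg_in_X a(1))
    then show ?thesis using a(1) ja by (intro exI[of _ a]) (simp add: Fh)
  qed
  have Flin: "linear_on smul t X F" unfolding linear_on_def
  proof (intro conjI ballI allI)
    fix x y c assume x: "x \<in> X"
    obtain a where a: "\<forall>n. a n \<in> alg" "(\<lambda>n. j (a n)) \<longlonglongrightarrow> x" "(\<lambda>n. h (a n)) \<longlonglongrightarrow> F x" using Fapp[OF x] by blast
    have "(\<lambda>n. F (j (pointwise_scale c (a n)))) \<longlonglongrightarrow> F (smul c x)"
    proof (rule seq)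
      show "(\<lambda>n. j (pointwise_scale c (a n))) \<longlonglongrightarrow> smul c x"
        using a(1) by (simp add: linear_onD(2)[OF j_lin] continuous_smul[OF a(2)])
    qed (use a x in \<open>auto intro!: X_closed alg_in_X ptw.subspace_scale[OF alg_subspace]\<close>)
    then have "(\<lambda>n. t c (h (a n))) \<longlonglongrightarrow> F (smul c x)"
      using a(1) by (simp add: Fh h_scale ptw.subspace_scale[OF alg_subspace])
    moreover have "(\<lambda>n. t c (h (a n))) \<longlonglongrightarrow> t c (F x)"
    proof (rule LIM_zero_cancel)
      have "norm (t c (h (a n)) - t c (F x)) = norm c * norm (h (a n) - F x)" for n
        by (metis t.norm_smul t.scale_right_diff_distrib)
      moreover have "(\<lambda>n. norm c * norm (h (a n) - F x)) \<longlonglongrightarrow> 0"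
        using a(3) by (intro tendsto_mult_right_zero tendsto_norm_zero LIM_zero)
      ultimately show "(\<lambda>n. t c (h (a n)) - t c (F x)) \<longlonglongrightarrow> 0"
        by (subst tendsto_norm_zero_iff[symmetric]) simp
    qed
    ultimately show "F (smul c x) = t c (F x)" by (rule LIMSEQ_unique)
    assume y: "y \<in> X"
    obtain b where b: "\<forall>n. b n \<in> alg" "(\<lambda>n. j (b n)) \<longlonglongrightarrow> y" "(\<lambda>n. h (b n)) \<longlonglongrightarrow> F y" using Fapp[OF y] by blast
    have "(\<lambda>n. F (j (a n) + j (b n))) \<longlonglongrightarrow> F (x + y)"
      by (rule seq) (use a b x y in \<open>auto intro!: X_closed alg_in_X tendsto_add\<close>)
    moreover have "F (j (a n) + j (b n)) = h (a n) + h (b n)" for n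
    proof -
      have ab: "a n \<in> alg" "b n \<in> alg" using a(1) b(1) by auto
      show ?thesis
        using linear_onD(1)[OF j_lin ab] h_add[OF ab] Fh[OF ptw.subspace_add[OF alg_subspace ab]] by simp
    qed
    ultimately have "(\<lambda>n. h (a n) + h (b n)) \<longlonglongrightarrow> F (x + y)" by simp
    then show "F (x + y) = F x + F y" using tendsto_add[OF a(3) b(3)] LIMSEQ_unique by blast
  qed
  have Fbd: "norm (F x) \<le> C * norm x" if x: "x \<in> X" for x
  proof -
    obtain a where a: "\<forall>n. a n \<in> alg" "(\<lambda>n. j (a n)) \<longlonglongrightarrow> x" "(\<lambda>n. h (a n)) \<longlonglongrightarrow> F x" using Fapp[OF x] by blast
    have 1: "(\<lambda>n. norm (h (a n))) \<longlonglongrightarrow> norm (F x)" by (rule tendsto_norm[OF a(3)])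
    have 2: "(\<lambda>n. C * norm (j (a n))) \<longlonglongrightarrow> C * norm x" by (intro tendsto_intros a(2))
    show ?thesis by (rule LIMSEQ_le[OF 1 2]) (use a(1) h_bound in blast)
  qed
  have "F (tau x) = B x" if x: "x \<in> PE" for x
  proof -
    have "h (\<Sum>k<Suc 0. el x) = (\<Sum>k<Suc 0. B x)" by (rule h_eq) (simp add: x)
    then have "h (el x) = B x" by (simp add: lessThan_Suc)
    then show ?thesis unfolding tau_def using Fh[OF el_in_alg[OF x]] by simp
  qed
  with Flin Fbd show ?thesis using that by blast
qed

end

section \<open>Bounded operators on the completed tensor product\<close>

lemma linear_on_sum:
  assumes F: "linear_on s1 s2 S F" and S: "module.subspace s1 S" and v: "vector_space s1"
    and u: "\<And>k. k \<in> K \<Longrightarrow> u k \<in> S"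
  shows "F (\<Sum>k\<in>K. u k) = (\<Sum>k\<in>K. F (u k))"
proof -
  interpret vector_space s1 by (rule v)
  have 0: "0 \<in> S" using S by (rule subspace_0)
  have F0: "F 0 = 0" using linear_onD(1)[OF F 0 0] by simp
  show ?thesis using u
  proof (induction K rule: infinite_finite_induct)
    case (insert k K)
    then have "F (u k + sum u K) = F (u k) + F (sum u K)"
      by (intro linear_onD(1)[OF F] subspace_sum[OF S]) auto
    then show ?case using insert by simp
  qed (use F0 in auto)
qed

context projective_tensor
begin

lemma scaleR_eq: "r *\<^sub>R u = smul (of_real r) u"
  by (simp add: smul_of_real)

lemma X_scaleR: "u \<in> X \<Longrightarrow> r *\<^sub>R u \<in> X"
  by (simp add: scaleR_eq X_closed)

lemma vs_smul: "vector_space smul" ..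

lemma lin0:
  assumes "linear_on smul t X F" shows "F 0 = (0 :: 'y :: ab_group_add)"
  using linear_onD(1)[OF assms X_closed(1) X_closed(1)] by simp

lemma lin_sum:
  assumes "linear_on smul t X F" "\<And>k. k \<in> K \<Longrightarrow> u k \<in> X"
  shows "F (\<Sum>k\<in>K. u k) = (\<Sum>k\<in>K. F (u k) :: 'y :: ab_group_add)"
  using linear_on_sum[OF assms(1) X_subspace vs_smul assms(2)] .

lemma lin_diff:
  assumes "linear_on smul t X F" "u \<in> X" "v \<in> X"
  shows "F (u - v) = (F u - F v :: 'y :: ab_group_add)"
  using linear_onD(1)[OF assms(1) X_closed(4)[OF assms(2,3)] assms(3)] by simp

text \<open>The bound is a parameter because limits of operators need one bound for a whole
  sequence.\<close>

definition bop :: "real \<Rightarrow> ('x \<Rightarrow> 'x) \<Rightarrow> bool" where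
  "bop K T \<longleftrightarrow> 0 \<le> K \<and> (\<forall>u\<in>X. T u \<in> X) \<and> linear_on smul smul X T \<and> (\<forall>u\<in>X. norm (T u) \<le> K * norm u)"

lemma bopD:
  assumes "bop K T"
  shows "0 \<le> K" "u \<in> X \<Longrightarrow> T u \<in> X" "linear_on smul smul X T" "u \<in> X \<Longrightarrow> norm (T u) \<le> K * norm u"
  using assms by (auto simp: bop_def)

lemma bop_arith:
  assumes "bop K T"
  shows "u \<in> X \<Longrightarrow> v \<in> X \<Longrightarrow> T (u + v) = T u + T v" "u \<in> X \<Longrightarrow> T (smul c u) = smul c (T u)"
    "u \<in> X \<Longrightarrow> v \<in> X \<Longrightarrow> T (u - v) = T u - T v" "T 0 = 0"
    "(\<And>k. k \<in> F \<Longrightarrow> f k \<in> X) \<Longrightarrow> T (\<Sum>k\<in>F. f k) = (\<Sum>k\<in>F. T (f k))"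
  using bopD(3)[OF assms] by (auto simp: linear_onD lin_diff lin0 lin_sum)

lemma bop_id: "bop 1 (\<lambda>u. u)"
  by (auto simp: bop_def linear_on_def)

lemma bopI:
  assumes "0 \<le> K" "\<And>u. u \<in> X \<Longrightarrow> T u \<in> X" "\<And>u v. u \<in> X \<Longrightarrow> v \<in> X \<Longrightarrow> T (u + v) = T u + T v"
    "\<And>u c. u \<in> X \<Longrightarrow> T (smul c u) = smul c (T u)" "\<And>u. u \<in> X \<Longrightarrow> norm (T u) \<le> K * norm u"
  shows "bop K T"
  using assms by (auto simp: bop_def linear_on_def)

lemma bop_comp:
  assumes T: "bop K T" and S: "bop L S" shows "bop (K * L) (\<lambda>u. T (S u))"
proof (rule bopI)
  fix u assume u: "u \<in> X"
  have "norm (T (S u)) \<le> K * norm (S u)" by (rule bopD(4)[OF T bopD(2)[OF S u]])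
  also have "\<dots> \<le> K * (L * norm u)" by (intro mult_left_mono bopD(4)[OF S u] bopD(1)[OF T])
  finally show "norm (T (S u)) \<le> K * L * norm u" by (simp add: mult.assoc)
qed (use bopD(1,2)[OF T] bopD(1,2)[OF S] in \<open>auto simp: bop_arith[OF T] bop_arith[OF S]\<close>)

lemma bop_add:
  assumes T: "bop K T" and S: "bop L S" shows "bop (K + L) (\<lambda>u. T u + S u)"
proof (rule bopI)
  fix u assume u: "u \<in> X"
  show "norm (T u + S u) \<le> (K + L) * norm u"
    unfolding distrib_right by (intro norm_triangle_mono bopD(4)[OF T u] bopD(4)[OF S u])
qed (use bopD(1,2)[OF T] bopD(1,2)[OF S] in \<open>auto simp: bop_arith[OF T] bop_arith[OF S] X_closed scale_right_distrib\<close>)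

lemma bop_smul:
  assumes T: "bop K T" shows "bop (norm c * K) (\<lambda>u. smul c (T u))"
proof (rule bopI)
  fix u assume u: "u \<in> X"
  show "norm (smul c (T u)) \<le> norm c * K * norm u"
    unfolding norm_smul mult.assoc by (intro mult_left_mono bopD(4)[OF T u]) auto
qed (use bopD(1,2)[OF T] in \<open>auto simp: bop_arith[OF T] X_closed scale_right_distrib mult.commute\<close>)

lemma bop_diff:
  assumes T: "bop K T" and S: "bop L S" shows "bop (K + L) (\<lambda>u. T u - S u)"
proof -
  have "bop (K + norm (- 1 :: 'k) * L) (\<lambda>u. T u + smul (- 1) (S u))"
    by (intro bop_add bop_smul T S)
  then show ?thesis by simp
qed

lemma bop_sum:
  assumes "\<And>k. k \<in> F \<Longrightarrow> bop (K k) (T k)"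
  shows "bop (\<Sum>k\<in>F. K k) (\<lambda>u. \<Sum>k\<in>F. T k u)"
  using assms
proof (induction F rule: infinite_finite_induct)
  case (insert k F)
  then show ?case using bop_add[of "K k" "T k" "sum K F" "\<lambda>u. \<Sum>k\<in>F. T k u"] by simp
qed (auto simp: bop_def linear_on_def X_closed)

lemma bop_mono: "bop K T \<Longrightarrow> K \<le> L \<Longrightarrow> bop L T"
  unfolding bop_def by (meson order_trans mult_right_mono norm_ge_zero)

lemma lin_tendsto:
  fixes F :: "'x \<Rightarrow> 'y :: real_normed_vector"
  assumes F: "linear_on smul t X F" and K: "\<And>u. u \<in> X \<Longrightarrow> norm (F u) \<le> K * norm u"
    and f: "f \<longlonglongrightarrow> l" "\<And>n. f n \<in> X" "l \<in> X"
  shows "(\<lambda>n. F (f n)) \<longlonglongrightarrow> F l"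
proof (rule LIM_zero_cancel, rule Lim_null_comparison)
  show "\<forall>\<^sub>F n in sequentially. norm (F (f n) - F l) \<le> K * norm (f n - l)"
    using K[OF X_closed(4)[OF f(2,3)]] by (simp add: lin_diff[OF F f(2,3)])
  show "(\<lambda>n. K * norm (f n - l)) \<longlonglongrightarrow> 0"
    using f(1) by (intro tendsto_mult_right_zero tendsto_norm_zero LIM_zero)
qed

lemma bop_tendsto:
  assumes "bop K T" "f \<longlonglongrightarrow> l" "\<And>n. f n \<in> X" "l \<in> X"
  shows "(\<lambda>n. T (f n)) \<longlonglongrightarrow> T l"
  using lin_tendsto[OF bopD(3,4)[OF assms(1)] assms(2-4)] .

lemma bop_continuous:
  assumes T: "bop K T" shows "continuous_on X T"
proof -
  have "K-lipschitz_on X T"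
    using T by (intro lipschitz_onI) (auto simp: dist_norm bop_arith(3)[OF T, symmetric] X_closed bopD)
  then show ?thesis by (rule lipschitz_on_continuous_on)
qed

lemma lin_unique:
  fixes F G :: "'x \<Rightarrow> 'y :: real_normed_vector"
  assumes F: "linear_on smul t X F" "\<And>u. u \<in> X \<Longrightarrow> norm (F u) \<le> K * norm u"
    and G: "linear_on smul t X G" "\<And>u. u \<in> X \<Longrightarrow> norm (G u) \<le> L * norm u"
    and eq: "\<And>x. x \<in> PE \<Longrightarrow> F (tau x) = G (tau x)" and u: "u \<in> X"
  shows "F u = G u"
proof -
  have "u \<in> {u \<in> X. F u = G u}"
  proof (rule X_induct[OF u])
    fix f l assume *: "\<And>n. f n \<in> {u \<in> X. F u = G u}" "f \<longlonglongrightarrow> l" "l \<in> X"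
    have "F (f n) = G (f n)" for n using *(1)[of n] by simp
    have "(\<lambda>n. F (f n)) \<longlonglongrightarrow> F l" by (rule lin_tendsto[OF F *(2) _ *(3)]) (use * in auto)
    moreover have "(\<lambda>n. G (f n)) \<longlonglongrightarrow> G l" by (rule lin_tendsto[OF G *(2) _ *(3)]) (use * in auto)
    ultimately show "l \<in> {u \<in> X. F u = G u}" using LIMSEQ_unique *(3) \<open>\<And>n. F (f n) = G (f n)\<close> by simp
  qed (auto simp: tau_in_X eq X_closed lin0[OF F(1)] lin0[OF G(1)] linear_onD[OF F(1)] linear_onD[OF G(1)])
  then show ?thesis by simp
qed

lemma bop_unique:
  assumes "bop K S" "bop L T" "\<And>x. x \<in> PE \<Longrightarrow> S (tau x) = T (tau x)" "u \<in> X"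
  shows "S u = T u"
  using lin_unique[OF bopD(3,4)[OF assms(1)] bopD(3,4)[OF assms(2)] assms(3,4)] .

text \<open>A bounded linear map is determined by its values at elementary tensors. It thus agrees
  with the map that \<open>universal\<close> builds from these values, and inherits the constant
  \<open>C\<close>.\<close>

lemma lin_bound:
  fixes F :: "'x \<Rightarrow> 'y :: {real_normed_vector, complete_space}"
  assumes t: "normed_space_over t" and F: "linear_on smul t X F" "\<And>u. u \<in> X \<Longrightarrow> norm (F u) \<le> K * norm u"
    and bd: "\<And>x. x \<in> PE \<Longrightarrow> norm (F (tau x)) \<le> C * wt x" and C: "0 \<le> C" and u: "u \<in> X"
  shows "norm (F u) \<le> C * norm u"
proof -
  have "multilinear_map s t I E (\<lambda>x. F (tau x))"
    unfolding multilinear_map_def linear_on_def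
    by (auto simp: multilinear_mapD[OF tau_multilinear] linear_onD[OF F(1)] tau_in_X PiE_upd)
  from universal[OF t this bd C] obtain G where
    G: "linear_on smul t X G" "\<And>u. u \<in> X \<Longrightarrow> norm (G u) \<le> C * norm u" "\<And>x. x \<in> PE \<Longrightarrow> G (tau x) = F (tau x)"
    by metis
  have "F u = G u" by (rule lin_unique[OF F G(1,2) G(3)[symmetric] u])
  with G(2)[OF u] show ?thesis by simp
qed

lemma normed_smul: "normed_space_over smul" ..

lemma bop_bound:
  assumes "bop K T" "\<And>x. x \<in> PE \<Longrightarrow> norm (T (tau x)) \<le> C * wt x" "0 \<le> C"
  shows "bop C T"
  using assms lin_bound[OF normed_smul bopD(3,4)[OF assms(1)] assms(2,3)] unfolding bop_def by blast

lemma bop_extend: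
  assumes "multilinear_map s smul I E B" "\<And>x. x \<in> PE \<Longrightarrow> norm (B x) \<le> C * wt x" "0 \<le> C"
    "\<And>x. x \<in> PE \<Longrightarrow> B x \<in> X"
  obtains T where "bop C T" "\<And>x. x \<in> PE \<Longrightarrow> T (tau x) = B x"
proof -
  obtain T where T: "linear_on smul smul X T" "\<And>u. u \<in> X \<Longrightarrow> norm (T u) \<le> C * norm u"
    "\<And>x. x \<in> PE \<Longrightarrow> T (tau x) = B x"
    using universal[OF normed_smul assms(1-3)] by metis
  have "T u \<in> X" if u: "u \<in> X" for u
  proof -
    have "u \<in> {u \<in> X. T u \<in> X}"
    proof (rule X_induct[OF u])
      fix f l assume *: "\<And>n. f n \<in> {u \<in> X. T u \<in> X}" "f \<longlonglongrightarrow> l" "l \<in> X"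
      then have "(\<lambda>n. T (f n)) \<longlonglongrightarrow> T l" by (intro lin_tendsto[OF T(1,2)]) auto
      then have "T l \<in> X" using * closed_sequentially[OF closed_X, of "\<lambda>n. T (f n)"] by auto
      with * show "l \<in> {u \<in> X. T u \<in> X}" by simp
    qed (auto simp: tau_in_X T(3) assms(4) X_closed lin0[OF T(1)] linear_onD[OF T(1)])
    then show ?thesis by simp
  qed
  with T assms(3) have "bop C T" by (auto simp: bop_def)
  with T(3) show ?thesis using that by blast
qed

text \<open>A three-epsilon argument: the common bound \<open>C\<close> makes the set of points of
  convergence closed, so elementary tensors suffice.\<close>

lemma strong_convergence:
  assumes F: "\<And>n. bop C (F n)" and tau: "\<And>x. x \<in> PE \<Longrightarrow> convergent (\<lambda>n. F n (tau x))" and u: "u \<in> X"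
  shows "convergent (\<lambda>n. F n u)"
proof -
  have "u \<in> {u \<in> X. convergent (\<lambda>n. F n u)}"
  proof (rule X_induct[OF u])
    fix f l assume *: "\<And>n. f n \<in> {u \<in> X. convergent (\<lambda>n. F n u)}" "f \<longlonglongrightarrow> l" "l \<in> X"
    have "Cauchy (\<lambda>n. F n l)"
    proof (rule metric_CauchyI)
      fix e :: real assume e: "0 < e"
      have C: "0 \<le> C" using bopD(1)[OF F[of 0]] .
      have "0 < e / 3 / (C + 1)" using e C by simp
      with *(2) obtain m where m: "norm (f m - l) < e / 3 / (C + 1)" by (metis LIMSEQ_iff order_refl)
      have "Cauchy (\<lambda>n. F n (f m))" using *(1)[of m] by (simp add: convergent_Cauchy)
      then obtain M where M: "\<And>a b. a \<ge> M \<Longrightarrow> b \<ge> M \<Longrightarrow> dist (F a (f m)) (F b (f m)) < e / 3"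
        using e by (metis metric_CauchyD divide_pos_pos zero_less_numeral)
      have near: "dist (F a (f m)) (F a l) < e / 3" for a
      proof -
        have "dist (F a (f m)) (F a l) \<le> C * norm (f m - l)"
          using *(1)[of m] *(3) bopD(4)[OF F[of a], of "f m - l"] by (simp add: dist_norm bop_arith(3)[OF F] X_closed)
        also have "\<dots> \<le> (C + 1) * norm (f m - l)" by (intro mult_right_mono) auto
        also have "\<dots> < e / 3" using m C by (simp add: field_simps)
        finally show ?thesis .
      qed
      show "\<exists>M. \<forall>a\<ge>M. \<forall>b\<ge>M. dist (F a l) (F b l) < e"
      proof (intro exI allI impI)
        fix a b assume "M \<le> a" "M \<le> b"
        have "dist (F a l) (F b l) \<le> dist (F a (f m)) (F a l) + dist (F a (f m)) (F b (f m)) + dist (F b (f m)) (F b l)"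
          by metric
        then show "dist (F a l) (F b l) < e" using near[of a] near[of b] M[OF \<open>M \<le> a\<close> \<open>M \<le> b\<close>] by simp
      qed
    qed
    then show "l \<in> {u \<in> X. convergent (\<lambda>n. F n u)}" using *(3) by (simp add: Cauchy_convergent_iff)
  qed (auto simp: tau_in_X tau X_closed bop_arith[OF F] convergent_const intro: convergent_add)
  then show ?thesis by simp
qed

lemma bop_limit:
  assumes F: "\<And>n. bop C (F n)" and lim: "\<And>u. u \<in> X \<Longrightarrow> (\<lambda>n. F n u) \<longlonglongrightarrow> G u"
  shows "bop C G"
proof -
  have "linear_on smul smul X G" unfolding linear_on_def
  proof (intro conjI ballI allI)
    fix u v c assume u: "u \<in> X"
    have "(\<lambda>n. F n (smul c u)) \<longlonglongrightarrow> smul c (G u)"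
      using continuous_smul[OF lim[OF u]] by (simp add: bop_arith[OF F] u)
    then show "G (smul c u) = smul c (G u)" using lim[of "smul c u"] u LIMSEQ_unique X_closed by blast
    assume v: "v \<in> X"
    have "(\<lambda>n. F n (u + v)) \<longlonglongrightarrow> G u + G v"
      using tendsto_add[OF lim[OF u] lim[OF v]] by (simp add: bop_arith[OF F] u v)
    then show "G (u + v) = G u + G v" using lim[of "u + v"] u v LIMSEQ_unique X_closed by blast
  qed
  moreover have "G u \<in> X" if "u \<in> X" for u
    using closed_sequentially[OF closed_X _ lim[OF that]] bopD(2)[OF F that] by blast
  moreover have "norm (G u) \<le> C * norm u" if "u \<in> X" for u
    using Lim_bounded[OF tendsto_norm[OF lim[OF that]]] bopD(4)[OF F that] by blast
  ultimately show ?thesis using bopD(1)[OF F[of 0]] by (auto simp: bop_def)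
qed

section \<open>Scaling, substitution and expansion in multilinear maps\<close>

lemma multilinear_scale:
  assumes B: "multilinear_map s t I E B" and t: "vector_space t" and x: "x \<in> PE"
  shows "B (\<lambda>i\<in>I. s (c i) (x i)) = t (\<Prod>i\<in>I. c i) (B x)"
proof -
  interpret t: vector_space t by (rule t)
  have "B (\<lambda>i\<in>I. if i \<in> J then s (c i) (x i) else x i) = t (\<Prod>i\<in>J. c i) (B x)" if "J \<subseteq> I" for J
    using finite_subset[OF that fin] that
  proof (induction J)
    case empty
    have "(\<lambda>i\<in>I. x i) = x" using x by auto
    then show ?case by simp
  next
    case (insert h J)
    let ?y = "\<lambda>i\<in>I. if i \<in> J then s (c i) (x i) else x i"
    have y: "?y \<in> PE" using x by (auto simp: PiE_iff E_closed)
    have h: "h \<in> I" "x h \<in> E h" using insert x by auto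
    have "(\<lambda>i\<in>I. if i \<in> insert h J then s (c i) (x i) else x i) = ?y(h := s (c h) (x h))" using h by auto
    then have "B (\<lambda>i\<in>I. if i \<in> insert h J then s (c i) (x i) else x i) = t (c h) (B (?y(h := x h)))"
      using multilinear_mapD(2)[OF B y h] by simp
    also have "?y(h := x h) = ?y" using h insert.hyps by auto
    finally show ?case using insert by simp
  qed
  from this[of I] show ?thesis by (simp add: restrict_def cong: if_cong)
qed

lemma multilinear_pre:
  assumes B: "multilinear_map s t I E B"
    and h: "\<And>i. i \<in> I \<Longrightarrow> linear_on s s (E i) (h i)" "\<And>i v. i \<in> I \<Longrightarrow> v \<in> E i \<Longrightarrow> h i v \<in> E i"
  shows "multilinear_map s t I E (\<lambda>x. B (\<lambda>i\<in>I. h i (x i)))"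
proof -
  have *: "(\<lambda>i\<in>I. h i (if i = k then v else x i)) = (\<lambda>i\<in>I. h i (x i))(k := h k v)" if "k \<in> I" for x k v
    using that by auto
  have m: "(\<lambda>i\<in>I. h i (x i)) \<in> PE" if "x \<in> PE" for x using that h(2) by (auto simp: PiE_iff)
  show ?thesis unfolding multilinear_map_def linear_on_def
    by (auto simp: * linear_onD[OF h(1)] h(2) multilinear_mapD[OF B m])
qed

text \<open>Induction on the set \<open>J\<close> of coordinates whose sums have already been
  multiplied out.\<close>

lemma multilinear_expand:
  fixes B :: "('i \<Rightarrow> 'v) \<Rightarrow> 'y::ab_group_add"
  assumes B: "multilinear_map s t I E B" and fK: "\<And>i. i \<in> I \<Longrightarrow> finite (K i)"
    and y: "\<And>i k. i \<in> I \<Longrightarrow> k \<in> K i \<Longrightarrow> y i k \<in> E i"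
  shows "B (\<lambda>i\<in>I. \<Sum>k\<in>K i. y i k) = (\<Sum>\<alpha>\<in>Pi\<^sub>E I K. B (\<lambda>i\<in>I. y i (\<alpha> i)))"
proof -
  define S where "S i = (\<Sum>k\<in>K i. y i k)" for i
  have S: "S i \<in> E i" if "i \<in> I" for i
    unfolding S_def using that y subE by (intro fac.subspace_sum) auto
  have "B (\<lambda>i\<in>I. S i) = (\<Sum>\<alpha>\<in>Pi\<^sub>E J K. B (\<lambda>i\<in>I. if i \<in> J then y i (\<alpha> i) else S i))" if "J \<subseteq> I" for J
    using finite_subset[OF that fin] that
  proof (induction J)
    case empty
    then show ?case by simp
  next
    case (insert h J)
    have h: "h \<in> I" "h \<notin> J" and J: "J \<subseteq> I" using insert by auto
    have add: "B (x(h := \<Sum>k\<in>A. y h k)) = (\<Sum>k\<in>A. B (x(h := y h k)))" if x: "x \<in> PE" and A: "A \<subseteq> K h" for x A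
      using linear_on_sum[of s t "E h" "\<lambda>v. B (x(h := v))" A "y h"] subE[OF h(1)] fac.vector_space_axioms
        B x h y A unfolding multilinear_map_def by blast
    have "(\<Sum>\<alpha>\<in>Pi\<^sub>E (insert h J) K. B (\<lambda>i\<in>I. if i \<in> insert h J then y i (\<alpha> i) else S i))
      = (\<Sum>(k, \<alpha>)\<in>K h \<times> Pi\<^sub>E J K. B (\<lambda>i\<in>I. if i \<in> insert h J then y i ((\<alpha>(h := k)) i) else S i))"
      unfolding PiE_insert_eq using h
      by (subst sum.reindex[OF inj_combinator]) (auto simp: o_def case_prod_unfold)
    also have "\<dots> = (\<Sum>\<alpha>\<in>Pi\<^sub>E J K. \<Sum>k\<in>K h. B (\<lambda>i\<in>I. if i \<in> insert h J then y i ((\<alpha>(h := k)) i) else S i))"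
      by (subst sum.cartesian_product[symmetric]) (rule sum.swap)
    also have "\<dots> = (\<Sum>\<alpha>\<in>Pi\<^sub>E J K. B (\<lambda>i\<in>I. if i \<in> J then y i (\<alpha> i) else S i))"
    proof (rule sum.cong[OF refl])
      fix \<alpha> assume \<alpha>: "\<alpha> \<in> Pi\<^sub>E J K"
      let ?x = "\<lambda>i\<in>I. if i \<in> J then y i (\<alpha> i) else S i"
      have x: "?x \<in> PE" using \<alpha> J by (auto simp: PiE_iff y S)
      have "(\<lambda>i\<in>I. if i \<in> insert h J then y i ((\<alpha>(h := k)) i) else S i) = ?x(h := y h k)" for k
        using h by auto
      moreover have "?x = ?x(h := \<Sum>k\<in>K h. y h k)" using h by (auto simp: S_def)
      ultimately show "(\<Sum>k\<in>K h. B (\<lambda>i\<in>I. if i \<in> insert h J then y i ((\<alpha>(h := k)) i) else S i)) = B ?x"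
        using add[OF x order_refl] by simp
    qed
    finally show ?case unfolding insert.IH[OF J] by (rule sym)
  qed
  from this[of I] show ?thesis by (simp add: restrict_def S_def cong: if_cong)
qed

lemma tens_exists:
  assumes h: "\<And>i. i \<in> I \<Longrightarrow> linear_on s s (E i) (h i)" "\<And>i v. i \<in> I \<Longrightarrow> v \<in> E i \<Longrightarrow> h i v \<in> E i"
    and b: "\<And>i v. i \<in> I \<Longrightarrow> v \<in> E i \<Longrightarrow> nrm i (h i v) \<le> nrm i v"
  shows "\<exists>T. bop 1 T \<and> (\<forall>x\<in>PE. T (tau x) = tau (\<lambda>i\<in>I. h i (x i)))"
proof -
  have m: "(\<lambda>i\<in>I. h i (x i)) \<in> PE" if "x \<in> PE" for x using that h(2) by (auto simp: PiE_iff)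
  have "norm (tau (\<lambda>i\<in>I. h i (x i))) \<le> 1 * wt x" if x: "x \<in> PE" for x
    using norm_tau_le[OF m[OF x]] x unfolding wt_def
    by (auto intro!: order_trans[OF norm_tau_le[OF m[OF x]]] prod_mono b simp: wt_def nrm_nonneg PiE_iff)
  from bop_extend[OF multilinear_pre[OF tau_multilinear h] this _ tau_in_X[OF m]] show ?thesis
    by (metis zero_le_one)
qed

lemma nrm0: "i \<in> I \<Longrightarrow> nrm i 0 = 0"
  using nrm_scale[of i 0 0] E_closed(1) by simp

lemma tau_eq_0: "x \<in> PE \<Longrightarrow> wt x = 0 \<Longrightarrow> tau x = 0"
  using norm_tau_le[of x] by simp

lemma tau_normalize:
  assumes x: "x \<in> PE"
  shows "\<exists>y\<in>PE. (\<forall>i\<in>I. nrm i (y i) \<le> 1) \<and> tau x = wt x *\<^sub>R tau y"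
proof (cases "wt x = 0")
  case True
  then show ?thesis using tau_eq_0[OF x True]
    by (intro bexI[of _ "\<lambda>i\<in>I. 0"]) (auto simp: nrm0 E_closed)
next
  case False
  then have nz: "nrm i (x i) > 0" if "i \<in> I" for i
    using that fin nrm_nonneg[of i "x i"] unfolding wt_def by (auto simp: less_le)
  let ?y = "\<lambda>i\<in>I. s (of_real (inverse (nrm i (x i)))) (x i)"
  have xi: "x i \<in> E i" if "i \<in> I" for i using x that by auto
  have y: "?y \<in> PE" by (auto simp: E_closed xi)
  have "tau ?y = smul (\<Prod>i\<in>I. of_real (inverse (nrm i (x i)))) (tau x)"
    by (rule multilinear_scale[OF tau_multilinear vs_smul x])
  also have "\<dots> = inverse (wt x) *\<^sub>R tau x"
    unfolding scaleR_eq wt_def prod_inversef[unfolded o_def, symmetric] of_real_prod ..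
  finally have "tau x = wt x *\<^sub>R tau ?y" using False by simp
  moreover have "nrm i (?y i) \<le> 1" if i: "i \<in> I" for i
    using i nz[OF i] by (simp add: nrm_scale xi norm_inverse)
  ultimately show ?thesis using y by blast
qed

text \<open>The closed unit ball of \<open>X\<close> is the closed convex hull of the elementary tensors of vectors in the unit balls.\<close>

lemma unit_ball:
  fixes F :: "'x \<Rightarrow> 'x"
  assumes F: "bop K F"
    and el: "\<And>y. y \<in> PE \<Longrightarrow> (\<And>i. i \<in> I \<Longrightarrow> nrm i (y i) \<le> 1) \<Longrightarrow> norm (a + F (tau y)) \<le> r"
    and w: "w \<in> X" "norm w \<le> 1"
  shows "norm (a + F w) \<le> r"
proof -
  \<comment> \<open>The zero tensor bounds \<open>a\<close> alone; this is needed for the weight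
    that a representation leaves over.\<close>
  have "tau (\<lambda>i\<in>I. 0) = 0" using fin ne by (intro tau_eq_0) (auto simp: E_closed wt_def nrm0)
  with el[of "\<lambda>i\<in>I. 0"] have a: "norm a \<le> r" by (auto simp: E_closed nrm0 bop_arith[OF F])
  have el': "norm (wt x *\<^sub>R a + F (tau x)) \<le> wt x * r" if x: "x \<in> PE" for x
  proof -
    obtain y where y: "y \<in> PE" "\<And>i. i \<in> I \<Longrightarrow> nrm i (y i) \<le> 1" "tau x = wt x *\<^sub>R tau y"
      using tau_normalize[OF x] by blast
    have "wt x *\<^sub>R a + F (tau x) = wt x *\<^sub>R (a + F (tau y))"
      unfolding y(3) scaleR_eq bop_arith(2)[OF F tau_in_X[OF y(1)]] by (simp add: scale_right_distrib)
    then show ?thesis using el[OF y(1,2)] wt_nonneg[of x] by (simp add: mult_left_mono)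
  qed
  have 1: "norm (a + F (j u)) \<le> r" if u: "u \<in> alg" "norm (j u) < 1" for u
  proof -
    have "projective_norm s I E nrm u < 1" using u j_norm by simp
    from pn_approx[OF u(1) this] obtain n :: nat and y where
      y: "\<forall>k<n. y k \<in> PE" "u = (\<Sum>k<n. el (y k))" and l: "(\<Sum>k<n. wt (y k)) < 1" by blast
    have "j u = (\<Sum>k<n. tau (y k))" unfolding y(2) tau_def using y(1) by (intro j_sum el_in_alg) auto
    moreover have "F (\<Sum>k<n. tau (y k)) = (\<Sum>k<n. F (tau (y k)))"
      by (rule bop_arith(5)[OF F]) (simp add: tau_in_X y(1))
    ultimately have "F (j u) = (\<Sum>k<n. F (tau (y k)))" by simp
    \<comment> \<open>The weights add up to less than 1; the missing weight is put on
      \<open>a\<close>, that is, on the zero tensor.\<close>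
    then have "a + F (j u) = (1 - (\<Sum>k<n. wt (y k))) *\<^sub>R a + (\<Sum>k<n. wt (y k) *\<^sub>R a + F (tau (y k)))"
      by (simp add: algebra_simps sum.distrib scaleR_sum_left)
    also have "norm \<dots> \<le> (1 - (\<Sum>k<n. wt (y k))) * r + (\<Sum>k<n. wt (y k) * r)"
      using l a y(1) by (intro norm_triangle_mono sum_norm_le el') (auto intro: mult_left_mono)
    also have "\<dots> = r" by (simp add: algebra_simps sum_distrib_left)
    finally show ?thesis .
  qed
  obtain f where f: "\<forall>n. f n \<in> j ` alg" "f \<longlonglongrightarrow> w" using w(1) unfolding X_def closure_sequential by blast
  \<comment> \<open>Scales \<open>f n\<close> into the open unit ball. The summand
    \<open>1 / Suc n\<close> makes the inequality strict, and the factors tend to 1 because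
    \<open>norm w \<le> 1\<close>.\<close>
  define c where "c n = 1 / (max 1 (norm (f n)) + 1 / Suc n)" for n
  have c: "c n > 0" "c n * norm (f n) < 1" for n
  proof -
    have "norm (f n) < max 1 (norm (f n)) + 1 / Suc n" "0 < max 1 (norm (f n)) + 1 / Suc n"
      by (smt (verit) divide_pos_pos of_nat_0_less_iff zero_less_Suc)+
    then show "c n > 0" "c n * norm (f n) < 1" by (simp_all add: c_def)
  qed
  have "c \<longlonglongrightarrow> 1 / (max 1 (norm w) + 0)"
    unfolding c_def by (intro tendsto_intros f(2) LIMSEQ_Suc[OF lim_inverse_n', unfolded o_def] ) (auto simp: max_def)
  then have c1: "c \<longlonglongrightarrow> 1" using w(2) by (simp add: max_def split: if_splits)
  have cf: "(\<lambda>n. c n *\<^sub>R f n) \<longlonglongrightarrow> w" using tendsto_scaleR[OF c1 f(2)] by simp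
  have in_alg: "\<exists>u\<in>alg. c n *\<^sub>R f n = j u" for n
  proof -
    obtain u where "u \<in> alg" "f n = j u" using f(1) by blast
    then show ?thesis using linear_onD(2)[OF j_lin, of u "of_real (c n)"]
      by (intro bexI[of _ "pointwise_scale (of_real (c n)) u"]) (auto simp: scaleR_eq ptw.subspace_scale[OF alg_subspace])
  qed
  have "norm (a + F (c n *\<^sub>R f n)) \<le> r" for n
    using in_alg[of n] 1 c[of n] by (metis abs_of_pos norm_scaleR)
  moreover have "(\<lambda>n. norm (a + F (c n *\<^sub>R f n))) \<longlonglongrightarrow> norm (a + F w)"
    using in_alg alg_in_X by (intro tendsto_intros bop_tendsto[OF F cf _ w(1)]) metis
  ultimately show ?thesis using Lim_bounded by blast
qed

end

section \<open>Pelczynski's decomposition method\<close>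

text \<open>Unlike \<open>isomorphic\<close>, this compares sets in different types, as products
  require, and it records linearity of the inverse, which makes it visibly symmetric.\<close>

definition lin_homeo ::
  "('k \<Rightarrow> 'a::real_normed_vector \<Rightarrow> 'a) \<Rightarrow> 'a set \<Rightarrow> ('k \<Rightarrow> 'b::real_normed_vector \<Rightarrow> 'b) \<Rightarrow> 'b set \<Rightarrow> bool"
  where "lin_homeo s Y t Z \<longleftrightarrow>
    (\<exists>f g. homeomorphism Y Z f g \<and> linear_on s t Y f \<and> linear_on t s Z g)"

definition prod_scale :: "('k \<Rightarrow> 'a \<Rightarrow> 'a) \<Rightarrow> ('k \<Rightarrow> 'b \<Rightarrow> 'b) \<Rightarrow> 'k \<Rightarrow> 'a \<times> 'b \<Rightarrow> 'a \<times> 'b"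
  where "prod_scale s t c z = (s c (fst z), t c (snd z))"

lemma lin_homeo_sym: "lin_homeo s Y t Z \<Longrightarrow> lin_homeo t Z s Y"
  unfolding lin_homeo_def using homeomorphism_symD by blast

lemma lin_homeo_refl: "lin_homeo s Y s Y"
  unfolding lin_homeo_def linear_on_def by (intro exI[of _ "\<lambda>x. x"]) (auto simp: homeomorphism_def)

lemma lin_homeo_trans [trans]:
  assumes "lin_homeo s Y t Z" "lin_homeo t Z u W" shows "lin_homeo s Y u W"
proof -
  obtain f g where f: "homeomorphism Y Z f g" "linear_on s t Y f" "linear_on t s Z g"
    using assms(1) unfolding lin_homeo_def by blast
  obtain f' g' where f': "homeomorphism Z W f' g'" "linear_on t u Z f'" "linear_on u t W g'"
    using assms(2) unfolding lin_homeo_def by blast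
  have m: "\<And>y. y \<in> Y \<Longrightarrow> f y \<in> Z" "\<And>w. w \<in> W \<Longrightarrow> g' w \<in> Z"
    using f(1) f'(1) by (auto simp: homeomorphism_def)
  have "linear_on s u Y (f' \<circ> f)" "linear_on u s W (g \<circ> g')"
    unfolding linear_on_def
    by (auto simp: m linear_onD[OF f(2)] linear_onD[OF f(3)] linear_onD[OF f'(2)] linear_onD[OF f'(3)])
  with homeomorphism_compose[OF f(1) f'(1)] show ?thesis unfolding lin_homeo_def by blast
qed

lemma lin_homeoI:
  assumes "continuous_on Y f" "continuous_on Z g" "linear_on s t Y f" "linear_on t s Z g"
    "\<And>y. y \<in> Y \<Longrightarrow> f y \<in> Z" "\<And>z. z \<in> Z \<Longrightarrow> g z \<in> Y"
    "\<And>y. y \<in> Y \<Longrightarrow> g (f y) = y" "\<And>z. z \<in> Z \<Longrightarrow> f (g z) = z"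
  shows "lin_homeo s Y t Z"
  unfolding lin_homeo_def using assms by (intro exI[of _ f] exI[of _ g] conjI homeomorphismI) auto

lemma lin_homeo_Times:
  assumes "lin_homeo s Y s' Y'" "lin_homeo t Z t' Z'"
  shows "lin_homeo (prod_scale s t) (Y \<times> Z) (prod_scale s' t') (Y' \<times> Z')"
proof -
  obtain f g where f: "homeomorphism Y Y' f g" "linear_on s s' Y f" "linear_on s' s Y' g"
    using assms(1) unfolding lin_homeo_def by blast
  obtain f' g' where f': "homeomorphism Z Z' f' g'" "linear_on t t' Z f'" "linear_on t' t Z' g'"
    using assms(2) unfolding lin_homeo_def by blast
  have c: "continuous_on Y f" "continuous_on Y' g" "continuous_on Z f'" "continuous_on Z' g'"
    and [simp]: "\<And>y. y \<in> Y \<Longrightarrow> f y \<in> Y'" "\<And>y. y \<in> Y' \<Longrightarrow> g y \<in> Y"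
      "\<And>z. z \<in> Z \<Longrightarrow> f' z \<in> Z'" "\<And>z. z \<in> Z' \<Longrightarrow> g' z \<in> Z"
      "\<And>y. y \<in> Y \<Longrightarrow> g (f y) = y" "\<And>y. y \<in> Y' \<Longrightarrow> f (g y) = y"
      "\<And>z. z \<in> Z \<Longrightarrow> g' (f' z) = z" "\<And>z. z \<in> Z' \<Longrightarrow> f' (g' z) = z"
    using homeomorphism_cont1[OF f(1)] homeomorphism_cont2[OF f(1)] homeomorphism_cont1[OF f'(1)] homeomorphism_cont2[OF f'(1)]
      homeomorphism_image1[OF f(1)] homeomorphism_image2[OF f(1)] homeomorphism_image1[OF f'(1)] homeomorphism_image2[OF f'(1)]
      homeomorphism_apply1[OF f(1)] homeomorphism_apply2[OF f(1)] homeomorphism_apply1[OF f'(1)] homeomorphism_apply2[OF f'(1)]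
    by blast+
  note [simp] = linear_onD[OF f(2)] linear_onD[OF f(3)] linear_onD[OF f'(2)] linear_onD[OF f'(3)]
  show ?thesis
  proof (rule lin_homeoI[of _ "\<lambda>z. (f (fst z), f' (snd z))" _ "\<lambda>z. (g (fst z), g' (snd z))"])
    show "continuous_on (Y \<times> Z) (\<lambda>z. (f (fst z), f' (snd z)))"
      by (rule continuous_on_Pair[OF continuous_on_compose2[OF c(1) continuous_on_fst[OF continuous_on_id]]
            continuous_on_compose2[OF c(3) continuous_on_snd[OF continuous_on_id]]]) auto
    show "continuous_on (Y' \<times> Z') (\<lambda>z. (g (fst z), g' (snd z)))"
      by (rule continuous_on_Pair[OF continuous_on_compose2[OF c(2) continuous_on_fst[OF continuous_on_id]]
            continuous_on_compose2[OF c(4) continuous_on_snd[OF continuous_on_id]]]) auto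
  qed (auto simp: linear_on_def[of _ "prod_scale _ _"] linear_on_def[of "prod_scale _ _"] prod_scale_def)
qed

lemma lin_homeo_swap: "lin_homeo (prod_scale s t) (Y \<times> Z) (prod_scale t s) (Z \<times> Y)"
  by (rule lin_homeoI[of _ "\<lambda>z. (snd z, fst z)" _ "\<lambda>z. (snd z, fst z)"])
    (auto simp: linear_on_def prod_scale_def intro!: continuous_intros)

lemma lin_homeo_assoc:
  "lin_homeo (prod_scale (prod_scale s t) u) ((Y \<times> Z) \<times> W) (prod_scale s (prod_scale t u)) (Y \<times> (Z \<times> W))"
  by (rule lin_homeoI[of _ "\<lambda>z. (fst (fst z), snd (fst z), snd z)" _ "\<lambda>z. ((fst z, fst (snd z)), snd (snd z))"])
    (auto simp: linear_on_def prod_scale_def intro!: continuous_intros)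

text \<open>Pelczynski's decomposition method, with \<open>D\<close> in the role of an infinite direct sum of copies of \<open>X\<close>.\<close>

lemma pelczynski_decomposition:
  assumes XDW: "lin_homeo s X t (D \<times> W)" "t = prod_scale s s"
    and DXD: "lin_homeo s D t (X \<times> D)" and DYD: "lin_homeo s D t (Y \<times> D)" and YXV: "lin_homeo s Y t (X \<times> V)"
  shows "lin_homeo s X s Y"
proof -
  note [simp] = XDW(2)
  \<comment> \<open>What \<open>D\<close> absorbs is absorbed by \<open>X\<close>, since
    \<open>D\<close> is a factor of \<open>X\<close>: A + X = A + D + W = D + W = X.\<close>
  have absorb: "lin_homeo t (A \<times> X) s X" if "lin_homeo s D t (A \<times> D)" for A
  proof -
    have "lin_homeo t (A \<times> X) (prod_scale s t) (A \<times> (D \<times> W))"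
      using lin_homeo_Times[OF lin_homeo_refl[of s A] XDW(1)] by simp
    also have "lin_homeo (prod_scale s t) (A \<times> (D \<times> W)) (prod_scale t s) ((A \<times> D) \<times> W)"
      using lin_homeo_sym[OF lin_homeo_assoc] by simp
    also have "lin_homeo (prod_scale t s) ((A \<times> D) \<times> W) t (D \<times> W)"
      using lin_homeo_Times[OF lin_homeo_sym[OF that] lin_homeo_refl[of s W]] by simp
    also have "lin_homeo t (D \<times> W) s X" by (rule lin_homeo_sym[OF XDW(1)])
    finally show ?thesis .
  qed
  \<comment> \<open>The chain is Y = X + V = X + X + V = X + Y = X. The second equality absorbs
    \<open>X\<close>, the last absorbs \<open>Y\<close>.\<close>
  have "lin_homeo s Y t (X \<times> V)" by (rule YXV)
  also have "lin_homeo t (X \<times> V) (prod_scale t s) ((X \<times> X) \<times> V)"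
    using lin_homeo_Times[OF lin_homeo_sym[OF absorb[OF DXD]] lin_homeo_refl[of s V]] by simp
  also have "lin_homeo (prod_scale t s) ((X \<times> X) \<times> V) (prod_scale s t) (X \<times> (X \<times> V))"
    using lin_homeo_assoc by simp
  also have "lin_homeo (prod_scale s t) (X \<times> (X \<times> V)) t (X \<times> Y)"
    using lin_homeo_Times[OF lin_homeo_refl[of s X] lin_homeo_sym[OF YXV]] by simp
  also have "lin_homeo t (X \<times> Y) t (Y \<times> X)" using lin_homeo_swap by simp
  also have "lin_homeo t (Y \<times> X) s X" by (rule absorb[OF DYD])
  finally show ?thesis by (rule lin_homeo_sym)
qed

lemma lin_homeo_imp_isomorphic: "lin_homeo smul Y smul Z \<Longrightarrow> isomorphic smul Y Z"
  unfolding lin_homeo_def isomorphic_def by blast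

section \<open>Sequence spaces\<close>

text \<open>The p-th power of the norm, which is additive over disjoint supports.\<close>

definition psum :: "real \<Rightarrow> (nat \<Rightarrow> 'k::real_normed_field) \<Rightarrow> real"
  where "psum p x = (\<Sum>n. norm (x n) powr p)"

lemma lp_norm_psum: "lp_norm p x = psum p x powr (1 / p)"
  by (simp add: lp_norm_def psum_def)

lemma lp_sum_le: "x \<in> lp p \<Longrightarrow> finite F \<Longrightarrow> (\<Sum>n\<in>F. norm (x n) powr p) \<le> psum p x"
  unfolding lp_def psum_def by (intro sum_le_suminf) auto

lemma lp_boundI:
  assumes "\<And>F. finite F \<Longrightarrow> (\<Sum>n\<in>F. norm (x n) powr p) \<le> B"
  shows "x \<in> lp p" "psum p x \<le> B"
proof -
  show "x \<in> lp p" unfolding lp_def using assms by (auto intro!: summableI_nonneg_bounded[where x = B])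
  then show "psum p x \<le> B" unfolding lp_def psum_def using assms by (intro suminf_le_const) auto
qed

lemma psum_nonneg: "x \<in> lp p \<Longrightarrow> 0 \<le> psum p x"
  using lp_sum_le[of x p "{}"] by simp

lemma lp_norm_nonneg: "0 \<le> lp_norm p x"
  by (simp add: lp_norm_def)

lemma lp_norm_powr: "x \<in> lp p \<Longrightarrow> 0 < p \<Longrightarrow> lp_norm p x powr p = psum p x"
  by (simp add: lp_norm_psum powr_powr psum_nonneg)

lemma lp_norm_mono: "0 < p \<Longrightarrow> x \<in> lp p \<Longrightarrow> psum p x \<le> psum p y \<Longrightarrow> lp_norm p x \<le> lp_norm p y"
  unfolding lp_norm_psum by (intro powr_mono2) (auto simp: psum_nonneg)

lemma norm_le_lp_norm:
  assumes "0 < p" "x \<in> lp p" shows "norm (x n) \<le> lp_norm p x"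
proof -
  have "norm (x n) powr p \<le> psum p x" using lp_sum_le[OF assms(2), of "{n}"] by simp
  then have "(norm (x n) powr p) powr (1 / p) \<le> psum p x powr (1 / p)"
    using assms by (intro powr_mono2) auto
  then show ?thesis using assms by (simp add: powr_powr lp_norm_psum)
qed

lemma lp_scale:
  assumes "x \<in> lp p" "0 < p"
  shows "pointwise_scale c x \<in> lp p" "lp_norm p (pointwise_scale c x) = norm c * lp_norm p x"
proof -
  have s: "summable (\<lambda>n. norm (x n) powr p)" using assms by (simp add: lp_def)
  then show "pointwise_scale c x \<in> lp p"
    by (simp add: lp_def pointwise_scale_def norm_mult powr_mult summable_mult)
  have "psum p (pointwise_scale c x) = norm c powr p * psum p x"
    unfolding psum_def using suminf_mult[OF s, of "norm c powr p"]
    by (simp add: pointwise_scale_def norm_mult powr_mult)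
  then show "lp_norm p (pointwise_scale c x) = norm c * lp_norm p x"
    using assms by (simp add: lp_norm_psum powr_mult powr_powr psum_nonneg)
qed

lemma lp_subspace:
  assumes p: "0 < p"
  shows "ptw.subspace (lp p :: (nat \<Rightarrow> 'k::real_normed_field) set)"
  unfolding ptw.subspace_def
proof (intro conjI ballI allI)
  show "0 \<in> lp p" using p by (simp add: lp_def)
  fix x y :: "nat \<Rightarrow> 'k" and c assume x: "x \<in> lp p"
  show "pointwise_scale c x \<in> lp p" by (rule lp_scale[OF x p])
  assume y: "y \<in> lp p"
  show "x + y \<in> lp p"
  proof (rule lp_boundI)
    fix F :: "nat set" assume F: "finite F"
    have "norm ((x + y) n) powr p \<le> 2 powr p * (norm (x n) powr p + norm (y n) powr p)" for n
    proof -
      let ?m = "max (norm (x n)) (norm (y n))"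
      have "norm ((x + y) n) \<le> 2 * ?m" using norm_triangle_ineq[of "x n" "y n"] by auto
      then have "norm ((x + y) n) powr p \<le> (2 * ?m) powr p" using p by (intro powr_mono2) auto
      also have "\<dots> = 2 powr p * ?m powr p" by (simp add: powr_mult)
      also have "?m powr p \<le> norm (x n) powr p + norm (y n) powr p" by (simp add: max_def)
      finally show ?thesis by simp
    qed
    then have "(\<Sum>n\<in>F. norm ((x + y) n) powr p) \<le> (\<Sum>n\<in>F. 2 powr p * (norm (x n) powr p + norm (y n) powr p))"
      by (rule sum_mono)
    also have "\<dots> = 2 powr p * ((\<Sum>n\<in>F. norm (x n) powr p) + (\<Sum>n\<in>F. norm (y n) powr p))"
      by (simp only: sum_distrib_left[symmetric] sum.distrib)
    also have "\<dots> \<le> 2 powr p * (psum p x + psum p y)"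
      by (intro mult_left_mono add_mono lp_sum_le x y F) auto
    finally show "(\<Sum>n\<in>F. norm ((x + y) n) powr p) \<le> 2 powr p * (psum p x + psum p y)" .
  qed
qed

lemma sum_disjoint:
  assumes "finite K" "\<And>k l. k \<in> K \<Longrightarrow> l \<in> K \<Longrightarrow> k \<noteq> l \<Longrightarrow> v k = 0 \<or> v l = 0" "g 0 = (0 :: 'b :: comm_monoid_add)"
  shows "g (\<Sum>k\<in>K. v k) = (\<Sum>k\<in>K. g (v k))"
proof (cases "\<exists>k\<in>K. v k \<noteq> 0")
  case True
  then obtain k where k: "k \<in> K" "v k \<noteq> 0" by blast
  then have *: "v l = 0" if "l \<in> K - {k}" for l using assms(2)[of k l] that by auto
  have "(\<Sum>l\<in>K. v l) = (\<Sum>l\<in>{k}. v l)" "(\<Sum>l\<in>K. g (v l)) = (\<Sum>l\<in>{k}. g (v l))"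
    using k(1) assms(1,3) * by (intro sum.mono_neutral_right; simp)+
  then show ?thesis by simp
qed (simp add: assms)

lemma psum_disjoint:
  assumes p: "0 < p" and K: "finite K" and f: "\<And>k. k \<in> K \<Longrightarrow> f k \<in> lp p"
    and d: "\<And>k l m. k \<in> K \<Longrightarrow> l \<in> K \<Longrightarrow> k \<noteq> l \<Longrightarrow> f k m = 0 \<or> f l m = 0"
  shows "(\<Sum>k\<in>K. f k) \<in> lp p" "psum p (\<Sum>k\<in>K. f k) = (\<Sum>k\<in>K. psum p (f k))"
proof -
  show "(\<Sum>k\<in>K. f k) \<in> lp p" using lp_subspace[OF p] f by (intro ptw.subspace_sum) auto
  have "norm ((\<Sum>k\<in>K. f k) m) powr p = (\<Sum>k\<in>K. norm (f k m) powr p)" for m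
    unfolding sum_fun_apply using d[of _ _ m] p
    by (intro sum_disjoint[where g = "\<lambda>z. norm z powr p" and v = "\<lambda>k. f k m"] K) auto
  then have "psum p (\<Sum>k\<in>K. f k) = (\<Sum>m. \<Sum>k\<in>K. norm (f k m) powr p)" by (simp add: psum_def)
  also have "\<dots> = (\<Sum>k\<in>K. psum p (f k))" unfolding psum_def
    using f by (intro suminf_sum) (auto simp: lp_def)
  finally show "psum p (\<Sum>k\<in>K. f k) = (\<Sum>k\<in>K. psum p (f k))" .
qed

section \<open>Reindexing, truncation and blocks of sequences\<close>

definition pull :: "(nat \<Rightarrow> nat) \<Rightarrow> (nat \<Rightarrow> 'k) \<Rightarrow> nat \<Rightarrow> 'k"
  where "pull a x = (\<lambda>n. x (a n))"

definition push :: "(nat \<Rightarrow> nat) \<Rightarrow> (nat \<Rightarrow> 'k::zero) \<Rightarrow> nat \<Rightarrow> 'k"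
  where "push a x = (\<lambda>m. if m \<in> range a then x (inv a m) else 0)"

definition trunc :: "nat \<Rightarrow> (nat \<Rightarrow> 'k::zero) \<Rightarrow> nat \<Rightarrow> 'k"
  where "trunc n x = (\<lambda>m. if m < n then x m else 0)"

definition unit_vec :: "nat \<Rightarrow> nat \<Rightarrow> 'k::zero_neq_one"
  where "unit_vec n = (\<lambda>m. if m = n then 1 else 0)"

lemma pull_linear: "linear_on pointwise_scale pointwise_scale S (pull a)"
  by (auto simp: linear_on_def pull_def pointwise_scale_def)

lemma push_linear: "linear_on pointwise_scale pointwise_scale S (push a)"
  by (auto simp: linear_on_def push_def pointwise_scale_def fun_eq_iff)

lemma trunc_linear: "linear_on pointwise_scale pointwise_scale S (trunc n)"
  by (auto simp: linear_on_def trunc_def pointwise_scale_def fun_eq_iff)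

lemma pull_lp:
  assumes "inj a" "x \<in> lp p" "0 < p"
  shows "pull a x \<in> lp p" "psum p (pull a x) \<le> psum p x" "lp_norm p (pull a x) \<le> lp_norm p x"
proof -
  have *: "(\<Sum>n\<in>F. norm (pull a x n) powr p) \<le> psum p x" if "finite F" for F
    using lp_sum_le[OF assms(2), of "a ` F"] that assms(1)
    by (simp add: sum.reindex inj_on_subset pull_def o_def)
  show "pull a x \<in> lp p" "psum p (pull a x) \<le> psum p x" using lp_boundI[OF *] by auto
  then show "lp_norm p (pull a x) \<le> lp_norm p x" by (intro lp_norm_mono assms)
qed

lemma push_lp:
  assumes "inj a" "x \<in> lp p" "0 < p"
  shows "push a x \<in> lp p" "psum p (push a x) \<le> psum p x" "lp_norm p (push a x) \<le> lp_norm p x"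
proof -
  have *: "(\<Sum>n\<in>F. norm (push a x n) powr p) \<le> psum p x" if F: "finite F" for F
  proof -
    have "(\<Sum>m\<in>F. norm (push a x m) powr p) = (\<Sum>m\<in>F \<inter> range a. norm (push a x m) powr p)"
      using F assms(3) by (intro sum.mono_neutral_right) (auto simp: push_def)
    also have "F \<inter> range a = a ` (a -` F)" by auto
    also have "(\<Sum>m\<in>a ` (a -` F). norm (push a x m) powr p) = (\<Sum>n\<in>a -` F. norm (x n) powr p)"
      using assms(1) by (subst sum.reindex) (auto simp: push_def intro: inj_on_subset)
    also have "\<dots> \<le> psum p x" using F assms(1,2) by (intro lp_sum_le finite_vimageI)
    finally show ?thesis .
  qed
  show "push a x \<in> lp p" "psum p (push a x) \<le> psum p x" using lp_boundI[OF *] by auto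
  then show "lp_norm p (push a x) \<le> lp_norm p x" by (intro lp_norm_mono assms)
qed

lemma trunc_lp:
  assumes "x \<in> lp p" "0 < p"
  shows "trunc n x \<in> lp p" "lp_norm p (trunc n x) \<le> lp_norm p x"
proof -
  have *: "(\<Sum>n\<in>F. norm (trunc m x n) powr p) \<le> psum p x" if F: "finite F" for F m
    using assms(2) by (intro order_trans[OF sum_mono lp_sum_le[OF assms(1) F]]) (auto simp: trunc_def)
  show "trunc n x \<in> lp p" using lp_boundI[OF *] by auto
  then show "lp_norm p (trunc n x) \<le> lp_norm p x" using lp_boundI[OF *] by (intro lp_norm_mono assms)
qed

lemma pull_push: "inj a \<Longrightarrow> pull a (push a x) = x"
  by (auto simp: pull_def push_def)

lemma pull_pull: "pull b (pull a x) = pull (\<lambda>n. a (b n)) x"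
  by (auto simp: pull_def)

lemma push_apply: "inj a \<Longrightarrow> push a x (a n) = x n"
  by (simp add: push_def)

lemma push_apply0: "m \<notin> range a \<Longrightarrow> push a x m = 0"
  by (simp add: push_def)

lemma push_push:
  assumes a: "inj a" and b: "inj b"
  shows "push a (push b x) = push (\<lambda>n. a (b n)) x"
proof (rule ext)
  fix m
  have i: "inj (\<lambda>n. a (b n))" using inj_compose[OF a b] by (simp add: o_def)
  consider n where "m = a (b n)" | k where "m = a k" "k \<notin> range b" | "m \<notin> range a" by blast
  then show "push a (push b x) m = push (\<lambda>n. a (b n)) x m"
  proof cases
    case (1 n)
    then show ?thesis using push_apply[OF i, of x n] by (simp add: push_apply a b)
  next
    case (2 k)
    then have "m \<notin> range (\<lambda>n. a (b n))" using a by (auto dest: injD)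
    with 2 show ?thesis by (simp add: push_apply a push_apply0)
  next
    case 3
    then have "m \<notin> range (\<lambda>n. a (b n))" by auto
    with 3 show ?thesis by (simp add: push_apply0)
  qed
qed

text \<open>The pairing function splits the indices into infinitely many infinite blocks.
  \<open>shift\<close> carries each block onto the next one and so misses block 0.\<close>

definition blk :: "nat \<Rightarrow> nat \<Rightarrow> nat" where "blk k j = prod_encode (k, j)"
definition shift :: "nat \<Rightarrow> nat" where "shift m = (case prod_decode m of (k, j) \<Rightarrow> prod_encode (Suc k, j))"

lemma inj_blk: "inj (blk k)" by (auto simp: inj_def blk_def)
lemma shift_blk: "shift (blk k j) = blk (Suc k) j" by (simp add: shift_def blk_def)

lemma blk_disj: "blk k j = blk l i \<longleftrightarrow> k = l \<and> j = i" by (auto simp: blk_def)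

lemma blk_cases: obtains k j where "m = blk k j" by (metis blk_def prod.exhaust prod_decode_inverse)

lemma inj_shift: "inj shift"
proof (rule injI)
  fix m n assume eq: "shift m = shift n"
  obtain k j where m: "m = blk k j" by (rule blk_cases)
  obtain l i where n: "n = blk l i" by (rule blk_cases)
  show "m = n" using eq unfolding m n shift_blk by (simp add: blk_disj)
qed

text \<open>The relations between the blocks and their shift on sequences; \<open>tens_tens\<close>
  lifts them to \<open>X\<close> as \<open>map_rules\<close>.\<close>

lemma blk_rules:
  "k \<noteq> l \<Longrightarrow> pull (blk k) (push (blk l) x) = (0 :: nat \<Rightarrow> 'k :: zero)" "pull (blk k) (push (blk k) x) = (x :: nat \<Rightarrow> 'k)"
  "push shift (push (blk k) x) = push (blk (Suc k)) x" "pull (blk k) (pull shift x) = pull (blk (Suc k)) x"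
  "pull shift (push (blk (Suc k)) x) = push (blk k) x" "pull shift (push (blk 0) x) = 0"
  "pull (blk (Suc k)) (push shift x) = pull (blk k) x" "pull (blk 0) (push shift x) = 0"
  "pull shift (push shift x) = x"
proof -
  have r: "blk k j \<notin> range (blk l)" if "k \<noteq> l" for k l j using that by (auto simp: blk_disj)
  have r0: "blk 0 j \<notin> range shift" for j
  proof
    assume "blk 0 j \<in> range shift"
    then obtain m where "blk 0 j = shift m" by auto
    moreover obtain k i where "m = blk k i" by (rule blk_cases)
    ultimately show False by (simp add: shift_blk blk_disj)
  qed
  show "k \<noteq> l \<Longrightarrow> pull (blk k) (push (blk l) x) = 0"
    using r by (auto simp: pull_def push_apply0 fun_eq_iff)
  show "pull (blk k) (push (blk k) x) = x" by (simp add: pull_push inj_blk)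
  show s: "push shift (push (blk k) x) = push (blk (Suc k)) x" for k
    by (simp add: push_push inj_blk inj_shift shift_blk)
  show "pull (blk k) (pull shift x) = pull (blk (Suc k)) x" by (simp add: pull_pull shift_blk)
  show pp: "pull shift (push shift x) = x" for x :: "nat \<Rightarrow> 'k" by (simp add: pull_push inj_shift)
  show "pull shift (push (blk (Suc k)) x) = push (blk k) x" by (simp flip: s add: pp)
  show "pull shift (push (blk 0) x) = 0"
  proof
    fix m obtain k j where "m = blk k j" by (rule blk_cases)
    then show "pull shift (push (blk 0) x) m = 0 m" by (simp add: pull_def shift_blk push_apply0 r)
  qed
  show "pull (blk (Suc k)) (push shift x) = pull (blk k) x"
    by (simp add: pull_def push_apply[OF inj_shift] flip: shift_blk)
  show "pull (blk 0) (push shift x) = 0" using r0 by (auto simp: pull_def push_apply0 fun_eq_iff)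
qed

lemma unit_vec_lp:
  assumes p: "0 < p"
  shows "(unit_vec n :: nat \<Rightarrow> 'k) \<in> lp p" "lp_norm p (unit_vec n :: nat \<Rightarrow> 'k::real_normed_field) = 1"
proof -
  have "norm (unit_vec n m :: 'k) powr p = (if m \<in> {n} then 1 else 0)" for m by (simp add: unit_vec_def p)
  then have "(\<lambda>m. norm (unit_vec n m :: 'k) powr p) sums (\<Sum>m\<in>{n}. 1)" by (simp only: sums_If_finite_set finite.intros)
  then show "(unit_vec n :: nat \<Rightarrow> 'k) \<in> lp p" "lp_norm p (unit_vec n :: nat \<Rightarrow> 'k) = 1"
    by (auto simp: lp_def sums_iff lp_norm_def)
qed

lemma trunc_tendsto:
  assumes "x \<in> lp p" "0 < p"
  shows "(\<lambda>n. lp_norm p (x - trunc n x)) \<longlonglongrightarrow> 0"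
proof -
  have s: "summable (\<lambda>m. norm (x m) powr p)" using assms by (simp add: lp_def)
  have "psum p (x - trunc n x) = (\<Sum>m. norm (x (m + n)) powr p)" for n
  proof -
    have "(\<lambda>m. norm ((x - trunc n x) (m + n)) powr p) = (\<lambda>m. norm (x (m + n)) powr p)"
      by (simp add: trunc_def)
    moreover have "summable (\<lambda>m. norm ((x - trunc n x) m) powr p)"
      using assms lp_subspace[OF assms(2)] trunc_lp(1)[OF assms] ptw.subspace_diff by (fastforce simp: lp_def)
    ultimately show ?thesis unfolding psum_def
      using suminf_split_initial_segment[of "\<lambda>m. norm ((x - trunc n x) m) powr p" n] assms(2) by (simp add: trunc_def)
  qed
  then have "(\<lambda>n. psum p (x - trunc n x)) \<longlonglongrightarrow> 0" using suminf_exist_split2[OF s] by simp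
  moreover have "0 \<le> psum p (x - trunc n x)" for n
    using assms lp_subspace[OF assms(2)] trunc_lp(1)[OF assms] ptw.subspace_diff by (intro psum_nonneg) blast
  ultimately show ?thesis unfolding lp_norm_psum using assms(2)
    by (intro tendsto_zero_powrI[where b = "1 / p"]) (auto intro!: always_eventually)
qed

section \<open>Diagonal estimates\<close>

text \<open>The diagonal is the average over signs. Signs are averaged one index at a time: both
  choices at \<open>a\<close> leave \<open>g a a\<close> unchanged and cancel the mixed terms with
  \<open>a\<close>. The summand \<open>h\<close> collects the diagonal terms already
  isolated.\<close>

lemma sign_diagonal:
  fixes g :: "'a \<Rightarrow> 'a \<Rightarrow> 'b::real_normed_vector"
  assumes "finite F"
    and "\<And>\<epsilon> :: 'a \<Rightarrow> real. (\<And>k. \<epsilon> k \<in> {1, -1}) \<Longrightarrow> norm (h + (\<Sum>k\<in>F. \<Sum>l\<in>F. (\<epsilon> k * \<epsilon> l) *\<^sub>R g k l)) \<le> C"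
  shows "norm (h + (\<Sum>k\<in>F. g k k)) \<le> C"
  using assms
proof (induction F arbitrary: h)
  case empty
  then show ?case using empty[of "\<lambda>_. 1"] by simp
next
  case (insert a F)
  have "norm ((h + g a a) + (\<Sum>k\<in>F. \<Sum>l\<in>F. (\<epsilon> k * \<epsilon> l) *\<^sub>R g k l)) \<le> C" (is "norm ?u \<le> C")
    if \<epsilon>: "\<And>k. \<epsilon> k \<in> {1, -1 :: real}" for \<epsilon>
  proof -
    define v where "v = (\<Sum>l\<in>F. \<epsilon> l *\<^sub>R (g a l + g l a))"
    have *: "norm (?u + \<delta> *\<^sub>R v) \<le> C" if "\<delta> \<in> {1, -1 :: real}" for \<delta>
    proof -
      let ?e = "\<epsilon>(a := \<delta>)"
      have "(\<Sum>k\<in>F. \<Sum>l\<in>F. (?e k * ?e l) *\<^sub>R g k l) = (\<Sum>k\<in>F. \<Sum>l\<in>F. (\<epsilon> k * \<epsilon> l) *\<^sub>R g k l)"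
        using insert.hyps by (intro sum.cong refl) auto
      moreover have "(\<Sum>l\<in>F. (?e a * ?e l) *\<^sub>R g a l) = (\<Sum>l\<in>F. \<delta> *\<^sub>R (\<epsilon> l *\<^sub>R g a l))"
        "(\<Sum>l\<in>F. (?e l * ?e a) *\<^sub>R g l a) = (\<Sum>l\<in>F. \<delta> *\<^sub>R (\<epsilon> l *\<^sub>R g l a))"
        using insert.hyps by (auto intro!: sum.cong)
      moreover have "\<delta> * \<delta> = 1" using that by auto
      ultimately have "h + (\<Sum>k\<in>insert a F. \<Sum>l\<in>insert a F. (?e k * ?e l) *\<^sub>R g k l) = ?u + \<delta> *\<^sub>R v"
        using insert.hyps by (simp add: v_def sum.distrib scaleR_right_distrib scaleR_sum_right add_ac del: scaleR_scaleR)
      moreover have "?e k \<in> {1, -1}" for k using \<epsilon>[of k] that by auto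
      ultimately show ?thesis using insert.prems[of ?e] by (simp only: add.assoc)
    qed
    have "norm (2 *\<^sub>R ?u) \<le> norm (?u + 1 *\<^sub>R v) + norm (?u + (-1) *\<^sub>R v)"
      using norm_triangle_ineq[of "?u + 1 *\<^sub>R v" "?u + (-1) *\<^sub>R v"] by (simp add: scaleR_2)
    also have "\<dots> \<le> C + C" by (intro add_mono *) auto
    finally show ?thesis by simp
  qed
  from insert.IH[OF this] insert.hyps show ?case by (simp add: add_ac)
qed

context projective_tensor
begin

text \<open>Coordinates in \<open>S\<close> are tied to the index k, the others carry the full sum.
  For a singleton \<open>S\<close> this is a single elementary tensor; tying one more coordinate is
  passage to a diagonal, free of charge by \<open>sign_diagonal\<close>. The signs are absorbed into
  the \<open>z k i\<close>, which is why \<open>d\<close> must bound all signed sums.\<close>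

lemma tau_diagonal:
  fixes z :: "'b \<Rightarrow> 'i \<Rightarrow> 'v"
  assumes F: "finite F" and z: "\<And>k i. k \<in> F \<Longrightarrow> i \<in> I \<Longrightarrow> z k i \<in> E i"
    and d: "\<And>\<epsilon> i. (\<And>k. \<epsilon> k \<in> {1, -1 :: real}) \<Longrightarrow> i \<in> I \<Longrightarrow> nrm i (\<Sum>k\<in>F. s (of_real (\<epsilon> k)) (z k i)) \<le> d i"
  shows "norm (\<Sum>k\<in>F. tau (\<lambda>i\<in>I. z k i)) \<le> (\<Prod>i\<in>I. d i)"
proof -
  have sumE: "(\<Sum>k\<in>F. y k) \<in> E i" if "i \<in> I" "\<And>k. k \<in> F \<Longrightarrow> y k \<in> E i" for y i
    using that subE by (intro fac.subspace_sum) auto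
  have exp: "tau (x(i := \<Sum>k\<in>F. y k)) = (\<Sum>k\<in>F. tau (x(i := y k)))" if "x \<in> PE" "i \<in> I" "\<And>k. k \<in> F \<Longrightarrow> y k \<in> E i" for x i y
    using linear_on_sum[of s smul "E i" "\<lambda>v. tau (x(i := v))" F y] that subE fac.vector_space_axioms tau_multilinear
    unfolding multilinear_map_def by blast
  have "norm (\<Sum>k\<in>F. tau (\<lambda>i\<in>I. if i \<in> S then z k i else \<Sum>l\<in>F. z l i)) \<le> (\<Prod>i\<in>I. d i)"
    if "S \<noteq> {}" "S \<subseteq> I" for S
    using finite_subset[OF that(2) fin] that z d
  proof (induction S arbitrary: z rule: finite_ne_induct)
    case (singleton a)
    let ?Z = "\<lambda>i\<in>I. \<Sum>l\<in>F. z l i"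
    have a: "a \<in> I" and Z: "?Z \<in> PE" using singleton by (auto intro!: sumE)
    have "(\<Sum>k\<in>F. tau (\<lambda>i\<in>I. if i \<in> {a} then z k i else \<Sum>l\<in>F. z l i)) = (\<Sum>k\<in>F. tau (?Z(a := z k a)))"
      using a by (intro sum.cong refl arg_cong[where f = tau]) auto
    also have "\<dots> = tau (?Z(a := \<Sum>k\<in>F. z k a))" using exp[OF Z a, of "\<lambda>k. z k a"] singleton a by simp
    also have "?Z(a := \<Sum>k\<in>F. z k a) = ?Z" using a by auto
    also have "norm (tau ?Z) \<le> (\<Prod>i\<in>I. d i)"
      using singleton.prems(3)[of "\<lambda>_. 1"] by (intro order_trans[OF norm_tau_le[OF Z]]) (auto simp: wt_def nrm_nonneg intro!: prod_mono)
    finally show ?case .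
  next
    case (insert h S)
    obtain a where a: "a \<in> S" using insert by auto
    then have ah: "a \<in> I" "h \<in> I" "a \<noteq> h" using insert by auto
    let ?Z = "\<lambda>i. \<Sum>l\<in>F. z l i"
    let ?x = "\<lambda>k. \<lambda>i\<in>I. if i \<in> S then z k i else ?Z i"
    let ?g = "\<lambda>k l. tau ((?x k)(h := z l h))"
    have x: "?x k \<in> PE" if "k \<in> F" for k using insert.prems(2) that by (auto intro!: sumE)
    have "norm (0 + (\<Sum>k\<in>F. ?g k k)) \<le> (\<Prod>i\<in>I. d i)"
    proof (rule sign_diagonal[OF F, where h = 0 and g = ?g])
      fix \<epsilon> :: "'b \<Rightarrow> real" assume \<epsilon>: "\<And>k. \<epsilon> k \<in> {1, -1}"
      \<comment> \<open>The sign of k enters through factor \<open>a\<close>, which is tied to k;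
        the sign of l enters through factor \<open>h\<close>, still summed freely over l.\<close>
      define z' where "z' k i = (if i = a \<or> i = h then s (of_real (\<epsilon> k)) (z k i) else z k i)" for k i
      have "norm (\<Sum>k\<in>F. tau (\<lambda>i\<in>I. if i \<in> S then z' k i else \<Sum>l\<in>F. z' l i)) \<le> (\<Prod>i\<in>I. d i)"
      proof (rule insert.IH)
        show "S \<subseteq> I" using insert by auto
        show "z' k i \<in> E i" if "k \<in> F" "i \<in> I" for k i
          using insert.prems(2) that by (auto simp: z'_def E_closed)
        show "nrm i (\<Sum>k\<in>F. s (of_real (\<delta> k)) (z' k i)) \<le> d i" if \<delta>: "\<And>k. \<delta> k \<in> {1, -1}" and i: "i \<in> I" for \<delta> i
        proof (cases "i = a \<or> i = h")
          case True
          have "\<delta> k * \<epsilon> k \<in> {1, -1}" for k using \<delta>[of k] \<epsilon>[of k] by auto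
          from insert.prems(3)[of "\<lambda>k. \<delta> k * \<epsilon> k", OF this i] True show ?thesis by (simp add: z'_def)
        next
          case False
          with insert.prems(3)[of \<delta>, OF \<delta> i] show ?thesis by (simp add: z'_def)
        qed
      qed
      also have "(\<Sum>k\<in>F. tau (\<lambda>i\<in>I. if i \<in> S then z' k i else \<Sum>l\<in>F. z' l i)) = (\<Sum>k\<in>F. \<Sum>l\<in>F. (\<epsilon> k * \<epsilon> l) *\<^sub>R ?g k l)"
      proof (rule sum.cong[OF refl])
        fix k assume k: "k \<in> F"
        have zk: "z l i \<in> E i" if "l \<in> F" "i \<in> I" for l i using insert.prems(2) that by auto
        let ?y = "(?x k)(a := s (of_real (\<epsilon> k)) (z k a))"
        have y: "?y \<in> PE" using x[OF k] ah zk[OF k] by (intro PiE_upd E_closed)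
        have "(\<lambda>i\<in>I. if i \<in> S then z' k i else \<Sum>l\<in>F. z' l i) = ?y(h := \<Sum>l\<in>F. s (of_real (\<epsilon> l)) (z l h))"
          using ah a insert.hyps by (auto simp: z'_def fun_eq_iff)
        then have "tau (\<lambda>i\<in>I. if i \<in> S then z' k i else \<Sum>l\<in>F. z' l i) = (\<Sum>l\<in>F. tau (?y(h := s (of_real (\<epsilon> l)) (z l h))))"
          using exp[OF y ah(2)] zk ah by (simp add: E_closed)
        also have "\<dots> = (\<Sum>l\<in>F. (\<epsilon> k * \<epsilon> l) *\<^sub>R ?g k l)"
        proof (rule sum.cong[OF refl])
          fix l assume l: "l \<in> F"
          have "tau (?y(h := s (of_real (\<epsilon> l)) (z l h))) = smul (of_real (\<epsilon> l)) (tau (?y(h := z l h)))"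
            by (rule multilinear_mapD(2)[OF tau_multilinear y ah(2) zk[OF l ah(2)]])
          also have "?y(h := z l h) = ((?x k)(h := z l h))(a := s (of_real (\<epsilon> k)) (z k a))" using ah by auto
          also have "tau \<dots> = smul (of_real (\<epsilon> k)) (tau (((?x k)(h := z l h))(a := z k a)))"
            using ah by (intro multilinear_mapD(2)[OF tau_multilinear _ ah(1)] PiE_upd x k zk l)
          also have "((?x k)(h := z l h))(a := z k a) = (?x k)(h := z l h)" using ah a by auto
          finally show "tau (?y(h := s (of_real (\<epsilon> l)) (z l h))) = (\<epsilon> k * \<epsilon> l) *\<^sub>R ?g k l"
            by (simp only: smul_of_real scaleR_scaleR mult.commute)
        qed
        finally show "tau (\<lambda>i\<in>I. if i \<in> S then z' k i else \<Sum>l\<in>F. z' l i) = (\<Sum>l\<in>F. (\<epsilon> k * \<epsilon> l) *\<^sub>R ?g k l)" .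
      qed
      finally show "norm (0 + (\<Sum>k\<in>F. \<Sum>l\<in>F. (\<epsilon> k * \<epsilon> l) *\<^sub>R ?g k l)) \<le> (\<Prod>i\<in>I. d i)" by simp
    qed
    moreover have "(\<Sum>k\<in>F. ?g k k) = (\<Sum>k\<in>F. tau (\<lambda>i\<in>I. if i \<in> insert h S then z k i else ?Z i))"
      using ah insert.hyps by (intro sum.cong refl arg_cong[where f = tau]) auto
    ultimately show ?case by (simp add: restrict_def)
  qed
  from this[OF ne order_refl] show ?thesis by (simp cong: restrict_cong)
qed

section \<open>Tensor products of contractions\<close>

definition contractions :: "('i \<Rightarrow> 'v \<Rightarrow> 'v) \<Rightarrow> bool" where
  "contractions h \<longleftrightarrow> (\<forall>i\<in>I. linear_on s s (E i) (h i) \<and> (\<forall>v\<in>E i. h i v \<in> E i \<and> nrm i (h i v) \<le> nrm i v))"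

definition tens :: "('i \<Rightarrow> 'v \<Rightarrow> 'v) \<Rightarrow> 'x \<Rightarrow> 'x" where
  "tens h = (SOME T. bop 1 T \<and> (\<forall>x\<in>PE. T (tau x) = tau (\<lambda>i\<in>I. h i (x i))))"

lemma tens:
  assumes "contractions h"
  shows "bop 1 (tens h)" "x \<in> PE \<Longrightarrow> tens h (tau x) = tau (\<lambda>i\<in>I. h i (x i))"
proof -
  have "\<exists>T. bop 1 T \<and> (\<forall>x\<in>PE. T (tau x) = tau (\<lambda>i\<in>I. h i (x i)))"
    using assms by (intro tens_exists) (auto simp: contractions_def)
  from someI_ex[OF this] show "bop 1 (tens h)" "x \<in> PE \<Longrightarrow> tens h (tau x) = tau (\<lambda>i\<in>I. h i (x i))"
    unfolding tens_def by blast+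
qed

lemma contractions_PE: "contractions h \<Longrightarrow> x \<in> PE \<Longrightarrow> (\<lambda>i\<in>I. h i (x i)) \<in> PE"
  by (auto simp: contractions_def PiE_iff)

lemma tens_tens:
  assumes g: "contractions g" and h: "contractions h" and u: "u \<in> X"
  shows "tens g (tens h u) = tens (\<lambda>i v. g i (h i v)) u"
proof (rule bop_unique[OF bop_comp[OF tens(1)[OF g] tens(1)[OF h]] _ _ u])
  have gh: "contractions (\<lambda>i v. g i (h i v))"
    unfolding contractions_def
  proof (intro ballI conjI)
    fix i v assume i: "i \<in> I" and v: "v \<in> E i"
    note G = g[unfolded contractions_def, rule_format, OF i] and H = h[unfolded contractions_def, rule_format, OF i]
    show "g i (h i v) \<in> E i" using G H v by blast
    show "nrm i (g i (h i v)) \<le> nrm i v" using G H v by (meson order_trans)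
  next
    fix i assume i: "i \<in> I"
    note G = g[unfolded contractions_def, rule_format, OF i] and H = h[unfolded contractions_def, rule_format, OF i]
    show "linear_on s s (E i) (\<lambda>v. g i (h i v))" using G H unfolding linear_on_def by simp
  qed
  show "bop 1 (tens (\<lambda>i v. g i (h i v)))" by (rule tens(1)[OF gh])
  fix x assume x: "x \<in> PE"
  have "(\<lambda>i\<in>I. g i ((\<lambda>i\<in>I. h i (x i)) i)) = (\<lambda>i\<in>I. g i (h i (x i)))" by auto
  then show "tens g (tens h (tau x)) = tens (\<lambda>i v. g i (h i v)) (tau x)"
    by (simp add: tens(2)[OF gh x] tens(2)[OF h x] tens(2)[OF g contractions_PE[OF h x]])
qed

lemma tens_id: "u \<in> X \<Longrightarrow> tens (\<lambda>i v. v) u = u"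
proof (rule bop_unique[OF _ bop_id, where S = "tens (\<lambda>i v. v)"])
  have c: "contractions (\<lambda>i v. v)" by (auto simp: contractions_def linear_on_def)
  show "bop 1 (tens (\<lambda>i v. v))" by (rule tens[OF c])
  fix x assume x: "x \<in> PE"
  have "restrict x I = x" using x by auto
  then show "tens (\<lambda>i v. v) (tau x) = tau x" using tens(2)[OF c x] by simp
qed

lemma tens_zero: "u \<in> X \<Longrightarrow> tens (\<lambda>i v. 0) u = 0"
proof (rule bop_unique[of 1 "tens (\<lambda>i v. 0)" 0 "\<lambda>_. 0"])
  have c: "contractions (\<lambda>i v. 0)" by (auto simp: contractions_def linear_on_def E_closed nrm0 nrm_nonneg)
  show "bop 1 (tens (\<lambda>i v. 0))" by (rule tens[OF c])
  show "bop 0 (\<lambda>u. 0)" by (auto simp: bop_def linear_on_def X_closed)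
  fix x assume x: "x \<in> PE"
  have "tau (\<lambda>i\<in>I. 0) = 0" using fin ne by (intro tau_eq_0) (auto simp: E_closed wt_def nrm0)
  then show "tens (\<lambda>i v. 0) (tau x) = 0" using tens(2)[OF c x] by simp
qed

end

text \<open>Local compactness of the scalars provides limits of bounded sequences along an
  ultrafilter, and the finite net that reduces bilinear estimates to real scalars.\<close>

locale lp_tensor = projective_tensor smul pointwise_scale I "\<lambda>i. lp (p i)" "\<lambda>i. lp_norm (p i)" X j
  for smul :: "'k::{real_normed_field, heine_borel} \<Rightarrow> 'x::banach \<Rightarrow> 'x" and I :: "'i set"
    and p :: "'i \<Rightarrow> real" and X :: "'x set" and j +
  assumes p1: "\<And>i. i \<in> I \<Longrightarrow> 1 < p i"
begin

lemma p0: "i \<in> I \<Longrightarrow> 0 < p i" using p1[of i] by simp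

lemma contractions_push: "(\<And>i. i \<in> I \<Longrightarrow> inj (a i)) \<Longrightarrow> contractions (\<lambda>i. push (a i))"
  by (auto simp: contractions_def push_linear push_lp p0)

lemma contractions_pull: "(\<And>i. i \<in> I \<Longrightarrow> inj (a i)) \<Longrightarrow> contractions (\<lambda>i. pull (a i))"
  by (auto simp: contractions_def pull_linear pull_lp p0)

lemma contractions_trunc: "contractions (\<lambda>i. trunc n)"
  by (auto simp: contractions_def trunc_linear trunc_lp p0)

text \<open>The block number is the same in every coordinate: the copies of \<open>X\<close> live on
  the diagonal boxes of the set of multi-indices.\<close>

definition emb :: "nat \<Rightarrow> 'x \<Rightarrow> 'x" where "emb k = tens (\<lambda>i. push (blk k))"
definition prj :: "nat \<Rightarrow> 'x \<Rightarrow> 'x" where "prj k = tens (\<lambda>i. pull (blk k))"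
definition fwd :: "'x \<Rightarrow> 'x" where "fwd = tens (\<lambda>i. push shift)"
definition bwd :: "'x \<Rightarrow> 'x" where "bwd = tens (\<lambda>i. pull shift)"

lemma bop_maps: "bop 1 (emb k)" "bop 1 (prj k)" "bop 1 fwd" "bop 1 bwd"
  unfolding emb_def prj_def fwd_def bwd_def
  by (intro tens(1) contractions_push contractions_pull inj_blk inj_shift)+

lemma map_rules:
  assumes u: "u \<in> X"
  shows "k \<noteq> l \<Longrightarrow> prj k (emb l u) = 0" "prj k (emb k u) = u"
    "fwd (emb k u) = emb (Suc k) u" "prj k (bwd u) = prj (Suc k) u"
    "bwd (emb (Suc k) u) = emb k u" "bwd (emb 0 u) = 0"
    "prj (Suc k) (fwd u) = prj k u" "prj 0 (fwd u) = 0" "bwd (fwd u) = u"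
  unfolding emb_def prj_def fwd_def bwd_def
  by (simp_all add: tens_tens contractions_push contractions_pull inj_blk inj_shift u blk_rules tens_id tens_zero)

text \<open>By \<open>unit_ball\<close> the normalized vectors may be replaced, one block after
  another, by elementary tensors of vectors of norm at most 1; \<open>G\<close> is the set of blocks
  still to be treated. For elementary tensors \<open>tau_diagonal\<close> applies, and the signed
  sums in each factor have disjoint supports.\<close>

lemma block_estimate:
  assumes F: "finite F" and v: "\<And>k. k \<in> F \<Longrightarrow> v k \<in> X" "\<And>k. k \<in> F \<Longrightarrow> norm (v k) \<le> (\<Prod>i\<in>I. c k i)"
    and c: "\<And>k i. 0 \<le> c k i"
  shows "norm (\<Sum>k\<in>F. emb k (v k)) \<le> (\<Prod>i\<in>I. (\<Sum>k\<in>F. c k i powr p i) powr (1 / p i))" (is "_ \<le> ?r")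
proof -
  let ?C = "\<lambda>k. \<Prod>i\<in>I. c k i"
  let ?el = "\<lambda>w. \<exists>y\<in>PE. (\<forall>i\<in>I. lp_norm (p i) (y i) \<le> 1) \<and> w = tau y"
  have C: "0 \<le> ?C k" for k by (intro prod_nonneg) (simp add: c)
  have bop_Ce: "bop (?C k) (\<lambda>u. ?C k *\<^sub>R emb k u)" for k
    using bop_smul[OF bop_maps(1)[of k], of "of_real (?C k)"] C[of k]
    by (simp add: smul_of_real abs_of_nonneg del: of_real_prod)
  have *: "norm (\<Sum>k\<in>F. ?C k *\<^sub>R emb k (w k)) \<le> ?r"
    if "G \<subseteq> F" "\<And>k. k \<in> G \<Longrightarrow> w k \<in> X \<and> norm (w k) \<le> 1" "\<And>k. k \<in> F - G \<Longrightarrow> ?el (w k)" for G w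
    using finite_subset[OF that(1) F] that
  proof (induction G arbitrary: w)
    case empty
    then have "\<forall>k\<in>F. \<exists>y. y \<in> PE \<and> (\<forall>i\<in>I. lp_norm (p i) (y i) \<le> 1) \<and> w k = tau y" by fastforce
    then obtain y where y: "\<And>k. k \<in> F \<Longrightarrow> y k \<in> PE" "\<And>k i. k \<in> F \<Longrightarrow> i \<in> I \<Longrightarrow> lp_norm (p i) (y k i) \<le> 1"
      "\<And>k. k \<in> F \<Longrightarrow> w k = tau (y k)" by metis
    \<comment> \<open>The weight of block k is distributed over the factors of its elementary
      tensor.\<close>
    define q where "q k i = pointwise_scale (of_real (c k i)) (y k i)" for k i
    have yl: "y k i \<in> lp (p i)" if "k \<in> F" "i \<in> I" for k i using y(1)[OF that(1)] that(2) by auto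
    have q: "q k i \<in> lp (p i)" "lp_norm (p i) (q k i) \<le> c k i" if "k \<in> F" "i \<in> I" for k i
    proof -
      show "q k i \<in> lp (p i)" unfolding q_def by (rule lp_scale[OF yl[OF that] p0[OF that(2)]])
      show "lp_norm (p i) (q k i) \<le> c k i" unfolding q_def lp_scale(2)[OF yl[OF that] p0[OF that(2)]]
        using y(2)[OF that] c[of k i] by (simp add: mult_left_le)
    qed
    have "?C k *\<^sub>R emb k (w k) = tau (\<lambda>i\<in>I. push (blk k) (q k i))" if k: "k \<in> F" for k
    proof -
      have "?C k *\<^sub>R tau (y k) = tau (\<lambda>i\<in>I. q k i)"
        unfolding q_def multilinear_scale[OF tau_multilinear vs_smul y(1)[OF k]] scaleR_eq of_real_prod ..
      moreover have "(\<lambda>i\<in>I. q k i) \<in> PE" using q k by auto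
      ultimately show ?thesis
        using y(3)[OF k] bop_arith(2)[OF bop_maps(1) tau_in_X[OF y(1)[OF k]], of k "of_real (?C k)"]
          tens(2)[OF contractions_push, of "\<lambda>_. blk k" "\<lambda>i\<in>I. q k i"]
        by (simp add: scaleR_eq inj_blk emb_def cong: restrict_cong)
    qed
    then have "(\<Sum>k\<in>F. ?C k *\<^sub>R emb k (w k)) = (\<Sum>k\<in>F. tau (\<lambda>i\<in>I. push (blk k) (q k i)))" by simp
    also have "norm \<dots> \<le> ?r"
    proof (rule tau_diagonal[OF F])
      show "push (blk k) (q k i) \<in> lp (p i)" if "k \<in> F" "i \<in> I" for k i
        by (rule push_lp[OF inj_blk q(1)[OF that] p0[OF that(2)]])
      fix \<epsilon> :: "nat \<Rightarrow> real" and i assume \<epsilon>: "\<And>k. \<epsilon> k \<in> {1, -1}" and i: "i \<in> I"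
      let ?f = "\<lambda>k. pointwise_scale (of_real (\<epsilon> k)) (push (blk k) (q k i))"
      have f: "?f k \<in> lp (p i)" "psum (p i) (?f k) \<le> c k i powr p i" if k: "k \<in> F" for k
      proof -
        note P = push_lp[OF inj_blk q(1)[OF k i] p0[OF i], of k]
        show "?f k \<in> lp (p i)" by (rule lp_scale[OF P(1) p0[OF i]])
        have "lp_norm (p i) (?f k) \<le> c k i"
          using lp_scale(2)[OF P(1) p0[OF i], of "of_real (\<epsilon> k)"] \<epsilon>[of k] P(3) q(2)[OF k i] by auto
        then have "lp_norm (p i) (?f k) powr p i \<le> c k i powr p i"
          using p0[OF i] by (intro powr_mono2) (auto simp: lp_norm_nonneg)
        then show "psum (p i) (?f k) \<le> c k i powr p i"
          using lp_norm_powr[OF \<open>?f k \<in> lp (p i)\<close> p0[OF i]] by simp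
      qed
      have disj: "?f k m = 0 \<or> ?f l m = 0" if "k \<in> F" "l \<in> F" "k \<noteq> l" for k l m
        using that by (auto simp: pointwise_scale_def push_def blk_disj)
      have D: "(\<Sum>k\<in>F. ?f k) \<in> lp (p i)" "psum (p i) (\<Sum>k\<in>F. ?f k) = (\<Sum>k\<in>F. psum (p i) (?f k))"
        by (rule psum_disjoint[OF p0[OF i] F]; use f(1) disj in blast)+
      have "psum (p i) (\<Sum>k\<in>F. ?f k) \<le> (\<Sum>k\<in>F. c k i powr p i)"
        unfolding D(2) by (rule sum_mono[OF f(2)])
      then show "lp_norm (p i) (\<Sum>k\<in>F. ?f k) \<le> (\<Sum>k\<in>F. c k i powr p i) powr (1 / p i)"
        unfolding lp_norm_psum using p0[OF i] psum_nonneg[OF D(1)] by (intro powr_mono2) auto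
    qed
    finally show ?case .
  next
    case (insert g G)
    have g: "g \<in> F" using insert by auto
    have split: "(\<Sum>k\<in>F. ?C k *\<^sub>R emb k (w' k)) = (\<Sum>k\<in>F-{g}. ?C k *\<^sub>R emb k (w' k)) + ?C g *\<^sub>R emb g (w' g)" for w'
      using F g by (simp add: sum.remove add.commute)
    have "norm ((\<Sum>k\<in>F-{g}. ?C k *\<^sub>R emb k (w k)) + ?C g *\<^sub>R emb g (w g)) \<le> ?r"
    proof (rule unit_ball[OF bop_Ce])
      show "w g \<in> X" "norm (w g) \<le> 1" using insert.prems by auto
      fix y assume y: "y \<in> PE" "\<And>i. i \<in> I \<Longrightarrow> lp_norm (p i) (y i) \<le> 1"
      let ?w = "w(g := tau y)"
      have "norm (\<Sum>k\<in>F. ?C k *\<^sub>R emb k (?w k)) \<le> ?r"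
      proof (rule insert.IH)
        fix k assume "k \<in> F - G"
        then show "?el (?w k)" using y insert.prems(3)[of k] by (cases "k = g") auto
      qed (use insert.prems insert.hyps in auto)
      moreover have "(\<Sum>k\<in>F-{g}. ?C k *\<^sub>R emb k (?w k)) = (\<Sum>k\<in>F-{g}. ?C k *\<^sub>R emb k (w k))"
        by (rule sum.cong) auto
      ultimately show "norm ((\<Sum>k\<in>F-{g}. ?C k *\<^sub>R emb k (w k)) + ?C g *\<^sub>R emb g (tau y)) \<le> ?r"
        by (simp add: split)
    qed
    then show ?case by (simp add: split)
  qed
  \<comment> \<open>If the weight is 0 then \<open>v k\<close> is 0 as well, so the default
    \<open>inverse 0 = 0\<close> does no harm.\<close>
  define w where "w k = inverse (?C k) *\<^sub>R v k" for k
  have vw: "v k = ?C k *\<^sub>R w k" if "k \<in> F" for k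
    using v(2)[OF that] by (cases "?C k = 0") (auto simp: w_def)
  have w: "w k \<in> X \<and> norm (w k) \<le> 1" if "k \<in> F" for k
  proof (cases "?C k = 0")
    case False
    then have "?C k > 0" using C[of k] by linarith
    then show ?thesis using v[OF that] by (simp add: w_def X_scaleR field_simps)
  qed (simp add: w_def X_closed)
  have "norm (\<Sum>k\<in>F. ?C k *\<^sub>R emb k (w k)) \<le> ?r" by (rule *[OF order_refl w]) auto
  moreover have "?C k *\<^sub>R emb k (w k) = emb k (v k)" if "k \<in> F" for k
    using bop_arith(2)[OF bop_maps(1), of "w k" k "of_real (?C k)"] w[OF that] vw[OF that] by (simp add: scaleR_eq)
  ultimately show ?thesis by simp
qed

end

section \<open>Infinite direct sums of operators\<close>

lemma psum_pull_push:
  assumes a: "inj a" and x: "x \<in> lp p" "0 < p"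
  shows "psum p (push a x) = psum p x"
  using push_lp[OF a x] pull_lp(2)[OF a push_lp(1)[OF a x] x(2)] by (simp add: pull_push a)

lemma psum_blocks:
  assumes x: "x \<in> lp p" "0 < p" and F: "finite F"
  shows "(\<Sum>k\<in>F. psum p (pull (blk k) x)) \<le> psum p x"
proof -
  let ?f = "\<lambda>k. push (blk k) (pull (blk k) x)"
  note pl = pull_lp(1)[OF inj_blk x]
  have fl: "?f k \<in> lp p" for k by (rule push_lp(1)[OF inj_blk pl x(2)])
  have disj: "?f k m = 0 \<or> ?f l m = 0" if "k \<noteq> l" for k l m
    using that by (auto simp: push_def blk_disj)
  have "(\<Sum>k\<in>F. psum p (pull (blk k) x)) = (\<Sum>k\<in>F. psum p (?f k))"
    by (simp add: psum_pull_push[OF inj_blk pl x(2)])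
  also have "\<dots> = psum p (\<Sum>k\<in>F. ?f k)"
    by (rule psum_disjoint(2)[OF x(2) F, symmetric]) (use fl disj in auto)
  also have "\<dots> \<le> psum p x"
  proof (rule lp_boundI(2))
    fix G :: "nat set" assume G: "finite G"
    have "norm ((\<Sum>k\<in>F. ?f k) m) \<le> norm (x m)" for m
    proof -
      obtain l i where m: "m = blk l i" by (rule blk_cases)
      have "?f k m = (if k = l then x m else 0)" for k
        unfolding m by (cases "k = l") (auto simp: push_apply[OF inj_blk] pull_def image_iff blk_disj intro!: push_apply0)
      then show ?thesis unfolding sum_fun_apply using F by simp
    qed
    then show "(\<Sum>m\<in>G. norm ((\<Sum>k\<in>F. ?f k) m) powr p) \<le> psum p x"
      using x by (intro order_trans[OF sum_mono lp_sum_le[OF x(1) G]] powr_mono2) auto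
  qed
  finally show ?thesis .
qed

context lp_tensor
begin

text \<open>This is \<open>block_estimate\<close> with the norms of the blocks of the factors as
  weights; \<open>K\<close> is divided out beforehand, hence \<open>0 < K\<close>.\<close>

lemma diag_bound:
  assumes T: "bop K T" "0 < K" and x: "x \<in> PE" and F: "finite F"
  shows "norm (\<Sum>k\<in>F. emb k (T (prj k (tau x)))) \<le> K * (\<Prod>i\<in>I. (\<Sum>k\<in>F. psum (p i) (pull (blk k) (x i))) powr (1 / p i))"
proof -
  let ?c = "\<lambda>k i. lp_norm (p i) (pull (blk k) (x i))"
  define w where "w k = prj k (tau x)" for k
  have w: "w k = tau (\<lambda>i\<in>I. pull (blk k) (x i))" for k
    unfolding w_def prj_def by (rule tens(2)[OF contractions_pull x]) (rule inj_blk)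
  have xi: "pull (blk k) (x i) \<in> lp (p i)" if "i \<in> I" for i k
    using x that by (intro pull_lp(1)[OF inj_blk _ p0]) auto
  have wX: "w k \<in> X" for k unfolding w by (intro tau_in_X) (use xi in auto)
  have "norm (w k) \<le> (\<Prod>i\<in>I. ?c k i)" for k
  proof -
    have "(\<lambda>i\<in>I. pull (blk k) (x i)) \<in> PE" using xi by auto
    from norm_tau_le[OF this] show ?thesis unfolding w wt_def by (simp cong: prod.cong)
  qed
  then have nv: "norm (inverse K *\<^sub>R T (w k)) \<le> (\<Prod>i\<in>I. ?c k i)" for k
    using order_trans[OF bopD(4)[OF T(1) wX[of k]] mult_left_mono[of "norm (w k)" "\<Prod>i\<in>I. ?c k i" K]] T(2) by (simp add: field_simps)
  have vX: "T (w k) \<in> X" for k by (rule bopD(2)[OF T(1) wX])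
  have "(\<Sum>k\<in>F. emb k (T (w k))) = K *\<^sub>R (\<Sum>k\<in>F. emb k (inverse K *\<^sub>R T (w k)))"
    using T(2) by (simp add: scaleR_eq bop_arith(2)[OF bop_maps(1) vX] scale_sum_right del: of_real_inverse flip: of_real_mult)
  moreover have "norm (\<Sum>k\<in>F. emb k (inverse K *\<^sub>R T (w k))) \<le> (\<Prod>i\<in>I. (\<Sum>k\<in>F. ?c k i powr p i) powr (1 / p i))"
    by (rule block_estimate[OF F]) (use vX nv X_scaleR lp_norm_nonneg in auto)
  moreover have "(\<Prod>i\<in>I. (\<Sum>k\<in>F. ?c k i powr p i) powr (1 / p i)) = (\<Prod>i\<in>I. (\<Sum>k\<in>F. psum (p i) (pull (blk k) (x i))) powr (1 / p i))"
    by (intro prod.cong refl arg_cong2[where f = "(powr)"] sum.cong lp_norm_powr xi p0)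
  ultimately show ?thesis using T(2) by (simp add: w_def)
qed

definition part :: "('x \<Rightarrow> 'x) \<Rightarrow> nat \<Rightarrow> 'x \<Rightarrow> 'x" where
  "part T n u = (\<Sum>k<n. emb k (T (prj k u)))"

text \<open>The infinite direct sum of copies of \<open>T\<close>, one on every diagonal box. For
  the identity it is the projection onto the block diagonal part \<open>D\<close>.\<close>

definition hat :: "('x \<Rightarrow> 'x) \<Rightarrow> 'x \<Rightarrow> 'x" where
  "hat T u = lim (\<lambda>n. part T n u)"

text \<open>The point is that the bound does not depend on \<open>n\<close>: the blocks of a single
  sequence have p-th powers of norms adding up to at most its own.\<close>

lemma part_bop:
  assumes T: "bop K T" "0 < K" shows "bop K (part T n)"
proof (rule bop_bound)
  show "bop (\<Sum>k<n. 1 * (K * 1)) (part T n)"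
    unfolding part_def[abs_def] by (intro bop_sum bop_comp bop_maps T(1))
  fix x assume x: "x \<in> PE"
  have "norm (part T n (tau x)) \<le> K * (\<Prod>i\<in>I. (\<Sum>k<n. psum (p i) (pull (blk k) (x i))) powr (1 / p i))"
    unfolding part_def by (rule diag_bound[OF T x]) simp
  also have "\<dots> \<le> K * wt x" unfolding wt_def
  proof (intro mult_left_mono prod_mono conjI)
    fix i assume i: "i \<in> I"
    then have xi: "x i \<in> lp (p i)" using x by auto
    have "0 \<le> (\<Sum>k<n. psum (p i) (pull (blk k) (x i)))"
      by (intro sum_nonneg psum_nonneg pull_lp(1)[OF inj_blk xi p0[OF i]])
    then show "(\<Sum>k<n. psum (p i) (pull (blk k) (x i))) powr (1 / p i) \<le> lp_norm (p i) (x i)"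
      unfolding lp_norm_psum using p0[OF i] by (intro powr_mono2 psum_blocks xi) auto
  qed (use T in auto)
  finally show "norm (part T n (tau x)) \<le> K * wt x" .
qed (use T in simp)

text \<open>On an elementary tensor the blocks from m on are controlled by the tail of one chosen
  factor \<open>a\<close>; the other factors enter only through their norms.\<close>

lemma part_convergent:
  assumes T: "bop K T" "0 < K" and u: "u \<in> X"
  shows "convergent (\<lambda>n. part T n u)"
proof (rule strong_convergence[OF part_bop[OF T] _ u])
  fix x assume x: "x \<in> PE"
  obtain a where a: "a \<in> I" using ne by auto
  let ?f = "\<lambda>i k. psum (p i) (pull (blk k) (x i))"
  have xi: "x i \<in> lp (p i)" if "i \<in> I" for i using x that by auto
  have f0: "0 \<le> ?f i k" if "i \<in> I" for i k
    by (intro psum_nonneg pull_lp(1)[OF inj_blk xi p0] that)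
  have sf: "summable (?f a)"
    by (rule summableI_nonneg_bounded[OF f0[OF a] psum_blocks[OF xi p0]]) (use a in auto)
  define b where "b m = K * ((\<Sum>k. ?f a (k + m)) powr (1 / p a) * (\<Prod>i\<in>I-{a}. lp_norm (p i) (x i)))" for m
  have t0: "0 \<le> (\<Sum>k. ?f a (k + m))" for m
    by (intro suminf_nonneg) (use summable_ignore_initial_segment[OF sf] f0[OF a] in auto)
  have "(\<lambda>m. (\<Sum>k. ?f a (k + m)) powr (1 / p a)) \<longlonglongrightarrow> 0"
    using p0[OF a] t0 by (intro tendsto_zero_powrI[where b = "1 / p a"] suminf_exist_split2[OF sf]) auto
  then have b: "b \<longlonglongrightarrow> 0" unfolding b_def by (intro tendsto_mult_right_zero tendsto_mult_left_zero)
  have est: "norm (part T n (tau x) - part T m (tau x)) \<le> b m" if "m \<le> n" for m n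
  proof -
    have "part T n (tau x) - part T m (tau x) = (\<Sum>k\<in>{m..<n}. emb k (T (prj k (tau x))))"
      unfolding part_def using that by (subst sum_diff[symmetric]) (auto intro!: sum.cong)
    also have "norm \<dots> \<le> K * (\<Prod>i\<in>I. (\<Sum>k\<in>{m..<n}. ?f i k) powr (1 / p i))"
      by (rule diag_bound[OF T x]) simp
    also have "(\<Prod>i\<in>I. (\<Sum>k\<in>{m..<n}. ?f i k) powr (1 / p i)) =
        (\<Sum>k\<in>{m..<n}. ?f a k) powr (1 / p a) * (\<Prod>i\<in>I-{a}. (\<Sum>k\<in>{m..<n}. ?f i k) powr (1 / p i))"
      by (rule prod.remove[OF fin a])
    also have "K * \<dots> \<le> b m" unfolding b_def
    proof (intro mult_left_mono mult_mono prod_mono conjI)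
      have "(\<Sum>k\<in>{m..<n}. ?f a k) = (\<Sum>k<n-m. ?f a (k + m))"
        by (rule sum.reindex_bij_witness[of _ "\<lambda>k. k + m" "\<lambda>k. k - m"]) auto
      also have "\<dots> \<le> (\<Sum>k. ?f a (k + m))"
        using summable_ignore_initial_segment[OF sf] f0[OF a] by (intro sum_le_suminf) auto
      finally show "(\<Sum>k\<in>{m..<n}. ?f a k) powr (1 / p a) \<le> (\<Sum>k. ?f a (k + m)) powr (1 / p a)"
        using p0[OF a] f0[OF a] by (intro powr_mono2 sum_nonneg) auto
      fix i assume "i \<in> I - {a}"
      then have i: "i \<in> I" by simp
      show "(\<Sum>k\<in>{m..<n}. ?f i k) powr (1 / p i) \<le> lp_norm (p i) (x i)"
        unfolding lp_norm_psum using p0[OF i] f0[OF i] by (intro powr_mono2 psum_blocks xi i sum_nonneg) auto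
    qed (use T in \<open>auto intro!: prod_nonneg\<close>)
    finally show ?thesis .
  qed
  have "Cauchy (\<lambda>n. part T n (tau x))"
  proof (rule CauchyI')
    fix e :: real assume "0 < e"
    then obtain M where M: "\<And>m. m \<ge> M \<Longrightarrow> b m < e" using order_tendstoD(2)[OF b] unfolding eventually_sequentially by blast
    show "\<exists>M. \<forall>m\<ge>M. \<forall>n>m. dist (part T m (tau x)) (part T n (tau x)) < e"
    proof (intro exI[of _ M] allI impI)
      fix m n assume "M \<le> m" "m < n"
      then show "dist (part T m (tau x)) (part T n (tau x)) < e"
        using est[of m n] M[of m] by (simp add: dist_norm norm_minus_commute)
    qed
  qed
  then show "convergent (\<lambda>n. part T n (tau x))" by (rule Cauchy_convergent)
qed

section \<open>Calculus of block diagonal operators\<close>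

definition bounded_op :: "('x \<Rightarrow> 'x) \<Rightarrow> bool" where "bounded_op T \<longleftrightarrow> (\<exists>K. bop K T)"

lemma bounded_opE:
  assumes "bounded_op T" obtains K where "bop K T" "0 < K"
proof -
  obtain K where K: "bop K T" using assms unfolding bounded_op_def by blast
  then have "bop (K + 1) T" "0 < K + 1" using bopD(1)[OF K] by (auto intro: bop_mono)
  with that show ?thesis by blast
qed

lemma bounded_op_rules:
  "bounded_op (\<lambda>u. u)" "bounded_op S \<Longrightarrow> bounded_op T \<Longrightarrow> bounded_op (\<lambda>u. S (T u))"
  "bounded_op S \<Longrightarrow> bounded_op T \<Longrightarrow> bounded_op (\<lambda>u. S u + T u)"
  "bounded_op S \<Longrightarrow> bounded_op T \<Longrightarrow> bounded_op (\<lambda>u. S u - T u)"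
  "bounded_op S \<Longrightarrow> bounded_op (\<lambda>u. smul c (S u))"
  "bounded_op (emb k)" "bounded_op (prj k)" "bounded_op fwd" "bounded_op bwd"
  unfolding bounded_op_def
  by (use bop_id in blast, use bop_comp in blast, use bop_add in blast, use bop_diff in blast, use bop_smul in blast,
    (use bop_maps in blast)+)

lemma bounded_opD:
  assumes "bounded_op T"
  shows "u \<in> X \<Longrightarrow> T u \<in> X" "u \<in> X \<Longrightarrow> v \<in> X \<Longrightarrow> T (u + v) = T u + T v" "u \<in> X \<Longrightarrow> T (smul c u) = smul c (T u)"
    "u \<in> X \<Longrightarrow> v \<in> X \<Longrightarrow> T (u - v) = T u - T v" "T 0 = 0"
    "(\<And>k. k \<in> F \<Longrightarrow> f k \<in> X) \<Longrightarrow> T (\<Sum>k\<in>F. f k) = (\<Sum>k\<in>F. T (f k))" "continuous_on X T"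
proof -
  obtain K where K: "bop K T" using assms unfolding bounded_op_def by blast
  show "u \<in> X \<Longrightarrow> T u \<in> X" "u \<in> X \<Longrightarrow> v \<in> X \<Longrightarrow> T (u + v) = T u + T v" "u \<in> X \<Longrightarrow> T (smul c u) = smul c (T u)"
    "u \<in> X \<Longrightarrow> v \<in> X \<Longrightarrow> T (u - v) = T u - T v" "T 0 = 0"
    "(\<And>k. k \<in> F \<Longrightarrow> f k \<in> X) \<Longrightarrow> T (\<Sum>k\<in>F. f k) = (\<Sum>k\<in>F. T (f k))" "continuous_on X T"
    by (fact bopD(2)[OF K] bop_arith[OF K] bop_continuous[OF K])+
qed

lemma bounded_op_tendsto:
  assumes "bounded_op T" "f \<longlonglongrightarrow> l" "\<And>n. f n \<in> X" "l \<in> X"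
  shows "(\<lambda>n. T (f n)) \<longlonglongrightarrow> T l"
  using assms bop_tendsto unfolding bounded_op_def by blast

lemma hat_lim: "bounded_op T \<Longrightarrow> u \<in> X \<Longrightarrow> (\<lambda>n. part T n u) \<longlonglongrightarrow> hat T u"
  unfolding hat_def by (metis bounded_opE part_convergent convergent_LIMSEQ_iff)

lemma hat_bounded:
  assumes "bounded_op T" shows "bounded_op (hat T)"
proof -
  obtain K where K: "bop K T" "0 < K" using assms by (rule bounded_opE)
  have "bop K (hat T)" by (rule bop_limit[OF part_bop[OF K] hat_lim[OF assms]])
  then show ?thesis unfolding bounded_op_def by blast
qed

lemma part_X: "bounded_op T \<Longrightarrow> u \<in> X \<Longrightarrow> part T n u \<in> X"
  unfolding part_def by (intro X_closed bounded_opD(1)[OF bounded_op_rules(6)] bounded_opD(1)[OF bounded_op_rules(7)] bounded_opD(1)[of T])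

lemmas mem_rules = bounded_opD(1)[OF bounded_op_rules(6)] bounded_opD(1)[OF bounded_op_rules(7)]
  bounded_opD(1)[OF bounded_op_rules(8)] bounded_opD(1)[OF bounded_op_rules(9)] X_closed part_X

lemma hat_eqI:
  assumes "bounded_op T" "u \<in> X" "\<And>n. part T (Suc n) u = f n" "f \<longlonglongrightarrow> l"
  shows "hat T u = l"
  using LIMSEQ_unique[OF LIMSEQ_Suc[OF hat_lim[OF assms(1,2)]]] assms(3,4) by simp

lemma prj_hat:
  assumes T: "bounded_op T" and u: "u \<in> X"
  shows "prj k (hat T u) = T (prj k u)"
proof -
  have "(\<lambda>n. prj k (part T n u)) \<longlonglongrightarrow> prj k (hat T u)"
    by (rule bounded_op_tendsto[OF bounded_op_rules(7) hat_lim[OF T u]]) (intro mem_rules bounded_opD(1)[OF hat_bounded[OF T]] bounded_opD(1)[OF T] T u)+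
  moreover have "prj k (part T n u) = (if k < n then T (prj k u) else 0)" for n
  proof -
    have "prj k (part T n u) = (\<Sum>l<n. prj k (emb l (T (prj l u))))"
      unfolding part_def by (rule bounded_opD(6)[OF bounded_op_rules(7)]) (intro mem_rules bounded_opD(1)[OF T] T u)
    also have "\<dots> = (\<Sum>l<n. if l = k then T (prj k u) else 0)"
      using u by (intro sum.cong refl) (auto simp: map_rules mem_rules bounded_opD(1)[OF T])
    finally show ?thesis by simp
  qed
  moreover have "(\<lambda>n. if k < n then T (prj k u) else 0) \<longlonglongrightarrow> T (prj k u)"
    by (rule tendsto_eventually) (auto simp: eventually_sequentially intro!: exI[of _ "Suc k"])
  ultimately show ?thesis using LIMSEQ_unique by simp
qed

lemma part_cong: "u \<in> X \<Longrightarrow> (\<And>u. u \<in> X \<Longrightarrow> S u = T u) \<Longrightarrow> part S n u = part T n u"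
  unfolding part_def by (simp add: mem_rules)

lemma hat_cong: "u \<in> X \<Longrightarrow> (\<And>u. u \<in> X \<Longrightarrow> S u = T u) \<Longrightarrow> hat S u = hat T u"
  unfolding hat_def using part_cong[of u S T] by simp

lemma hat_hat:
  assumes T: "bounded_op T" and S: "bounded_op S" and u: "u \<in> X"
  shows "hat T (hat S u) = hat (\<lambda>u. T (S u)) u"
proof -
  have "part T n (hat S u) = part (\<lambda>u. T (S u)) n u" for n
    unfolding part_def by (simp add: prj_hat S u)
  then show ?thesis unfolding hat_def by simp
qed

lemma hat_zero: "hat (\<lambda>u. 0) u = 0"
  unfolding hat_def part_def by (simp add: bounded_opD(5)[OF bounded_op_rules(6)])

lemma hat_add:
  assumes T: "bounded_op T" and S: "bounded_op S" and u: "u \<in> X"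
  shows "hat T u + hat S u = hat (\<lambda>u. T u + S u) u"
proof (rule hat_eqI[symmetric, OF bounded_op_rules(3)[OF T S] u])
  show "part (\<lambda>u. T u + S u) (Suc n) u = part T (Suc n) u + part S (Suc n) u" for n
    unfolding part_def sum.distrib[symmetric]
    by (intro sum.cong refl bounded_opD(2)[OF bounded_op_rules(6)] mem_rules bounded_opD(1)[OF T] bounded_opD(1)[OF S] u)
  show "(\<lambda>n. part T (Suc n) u + part S (Suc n) u) \<longlonglongrightarrow> hat T u + hat S u"
    by (intro tendsto_add LIMSEQ_Suc hat_lim T S u)
qed

lemma part_Suc: "part T (Suc n) u = emb 0 (T (prj 0 u)) + (\<Sum>k<n. emb (Suc k) (T (prj (Suc k) u)))"
  unfolding part_def by (rule sum.lessThan_Suc_shift)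

text \<open>Self-similarity: what remains after block 0 is the same operator moved along by the
  shift. The relations of \<open>hat T\<close> to \<open>fwd\<close>, \<open>bwd\<close> and
  \<open>emb 0\<close> all follow from this.\<close>

lemma hat_split:
  assumes T: "bounded_op T" and u: "u \<in> X"
  shows "hat T u = emb 0 (T (prj 0 u)) + fwd (hat T (bwd u))"
proof (rule hat_eqI[OF T u])
  have "fwd (part T n (bwd u)) = (\<Sum>k<n. fwd (emb k (T (prj k (bwd u)))))" for n
    unfolding part_def by (rule bounded_opD(6)[OF bounded_op_rules(8)]) (intro mem_rules bounded_opD(1)[OF T] T u)
  then show "part T (Suc n) u = emb 0 (T (prj 0 u)) + fwd (part T n (bwd u))" for n
    unfolding part_Suc using u by (simp add: map_rules mem_rules bounded_opD(1)[OF T])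
  show "(\<lambda>n. emb 0 (T (prj 0 u)) + fwd (part T n (bwd u))) \<longlonglongrightarrow> emb 0 (T (prj 0 u)) + fwd (hat T (bwd u))"
    by (intro tendsto_intros bounded_op_tendsto[OF bounded_op_rules(8)] hat_lim) (intro mem_rules bounded_opD(1)[OF hat_bounded[OF T]] bounded_opD(1)[OF T] T u)+
qed

lemma hat_fwd:
  assumes T: "bounded_op T" and u: "u \<in> X"
  shows "hat T (fwd u) = fwd (hat T u)"
  using hat_split[OF T, of "fwd u"] u by (simp add: map_rules mem_rules bounded_opD(5)[OF T] bounded_opD(5)[OF bounded_op_rules(6)])

lemma hat_emb0:
  assumes T: "bounded_op T" and u: "u \<in> X"
  shows "hat T (emb 0 u) = emb 0 (T u)"
  using hat_split[OF T, of "emb 0 u"] u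
  by (simp add: map_rules mem_rules bounded_opD(1)[OF T] bounded_opD(5)[OF hat_bounded[OF T]] bounded_opD(5)[OF bounded_op_rules(8)])

lemma hat_bwd:
  assumes T: "bounded_op T" and u: "u \<in> X"
  shows "bwd (hat T u) = hat T (bwd u)"
  using arg_cong[OF hat_split[OF T u], of bwd] u
  by (simp add: map_rules mem_rules bounded_opD(1)[OF T] bounded_opD(1)[OF hat_bounded[OF T]] bounded_opD(2)[OF bounded_op_rules(9)])

abbreviation "proj_D \<equiv> hat (\<lambda>u. u)"
definition "D = {u \<in> X. proj_D u = u}"

lemma proj_D_absorb:
  assumes T: "bounded_op T" and u: "u \<in> X"
  shows "proj_D (hat T u) = hat T u" "hat T (proj_D u) = hat T u"
  by (simp_all add: hat_hat bounded_op_rules(1) T u)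

lemma X_split: "\<exists>W. lin_homeo smul X (prod_scale smul smul) (D \<times> W)"
proof
  let ?W = "{u \<in> X. proj_D u = 0}"
  have d: "bounded_op proj_D" by (intro hat_bounded bounded_op_rules)
  note dd = proj_D_absorb(1)[OF bounded_op_rules(1)]
  show "lin_homeo smul X (prod_scale smul smul) (D \<times> ?W)"
  proof (rule lin_homeoI[of _ "\<lambda>u. (proj_D u, u - proj_D u)" _ "\<lambda>z. fst z + snd z"])
    show "continuous_on X (\<lambda>u. (proj_D u, u - proj_D u))"
      by (intro continuous_intros bounded_opD(7) d)
    show "continuous_on (D \<times> ?W) (\<lambda>z. fst z + snd z)" by (intro continuous_intros)
  qed (auto simp: D_def linear_on_def prod_scale_def bounded_opD[OF d] dd X_closed scale_right_diff_distrib scale_right_distrib)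
qed

text \<open>With Q = 1 - P, \<open>D\<close> splits into the ranges of \<open>hat P\<close> and
  \<open>hat Q\<close>. Shifting only the \<open>hat P\<close> part frees its block 0, which is a
  copy of the range of \<open>P\<close>; the \<open>hat Q\<close> part stays in place.\<close>

lemma D_absorbs:
  assumes P: "bounded_op P" and PP: "\<And>u. u \<in> X \<Longrightarrow> P (P u) = P u"
  shows "lin_homeo smul D (prod_scale smul smul) ({u \<in> X. P u = u} \<times> D)"
proof -
  let ?Y = "{u \<in> X. P u = u}" and ?Q = "\<lambda>u. u - P u"
  have Q: "bounded_op ?Q" by (intro bounded_op_rules(1,4) P)
  have hP: "bounded_op (hat P)" and hQ: "bounded_op (hat ?Q)" by (intro hat_bounded P Q)+
  have PQ: "hat P (hat ?Q u) = 0" "hat ?Q (hat P u) = 0" "hat P (hat P u) = hat P u" "hat ?Q (hat ?Q u) = hat ?Q u"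
    if u: "u \<in> X" for u
    unfolding hat_hat[OF P Q u] hat_hat[OF Q P u] hat_hat[OF P P u] hat_hat[OF Q Q u]
    using hat_cong[OF u, of "\<lambda>u. P (u - P u)" "\<lambda>u. 0"] hat_cong[OF u, of "\<lambda>u. P u - P (P u)" "\<lambda>u. 0"]
      hat_cong[OF u, of "\<lambda>u. P (P u)" P] hat_cong[OF u, of "\<lambda>u. u - P u - P (u - P u)" ?Q]
    by (auto simp: PP bounded_opD[OF P] hat_zero X_closed)
  have sum: "hat P u + hat ?Q u = proj_D u" if "u \<in> X" for u
    using hat_add[OF P Q that] by simp
  let ?f = "\<lambda>a. (P (prj 0 a), hat ?Q a + bwd (hat P a))"
  let ?g = "\<lambda>z. emb 0 (fst z) + fwd (hat P (snd z)) + hat ?Q (snd z)"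
  have D: "D \<subseteq> X" by (auto simp: D_def)
  have fb: "bounded_op (\<lambda>a. P (prj 0 a))" "bounded_op (\<lambda>a. hat ?Q a + bwd (hat P a))"
    by (intro bounded_op_rules(2,3)[OF _ hP] bounded_op_rules(6) bounded_op_rules(2)[OF P bounded_op_rules(7)] bounded_op_rules(3)[OF hQ] bounded_op_rules(2)[OF bounded_op_rules(9) hP] bounded_op_rules(3)[OF bounded_op_rules(2)[OF bounded_op_rules(8) hP] hQ])+
  have gb: "bounded_op (emb 0)" "bounded_op (\<lambda>b. fwd (hat P b) + hat ?Q b)"
    by (intro bounded_op_rules(2,3)[OF _ hP] bounded_op_rules(6) bounded_op_rules(2)[OF P bounded_op_rules(7)] bounded_op_rules(3)[OF hQ] bounded_op_rules(2)[OF bounded_op_rules(9) hP] bounded_op_rules(3)[OF bounded_op_rules(2)[OF bounded_op_rules(8) hP] hQ])+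
  have DX: "a \<in> X" "proj_D a = a" if "a \<in> D" for a using that by (auto simp: D_def)
  note B = bounded_op_rules(6-9)
  note arith = bounded_opD(2)[OF B(1)] bounded_opD(2)[OF B(2)] bounded_opD(2)[OF B(3)] bounded_opD(2)[OF B(4)]
    bounded_opD(2)[OF hP] bounded_opD(2)[OF hQ] bounded_opD(2)[OF P] bounded_opD(2)[OF hat_bounded[OF bounded_op_rules(1)]]
  note zeros = bounded_opD(5)[OF B(1)] bounded_opD(5)[OF B(2)] bounded_opD(5)[OF B(3)] bounded_opD(5)[OF B(4)]
    bounded_opD(5)[OF hP] bounded_opD(5)[OF hQ] bounded_opD(5)[OF P]
  note mem = bounded_opD(1)[OF B(1)] bounded_opD(1)[OF B(2)] bounded_opD(1)[OF B(3)] bounded_opD(1)[OF B(4)]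
    bounded_opD(1)[OF hP] bounded_opD(1)[OF hQ] bounded_opD(1)[OF P] X_closed(2)
  show ?thesis
  proof (rule lin_homeoI[of _ ?f _ ?g])
    show "continuous_on D ?f"
      by (intro continuous_on_Pair continuous_on_subset[OF bounded_opD(7)[OF fb(1)] D] continuous_on_subset[OF bounded_opD(7)[OF fb(2)] D])
    have "continuous_on (?Y \<times> D) (\<lambda>z. emb 0 (fst z) + (fwd (hat P (snd z)) + hat ?Q (snd z)))"
      by (rule continuous_on_add[OF continuous_on_compose2[OF bounded_opD(7)[OF gb(1)] continuous_on_fst[OF continuous_on_id]]
            continuous_on_compose2[OF bounded_opD(7)[OF gb(2)] continuous_on_snd[OF continuous_on_id]]]) (use D in auto)
    then show "continuous_on (?Y \<times> D) ?g" by (simp add: add.assoc)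
    show "linear_on smul (prod_scale smul smul) D ?f"
      using bounded_opD(2,3)[OF fb(1)] bounded_opD(2,3)[OF fb(2)] DX(1) by (auto simp: linear_on_def prod_scale_def)
    show "linear_on (prod_scale smul smul) smul (?Y \<times> D) ?g"
      using bounded_opD(2,3)[OF gb(1)] bounded_opD(2,3)[OF gb(2)] DX(1)
      by (auto simp: linear_on_def prod_scale_def add.assoc scale_right_distrib add_ac)
    show "?f a \<in> ?Y \<times> D" if "a \<in> D" for a
      using DX[OF that] by (auto simp: D_def mem PP arith proj_D_absorb(1) P Q hat_bwd[OF bounded_op_rules(1), symmetric])
    show "?g z \<in> D" if "z \<in> ?Y \<times> D" for z
      using that DX[of "snd z"] by (auto simp: D_def mem arith proj_D_absorb(1) P Q hat_fwd bounded_op_rules(1) hat_emb0)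
    show "?g (?f a) = a" if "a \<in> D" for a
    proof -
      note a = DX[OF that]
      have b: "hat P (hat ?Q a + bwd (hat P a)) = bwd (hat P a)" "hat ?Q (hat ?Q a + bwd (hat P a)) = hat ?Q a"
        using a by (simp_all add: arith mem PQ hat_bwd[OF P, symmetric] hat_bwd[OF Q, symmetric] zeros)
      have "hat P a = emb 0 (P (prj 0 a)) + fwd (bwd (hat P a))"
        unfolding hat_bwd[OF P a(1)] by (rule hat_split[OF P a(1)])
      then have "?g (?f a) = hat P a + hat ?Q a" unfolding fst_conv snd_conv b by simp
      then show ?thesis using sum[OF a(1)] a by simp
    qed
    show "?f (?g z) = z" if zYD: "z \<in> ?Y \<times> D" for z
    proof -
      obtain y b where z: "z = (y, b)" "y \<in> X" "P y = y" "b \<in> X" "proj_D b = b"  using zYD by (cases z) (auto simp: D_def)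
      let ?a = "emb 0 y + fwd (hat P b) + hat ?Q b"
      have 1: "P (prj 0 ?a) = y"
      proof -
        have "P (?Q (prj 0 b)) = 0" using z by (simp add: bounded_opD[OF P] mem PP)
        then show ?thesis using z by (simp add: arith mem map_rules prj_hat[OF Q] bounded_opD(1)[OF Q] zeros)
      qed
      have 2: "hat P ?a = emb 0 y + fwd (hat P b)" "hat ?Q ?a = hat ?Q b"
        using z by (simp_all add: arith mem PQ hat_emb0[OF P] hat_emb0[OF Q] hat_fwd[OF P] hat_fwd[OF Q] zeros)
      have "hat ?Q ?a + bwd (hat P ?a) = hat P b + hat ?Q b"
        unfolding 2 using z by (simp add: arith mem map_rules add.commute)
      then show ?thesis using 1 sum[of b] z by simp
    qed
  qed
qed

text \<open>A factorization of the identity through \<open>P\<close> makes \<open>X\<close>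
  isomorphic to a complemented subspace of the range of \<open>P\<close>, the complement being the
  kernel of \<open>g\<close> there. Together with \<open>X_split\<close> and
  \<open>D_absorbs\<close> this supplies the data for
  \<open>pelczynski_decomposition\<close>.\<close>

lemma isomorphic_of_factorization:
  assumes P: "bounded_op P" and PP: "\<And>u. u \<in> X \<Longrightarrow> P (P u) = P u"
    and f: "bounded_op f" and g: "bounded_op g" and id: "\<And>u. u \<in> X \<Longrightarrow> g (P (f u)) = u"
  shows "isomorphic smul X {u \<in> X. P u = u}"
proof -
  let ?Y = "{u \<in> X. P u = u}" and ?V = "{u \<in> X. P u = u \<and> g u = 0}"
  let ?f = "\<lambda>u. P (f u)"
  have Pf: "bounded_op ?f" by (rule bounded_op_rules(2)[OF P f])
  have r: "bounded_op (\<lambda>y. y - ?f (g y))" by (rule bounded_op_rules(4)[OF bounded_op_rules(1) bounded_op_rules(2)[OF Pf g]])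
  have YXV: "lin_homeo smul ?Y (prod_scale smul smul) (X \<times> ?V)"
  proof (rule lin_homeoI[of _ "\<lambda>y. (g y, y - ?f (g y))" _ "\<lambda>z. ?f (fst z) + snd z"])
    show "continuous_on ?Y (\<lambda>y. (g y, y - ?f (g y)))"
      by (intro continuous_on_Pair continuous_on_subset[OF bounded_opD(7)[OF g]] continuous_on_subset[OF bounded_opD(7)[OF r]]) auto
    show "continuous_on (X \<times> ?V) (\<lambda>z. ?f (fst z) + snd z)"
      by (rule continuous_on_add[OF continuous_on_compose2[OF bounded_opD(7)[OF Pf] continuous_on_fst[OF continuous_on_id]]
            continuous_on_snd[OF continuous_on_id]]) auto
    show "linear_on smul (prod_scale smul smul) ?Y (\<lambda>y. (g y, y - ?f (g y)))"
      using bounded_opD(2,3)[OF g] bounded_opD(2,3)[OF r] by (auto simp: linear_on_def prod_scale_def)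
    show "linear_on (prod_scale smul smul) smul (X \<times> ?V) (\<lambda>z. ?f (fst z) + snd z)"
      using bounded_opD(2,3)[OF Pf] by (auto simp: linear_on_def prod_scale_def scale_right_distrib add_ac)
  qed (use id in \<open>auto simp: bounded_opD[OF g] bounded_opD[OF P] bounded_opD[OF f] PP X_closed\<close>)
  obtain W where W: "lin_homeo smul X (prod_scale smul smul) (D \<times> W)" using X_split by blast
  have DX: "lin_homeo smul D (prod_scale smul smul) (X \<times> D)"
    using D_absorbs[OF bounded_op_rules(1)] by simp
  show ?thesis
    by (rule lin_homeo_imp_isomorphic[OF pelczynski_decomposition[OF W refl DX D_absorbs[OF P PP] YXV]])
qed

text \<open>After division by \<open>c\<close>, \<open>R\<close> is within
  \<open>e / norm c < 1\<close> of the identity. Injectivity and the bound for the inverse come from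
  the estimate from below, surjectivity from Banach's fixed point theorem.\<close>

lemma neumann:
  assumes R: "bounded_op R" and near: "\<And>u. u \<in> X \<Longrightarrow> norm (R u - smul c u) \<le> e * norm u" and e: "0 \<le> e" "e < norm c"
  shows "\<exists>G. bounded_op G \<and> (\<forall>u\<in>X. G (R u) = u)"
proof -
  have c: "c \<noteq> 0" using e by auto
  note Ra = bounded_opD[OF R]
  have lower: "(norm c - e) * norm u \<le> norm (R u)" if "u \<in> X" for u
    using near[OF that] norm_triangle_ineq2[of "smul c u" "smul c u - R u"]
    by (simp add: norm_smul algebra_simps norm_minus_commute)
  have inj: "u = v" if "u \<in> X" "v \<in> X" "R u = R v" for u v
  proof -
    have "(norm c - e) * norm (u - v) \<le> 0" using lower[of "u - v"] that by (simp add: Ra X_closed)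
    then show ?thesis using e by (simp add: mult_le_0_iff)
  qed
  have surj: "\<exists>u\<in>X. R u = y" if y: "y \<in> X" for y
  proof -
    \<comment> \<open>A fixed point of this contraction is exactly a solution of
      \<open>R x = y\<close>.\<close>
    let ?h = "\<lambda>x. smul (inverse c) y + (x - smul (inverse c) (R x))"
    have "\<exists>!x\<in>X. ?h x = x"
    proof (rule Banach_fix[where c = "e / norm c"])
      show "complete X" using closed_X by (simp add: complete_eq_closed)
      show "X \<noteq> {}" using X_closed(1) by blast
      show "?h ` X \<subseteq> X" using y by (auto intro!: X_closed Ra)
      show "dist (?h u) (?h v) \<le> e / norm c * dist u v" if u: "u \<in> X" "v \<in> X" for u v
      proof -
        have "?h u - ?h v = smul (inverse c) (smul c (u - v) - R (u - v))"
          using u c by (simp add: Ra scale_right_diff_distrib algebra_simps)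
        then have "dist (?h u) (?h v) = inverse (norm c) * norm (R (u - v) - smul c (u - v))"
          by (simp only: dist_norm norm_smul norm_inverse norm_minus_commute)
        also have "\<dots> \<le> inverse (norm c) * (e * norm (u - v))" using near u by (intro mult_left_mono) (auto simp: X_closed)
        finally show "dist (?h u) (?h v) \<le> e / norm c * dist u v" by (simp add: dist_norm divide_inverse mult_ac)
      qed
    qed (use e in \<open>auto simp: divide_less_eq\<close>)
    then obtain x where x: "x \<in> X" "?h x = x" by blast
    then have "smul (inverse c) (y - R x) = 0" by (simp add: scale_right_diff_distrib algebra_simps)
    then show ?thesis using c x by (intro bexI[of _ x]) auto
  qed
  define G where "G y = (SOME u. u \<in> X \<and> R u = y)" for y
  have G: "G y \<in> X" "R (G y) = y" if "y \<in> X" for y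
    using someI_ex[of "\<lambda>u. u \<in> X \<and> R u = y"] surj[OF that] unfolding G_def by blast+
  have GR: "G (R u) = u" if "u \<in> X" for u using inj[OF G(1) that G(2)] Ra(1)[OF that] by simp
  have "bop (1 / (norm c - e)) G"
  proof (rule bopI)
    fix u v a assume u: "u \<in> X"
    show "G (smul a u) = smul a (G u)" by (rule inj) (use u in \<open>simp_all add: G X_closed Ra\<close>)
    show "norm (G u) \<le> 1 / (norm c - e) * norm u"
      using lower[OF G(1)[OF u]] e by (simp add: G(2)[OF u] field_simps)
    assume v: "v \<in> X"
    show "G (u + v) = G u + G v" by (rule inj) (use u v in \<open>simp_all add: G X_closed Ra\<close>)
  qed (use e G in auto)
  then show ?thesis using GR unfolding bounded_op_def by blast
qed

end

section \<open>Ultrafilter limits and Haar matrices\<close>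

text \<open>A minimal proper filter below \<open>sequentially\<close>, by Zorn's lemma for the
  reversed order; the infimum of a chain of proper filters is proper. By minimality, restricting it
  to a set that it does not exclude changes nothing.\<close>

lemma ultrafilter_exists:
  "\<exists>U :: nat filter. U \<noteq> bot \<and> U \<le> sequentially \<and> (\<forall>P. eventually P U \<or> eventually (\<lambda>n. \<not> P n) U)"
proof -
  let ?A = "{F :: nat filter. F \<noteq> bot \<and> F \<le> sequentially}"
  let ?R = "relation_of (\<lambda>F G. G \<le> F) ?A"
  have "\<exists>m\<in>?A. \<forall>a\<in>?A. a \<le> m \<longrightarrow> a = m"
  proof (rule predicate_Zorn)
    show "partial_order_on ?A ?R"
      by (rule partial_order_on_relation_ofI) auto
    fix C assume C: "C \<in> Chains ?R"
    then have CA: "C \<subseteq> ?A" and lin: "\<And>F G. F \<in> C \<Longrightarrow> G \<in> C \<Longrightarrow> F \<le> G \<or> G \<le> F"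
      by (auto simp: Chains_def relation_of_def)
    show "\<exists>u\<in>?A. \<forall>a\<in>C. u \<le> a"
    proof (cases "C = {}")
      case True
      then show ?thesis by (intro bexI[of _ sequentially]) auto
    next
      case False
      have base: "\<exists>x\<in>C. x \<le> inf F G" if "F \<in> C" "G \<in> C" for F G
        using lin[OF that] that by (auto intro: bexI[of _ F] bexI[of _ G])
      have "Inf C \<noteq> bot"
      proof
        assume "Inf C = bot"
        then have "eventually (\<lambda>_. False) (Inf C)" by simp
        then obtain F where "F \<in> C" "eventually (\<lambda>_. False) F" using eventually_Inf_base[OF False base] by blast
        then show False using CA by (auto simp: eventually_False)
      qed
      moreover have "Inf C \<le> sequentially"
      proof -
        obtain F where "F \<in> C" using False by blast
        then show ?thesis using CA by (intro Inf_lower2[of F]) auto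
      qed
      ultimately show ?thesis by (intro bexI[of _ "Inf C"]) (auto intro: Inf_lower)
    qed
  qed
  then obtain U where U: "U \<noteq> bot" "U \<le> sequentially" and max: "\<And>F. F \<noteq> bot \<Longrightarrow> F \<le> U \<Longrightarrow> F = U"
    by (force intro: order_trans)
  have "eventually P U \<or> eventually (\<lambda>n. \<not> P n) U" for P
  proof (rule disjCI)
    assume "\<not> eventually (\<lambda>n. \<not> P n) U"
    then have "inf U (principal {n. P n}) \<noteq> bot"
      by (auto simp: trivial_limit_def eventually_inf_principal)
    then have "inf U (principal {n. P n}) = U" by (rule max) simp
    moreover have "eventually P (inf U (principal {n. P n}))" by (simp add: eventually_inf_principal)
    ultimately show "eventually P U" by simp
  qed
  with U show ?thesis by blast
qed

definition ultra :: "nat filter" where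
  "ultra = (SOME U. U \<noteq> bot \<and> U \<le> sequentially \<and> (\<forall>P. eventually P U \<or> eventually (\<lambda>n. \<not> P n) U))"

lemma ultra: "ultra \<noteq> bot" "ultra \<le> sequentially" "eventually P ultra \<or> eventually (\<lambda>n. \<not> P n) ultra"
  using someI_ex[OF ultrafilter_exists] unfolding ultra_def by blast+

lemma eventually_ultra_ge: "eventually (\<lambda>n. N \<le> n) ultra"
  using filter_leD[OF ultra(2) eventually_ge_at_top] .

lemma eventually_ultra_neq: "eventually (\<lambda>n. n \<notin> F) ultra" if "finite F"
  using eventually_ultra_ge[of "Suc (Max (insert 0 F))"]
  by (rule eventually_mono) (metis Max_ge finite_insert insertCI not_less_eq_eq that)

text \<open>All bounded sequences converge along the same ultrafilter, so limits exist for all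
  matrix entries at once, without passing to subsequences.\<close>

definition ulim :: "(nat \<Rightarrow> 'a::t2_space) \<Rightarrow> 'a" where "ulim f = Lim ultra f"

lemma ulim_eqI: "(f \<longlongrightarrow> l) ultra \<Longrightarrow> ulim f = l"
  unfolding ulim_def using ultra(1) by (intro tendsto_Lim) auto

text \<open>Compactness gives a cluster point, and a cluster point along an ultrafilter is a
  limit.\<close>

lemma tendsto_ulim:
  fixes f :: "nat \<Rightarrow> 'a::{real_normed_vector, heine_borel}"
  assumes "\<And>n. norm (f n) \<le> K"
  shows "(f \<longlongrightarrow> ulim f) ultra"
proof -
  have "compact (cball (0 :: 'a) K)" by simp
  moreover have "filtermap f ultra \<noteq> bot" using ultra(1) by (simp add: filtermap_bot_iff)
  moreover have "eventually (\<lambda>x. x \<in> cball 0 K) (filtermap f ultra)"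
    using assms by (simp add: eventually_filtermap)
  ultimately obtain l where l: "inf (nhds l) (filtermap f ultra) \<noteq> bot" unfolding compact_filter by blast
  have "(f \<longlongrightarrow> l) ultra"
  proof (rule topological_tendstoI)
    fix S assume S: "open S" "l \<in> S"
    show "eventually (\<lambda>n. f n \<in> S) ultra"
    proof (rule ccontr)
      assume "\<not> eventually (\<lambda>n. f n \<in> S) ultra"
      then have "eventually (\<lambda>n. f n \<notin> S) ultra" using ultra(3) by blast
      then have "eventually (\<lambda>x. x \<notin> S) (filtermap f ultra)" by (simp add: eventually_filtermap)
      moreover have "eventually (\<lambda>x. x \<in> S) (nhds l)" using S by (rule eventually_nhds_in_open)
      ultimately have "eventually (\<lambda>x. False) (inf (nhds l) (filtermap f ultra))"
        unfolding eventually_inf by blast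
      with l show False by (simp add: trivial_limit_def)
    qed
  qed
  with ulim_eqI[OF this] show ?thesis by simp
qed

lemma norm_ulim_le:
  fixes f :: "nat \<Rightarrow> 'a::{real_normed_vector, heine_borel}"
  assumes "\<And>n. norm (f n) \<le> K" shows "norm (ulim f) \<le> K"
  by (rule tendsto_upperbound[OF tendsto_norm[OF tendsto_ulim[OF assms]] _ ultra(1)]) (use assms in auto)

section \<open>Inequalities for sums of powers\<close>

lemma holder_sum:
  fixes a b :: "'a \<Rightarrow> real"
  assumes p: "1 < p" "1 < q" "1 / p + 1 / q = 1" and a: "\<And>i. i \<in> F \<Longrightarrow> 0 \<le> a i" and b: "\<And>i. i \<in> F \<Longrightarrow> 0 \<le> b i"
  shows "(\<Sum>i\<in>F. a i * b i) \<le> (\<Sum>i\<in>F. a i powr p) powr (1 / p) * (\<Sum>i\<in>F. b i powr q) powr (1 / q)"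
proof (cases "finite F")
  case F: True
  let ?A = "(\<Sum>i\<in>F. a i powr p) powr (1 / p)" and ?B = "(\<Sum>i\<in>F. b i powr q) powr (1 / q)"
  show ?thesis
  proof (cases "(\<Sum>i\<in>F. a i powr p) = 0 \<or> (\<Sum>i\<in>F. b i powr q) = 0")
    case True
    then have "(\<forall>i\<in>F. a i powr p = 0) \<or> (\<forall>i\<in>F. b i powr q = 0)"
      using F by (simp add: sum_nonneg_eq_0_iff)
    then have "(\<Sum>i\<in>F. a i * b i) = 0" by (intro sum.neutral) auto
    then show ?thesis by simp
  next
    case False
    have S: "0 < (\<Sum>i\<in>F. a i powr p)" "0 < (\<Sum>i\<in>F. b i powr q)"
      using False sum_nonneg[of F "\<lambda>i. a i powr p"] sum_nonneg[of F "\<lambda>i. b i powr q"] by (auto simp: less_le)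
    then have AB: "0 < ?A" "0 < ?B" by auto
    have pw: "?A powr p = (\<Sum>i\<in>F. a i powr p)" "?B powr q = (\<Sum>i\<in>F. b i powr q)"
      using S p by (simp_all add: powr_powr)
    have "(\<Sum>i\<in>F. (a i / ?A) * (b i / ?B)) \<le> (\<Sum>i\<in>F. (a i / ?A) powr p / p + (b i / ?B) powr q / q)"
      using a b AB by (intro sum_mono Youngs_inequality p) auto
    also have "\<dots> = (\<Sum>i\<in>F. a i powr p) / ?A powr p / p + (\<Sum>i\<in>F. b i powr q) / ?B powr q / q"
      using a b AB by (simp add: powr_divide sum.distrib sum_divide_distrib)
    also have "\<dots> = 1" unfolding pw using S p by simp
    finally have "(\<Sum>i\<in>F. a i * b i) / (?A * ?B) \<le> 1" by (simp add: sum_divide_distrib)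
    then show ?thesis using AB by (simp add: divide_le_eq)
  qed
qed auto

lemma powr_mean_le:
  fixes x y :: real
  assumes "0 \<le> x" "0 \<le> y" "1 \<le> s"
  shows "((x + y) / 2) powr s \<le> (x powr s + y powr s) / 2"
proof (cases "x = 0 \<or> y = 0")
  case True
  have "(z / 2) powr s \<le> z powr s / 2" if "0 \<le> z" for z :: real
  proof -
    have "(2::real) \<le> 2 powr s" using assms(3) powr_mono[of 1 s 2] by simp
    then have "z powr s / 2 powr s \<le> z powr s / 2" by (intro divide_left_mono) auto
    then show ?thesis using that by (simp only: powr_divide)
  qed
  with assms True show ?thesis by auto
next
  case False
  then have "x \<in> {0<..}" "y \<in> {0<..}" using assms by auto
  from convex_onD[OF powr_convex[OF assms(3)], of "1/2" x y, OF _ _ this] show ?thesis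
    by (simp add: field_simps)
qed

text \<open>After division by \<open>u + v\<close> this is \<open>z \<le> z powr t\<close> on the
  unit interval.\<close>

lemma powr_add_le:
  fixes u v :: real
  assumes "0 \<le> u" "0 \<le> v" "0 < t" "t \<le> 1"
  shows "(u + v) powr t \<le> u powr t + v powr t"
proof (cases "u + v = 0")
  case False
  then have w: "0 < u + v" using assms by simp
  have "z \<le> z powr t" if "0 \<le> z" "z \<le> 1" for z :: real
    using that assms powr_mono'[of t 1 z] by (cases "z = 0") auto
  then have "u / (u + v) + v / (u + v) \<le> (u / (u + v)) powr t + (v / (u + v)) powr t"
    using assms w by (intro add_mono) auto
  moreover have "u / (u + v) + v / (u + v) = 1" using w by (simp add: add_divide_distrib[symmetric])
  ultimately have "1 \<le> (u powr t + v powr t) / (u + v) powr t"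
    using assms w by (simp add: powr_divide add_divide_distrib)
  then show ?thesis using w by (simp add: le_divide_eq)
qed (use assms in auto)

text \<open>For t = s / 2, convexity of the power 1 / t and the parallelogram law bound the mean of
  the two terms on the left by \<open>(a\<^sup>2 + b\<^sup>2) powr t\<close>; then the power t is
  subadditive.\<close>

lemma clarkson_real:
  fixes a b :: real
  assumes s: "1 < s" "s \<le> 2"
  shows "\<bar>a + b\<bar> powr s + \<bar>a - b\<bar> powr s \<le> 2 * (\<bar>a\<bar> powr s + \<bar>b\<bar> powr s)"
proof -
  define t where "t = s / 2"
  have t: "0 < t" "t \<le> 1" "1 \<le> 1 / t" using s by (auto simp: t_def)
  have sq: "(x\<^sup>2) powr t = \<bar>x\<bar> powr s" for x :: real
  proof -
    have "(x\<^sup>2) powr t = (\<bar>x\<bar> powr 2) powr t" by (simp add: powr_numeral)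
    also have "\<dots> = \<bar>x\<bar> powr s" unfolding powr_powr by (simp add: t_def)
    finally show ?thesis .
  qed
  let ?U = "\<bar>a + b\<bar> powr s" and ?V = "\<bar>a - b\<bar> powr s"
  have "((?U + ?V) / 2) powr (1 / t) \<le> (?U powr (1 / t) + ?V powr (1 / t)) / 2"
    by (rule powr_mean_le) (use t in auto)
  also have "\<dots> = a\<^sup>2 + b\<^sup>2"
  proof -
    have "(\<bar>z\<bar> powr s) powr (1 / t) = \<bar>z\<bar> powr 2" for z unfolding powr_powr using s by (simp add: t_def)
    then have "(\<bar>z\<bar> powr s) powr (1 / t) = z\<^sup>2" for z by (simp add: powr_numeral)
    then show ?thesis by (simp add: power2_eq_square algebra_simps)
  qed
  finally have "(((?U + ?V) / 2) powr (1 / t)) powr t \<le> (a\<^sup>2 + b\<^sup>2) powr t" using t by (intro powr_mono2) auto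
  also have "\<dots> \<le> (a\<^sup>2) powr t + (b\<^sup>2) powr t" by (rule powr_add_le) (use t in auto)
  finally have "(((?U + ?V) / 2) powr (1 / t)) powr t \<le> \<bar>a\<bar> powr s + \<bar>b\<bar> powr s" unfolding sq .
  then show ?thesis unfolding powr_powr using t by simp
qed

text \<open>\<open>haar k\<close> is the kernel of a dyadic paraproduct: \<open>haar k i j\<close> is the sum of
  \<open>h\<^sub>J(i) / |J|\<close> over the nontrivial dyadic subintervals \<open>J\<close> of \<open>{0..<2\<^sup>k}\<close> containing \<open>i\<close> and \<open>j\<close>, where \<open>h\<^sub>J\<close> is
  \<open>1\<close> on the left and \<open>-1\<close> on the right half of \<open>J\<close>.\<close>

fun haar :: "nat \<Rightarrow> nat \<Rightarrow> nat \<Rightarrow> real" where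
  "haar 0 i j = 0"
| "haar (Suc k) i j = (haar k (i div 2) (j div 2) + (if i div 2 = j div 2 then (if even i then 1 else -1) else 0)) / 2"

lemma sum_pairs: "(\<Sum>i<2 * n. f i) = (\<Sum>i<n. f (2 * i) + f (2 * i + 1))" for f :: "nat \<Rightarrow> 'a::comm_monoid_add"
  by (induction n) (auto simp: add_ac)

lemma sum_pairs2: "(\<Sum>i<2 * n. \<Sum>j<2 * n. f i j) = (\<Sum>i<n. \<Sum>j<n.
    f (2 * i) (2 * j) + f (2 * i) (2 * j + 1) + (f (2 * i + 1) (2 * j) + f (2 * i + 1) (2 * j + 1)))"
  for f :: "nat \<Rightarrow> nat \<Rightarrow> 'a::comm_monoid_add"
  by (simp only: sum_pairs sum.distrib add_ac)

lemma haar_even_odd: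
  "haar (Suc k) (2 * i) (2 * j) = (haar k i j + (if i = j then 1 else 0)) / 2"
  "haar (Suc k) (2 * i) (2 * j + 1) = (haar k i j + (if i = j then 1 else 0)) / 2"
  "haar (Suc k) (2 * i + 1) (2 * j) = (haar k i j - (if i = j then 1 else 0)) / 2"
  "haar (Suc k) (2 * i + 1) (2 * j + 1) = (haar k i j - (if i = j then 1 else 0)) / 2"
proof -
  have d: "2 * m div 2 = m" "(2 * m + 1) div 2 = m" "even (2 * m) = True" "even (2 * m + 1) = False" for m :: nat
    by auto
  have c: "x + (if i = j then - 1 else 0) = x - (if i = j then 1 else 0)" for x :: real by simp
  show "haar (Suc k) (2 * i) (2 * j) = (haar k i j + (if i = j then 1 else 0)) / 2"
    "haar (Suc k) (2 * i) (2 * j + 1) = (haar k i j + (if i = j then 1 else 0)) / 2"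
    "haar (Suc k) (2 * i + 1) (2 * j) = (haar k i j - (if i = j then 1 else 0)) / 2"
    "haar (Suc k) (2 * i + 1) (2 * j + 1) = (haar k i j - (if i = j then 1 else 0)) / 2"
    unfolding haar.simps(2) d if_True if_False c by (rule refl)+
qed

text \<open>The signs of the two halves cancel, so the trace is the same at every level.\<close>

lemma haar_diag: "(\<Sum>i<2 ^ k. haar k i i) = 0"
proof (induction k)
  case (Suc k)
  have "(\<Sum>i<2 ^ Suc k. haar (Suc k) i i) = (\<Sum>i<2 ^ k. haar (Suc k) (2 * i) (2 * i) + haar (Suc k) (2 * i + 1) (2 * i + 1))"
    unfolding power_Suc sum_pairs ..
  also have "\<dots> = (\<Sum>i<2 ^ k. haar k i i)" unfolding haar_even_odd by (intro sum.cong) (auto simp: field_simps)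
  finally show ?case using Suc by simp
qed simp

text \<open>Passing to the next level, an entry off the diagonal becomes four entries of half its
  size, which doubles the sum. In addition each of the \<open>2 ^ k\<close> diagonal entries puts
  one new entry above the diagonal, and together these contribute \<open>2 ^ k / 2\<close>. Hence
  the factor \<open>k\<close>.\<close>

lemma haar_upper: "(\<Sum>i<2 ^ k. \<Sum>j<2 ^ k. if i < j then haar k i j else 0) = k * 2 ^ k / 4"
proof (induction k)
  case (Suc k)
  let ?n = "2 ^ k :: nat"
  let ?f = "\<lambda>i j. if i < j then haar (Suc k) i j else 0"
  have "(\<Sum>i<2 ^ Suc k. \<Sum>j<2 ^ Suc k. ?f i j) =
      (\<Sum>i<?n. \<Sum>j<?n. ?f (2 * i) (2 * j) + ?f (2 * i) (2 * j + 1) + (?f (2 * i + 1) (2 * j) + ?f (2 * i + 1) (2 * j + 1)))"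
    unfolding power_Suc by (rule sum_pairs2)
  also have "\<dots> = (\<Sum>i<?n. \<Sum>j<?n. 2 * (if i < j then haar k i j else 0) + (if i = j then (haar k i i + 1) / 2 else 0))"
    unfolding haar_even_odd by (intro sum.cong refl) (auto simp: field_simps)
  also have "\<dots> = 2 * (\<Sum>i<?n. \<Sum>j<?n. if i < j then haar k i j else 0) + (\<Sum>i<?n. (haar k i i + 1) / 2)"
    unfolding sum.distrib sum_distrib_left[symmetric] by simp
  also have "(\<Sum>i<?n. (haar k i i + 1) / 2) = ?n / 2"
    using haar_diag[of k] by (simp add: sum.distrib flip: sum_divide_distrib)
  finally show ?case unfolding Suc by (simp add: field_simps)
qed simp

text \<open>It makes a constant matrix drop out when paired with \<open>haar k\<close>.\<close>

lemma haar_total: "(\<Sum>i<2 ^ k. \<Sum>j<2 ^ k. haar k i j) = 0"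
proof (induction k)
  case (Suc k)
  let ?n = "2 ^ k :: nat"
  let ?f = "haar (Suc k)"
  have "(\<Sum>i<2 ^ Suc k. \<Sum>j<2 ^ Suc k. ?f i j) =
      (\<Sum>i<?n. \<Sum>j<?n. ?f (2 * i) (2 * j) + ?f (2 * i) (2 * j + 1) + (?f (2 * i + 1) (2 * j) + ?f (2 * i + 1) (2 * j + 1)))"
    unfolding power_Suc by (rule sum_pairs2)
  also have "\<dots> = (\<Sum>i<?n. \<Sum>j<?n. 2 * haar k i j)"
    unfolding haar_even_odd by (intro sum.cong refl) (auto simp: field_simps)
  also have "\<dots> = 0" using Suc by (simp flip: sum_distrib_left)
  finally show ?case .
qed simp

text \<open>Let z be the averages of \<open>y\<close> over pairs and a the image of z one level
  lower. The image of \<open>y\<close> takes the values a + z and a - z on the pairs. Clarkson's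
  inequality costs a factor 2, averaging gains it back, and each level adds the power sum of
  \<open>y\<close> at most once.\<close>

lemma haar_operator:
  assumes s: "1 < s" "s \<le> 2"
  shows "(\<Sum>i<2 ^ k. \<bar>\<Sum>j<2 ^ k. haar k i j * y j\<bar> powr s) \<le> k * (\<Sum>j<2 ^ k. \<bar>y j\<bar> powr s)"
proof (induction k arbitrary: y)
  case (Suc k)
  let ?n = "2 ^ k :: nat"
  define z where "z j = (y (2 * j) + y (2 * j + 1)) / 2" for j
  define a where "a i = (\<Sum>j<?n. haar k i j * z j)" for i
  have delta: "(\<Sum>j<?n. (if i = j then 1 else 0) * z j) = z i" if "i < ?n" for i
  proof -
    have "(\<Sum>j<?n. (if i = j then 1 else 0) * z j) = (\<Sum>j<?n. if i = j then z j else 0)"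
      by (rule sum.cong) auto
    then show ?thesis using that by simp
  qed
  have ev: "(\<Sum>j<2 ^ Suc k. haar (Suc k) (2 * i) j * y j) = a i + z i"
    and od: "(\<Sum>j<2 ^ Suc k. haar (Suc k) (2 * i + 1) j * y j) = a i - z i" if i: "i < ?n" for i
  proof -
    have "(\<Sum>j<2 ^ Suc k. haar (Suc k) (2 * i) j * y j) = (\<Sum>j<?n. haar k i j * z j + (if i = j then 1 else 0) * z j)"
      unfolding power_Suc sum_pairs haar_even_odd z_def by (intro sum.cong refl) (simp add: field_simps)
    then show "(\<Sum>j<2 ^ Suc k. haar (Suc k) (2 * i) j * y j) = a i + z i"
      unfolding sum.distrib delta[OF i] a_def .
    have "(\<Sum>j<2 ^ Suc k. haar (Suc k) (2 * i + 1) j * y j) = (\<Sum>j<?n. haar k i j * z j - (if i = j then 1 else 0) * z j)"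
      unfolding power_Suc sum_pairs haar_even_odd z_def by (intro sum.cong refl) (simp add: field_simps)
    then show "(\<Sum>j<2 ^ Suc k. haar (Suc k) (2 * i + 1) j * y j) = a i - z i"
      unfolding sum_subtractf delta[OF i] a_def .
  qed
  have zs: "(\<Sum>j<?n. \<bar>z j\<bar> powr s) \<le> (\<Sum>j<2 ^ Suc k. \<bar>y j\<bar> powr s) / 2"
  proof -
    have "\<bar>z j\<bar> powr s \<le> (\<bar>y (2 * j)\<bar> powr s + \<bar>y (2 * j + 1)\<bar> powr s) / 2" for j
    proof -
      have "\<bar>z j\<bar> powr s \<le> ((\<bar>y (2 * j)\<bar> + \<bar>y (2 * j + 1)\<bar>) / 2) powr s"
        unfolding z_def using s by (intro powr_mono2) auto
      also have "\<dots> \<le> (\<bar>y (2 * j)\<bar> powr s + \<bar>y (2 * j + 1)\<bar> powr s) / 2" using s by (intro powr_mean_le) auto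
      finally show ?thesis .
    qed
    then show ?thesis unfolding power_Suc sum_pairs sum_divide_distrib by (intro sum_mono)
  qed
  have "(\<Sum>i<2 ^ Suc k. \<bar>\<Sum>j<2 ^ Suc k. haar (Suc k) i j * y j\<bar> powr s) = (\<Sum>i<?n. \<bar>a i + z i\<bar> powr s + \<bar>a i - z i\<bar> powr s)"
    unfolding power_Suc[of 2 k] sum_pairs[of "\<lambda>i. \<bar>\<Sum>j<2 * 2 ^ k. haar (Suc k) i j * y j\<bar> powr s"]
    using ev od by (intro sum.cong refl) (simp del: haar.simps)
  also have "\<dots> \<le> (\<Sum>i<?n. 2 * (\<bar>a i\<bar> powr s + \<bar>z i\<bar> powr s))" by (intro sum_mono clarkson_real s)
  also have "\<dots> = 2 * ((\<Sum>i<?n. \<bar>a i\<bar> powr s) + (\<Sum>i<?n. \<bar>z i\<bar> powr s))"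
    by (simp add: sum.distrib sum_distrib_left)
  also have "(\<Sum>i<?n. \<bar>a i\<bar> powr s) \<le> k * (\<Sum>i<?n. \<bar>z i\<bar> powr s)" unfolding a_def by (rule Suc)
  also have "2 * (real k * (\<Sum>i<?n. \<bar>z i\<bar> powr s) + (\<Sum>i<?n. \<bar>z i\<bar> powr s)) = Suc k * (2 * (\<Sum>i<?n. \<bar>z i\<bar> powr s))"
    by (simp add: algebra_simps)
  also have "\<dots> \<le> Suc k * (\<Sum>j<2 ^ Suc k. \<bar>y j\<bar> powr s)" using zs by (intro mult_left_mono) auto
  finally show ?case by simp
qed simp

text \<open>Hoelder's inequality against the constant 1, with exponents \<open>q / s\<close> and
  \<open>q / (q - s)\<close>.\<close>

lemma powr_norm_le:
  fixes a :: "'a \<Rightarrow> real"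
  assumes F: "finite F" "F \<noteq> {}" and s: "1 < s" "s \<le> q" and a: "\<And>i. i \<in> F \<Longrightarrow> 0 \<le> a i"
  shows "(\<Sum>i\<in>F. a i powr s) powr (1 / s) \<le> card F powr (1 / s - 1 / q) * (\<Sum>i\<in>F. a i powr q) powr (1 / q)"
proof (cases "s = q")
  case True
  then show ?thesis using F by simp
next
  case False
  then have sq: "s < q" using s by simp
  have "(\<Sum>i\<in>F. a i powr s * 1) \<le> (\<Sum>i\<in>F. (a i powr s) powr (q / s)) powr (1 / (q / s)) *
      (\<Sum>i\<in>F. 1 powr (q / (q - s))) powr (1 / (q / (q - s)))"
    using s sq by (intro holder_sum) (auto simp: field_simps)
  also have "\<dots> = (\<Sum>i\<in>F. a i powr q) powr (s / q) * card F powr ((q - s) / q)"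
    using s by (simp add: powr_powr)
  finally have "(\<Sum>i\<in>F. a i powr s) powr (1 / s) \<le> ((\<Sum>i\<in>F. a i powr q) powr (s / q) * card F powr ((q - s) / q)) powr (1 / s)"
    using s by (intro powr_mono2) (auto intro: sum_nonneg)
  also have "\<dots> = (\<Sum>i\<in>F. a i powr q) powr (1 / q) * card F powr ((q - s) / q / s)"
    using s by (simp add: powr_mult powr_powr sum_nonneg)
  also have "(q - s) / q / s = 1 / s - 1 / q" using s by (simp add: field_simps)
  finally show ?thesis by (simp add: mult.commute)
qed

text \<open>Here s is the exponent conjugate to \<open>p\<close>. The condition
  \<open>2 \<le> p\<close> gives \<open>s \<le> 2\<close>, as \<open>haar_operator\<close> needs;
  \<open>1 / p + 1 / q \<le> 1\<close> gives \<open>s \<le> q\<close>, as the comparison of norms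
  needs.\<close>

lemma haar_form_real:
  fixes x y :: "nat \<Rightarrow> real"
  assumes p: "2 \<le> p" "1 < q" "1 / p + 1 / q \<le> 1"
  shows "\<bar>\<Sum>i<2 ^ k. \<Sum>j<2 ^ k. haar k i j * (x i * y j)\<bar> \<le>
    real k powr (1 - 1 / p) * (2 ^ k) powr (1 - 1 / p - 1 / q) *
    ((\<Sum>i<2 ^ k. \<bar>x i\<bar> powr p) powr (1 / p) * (\<Sum>j<2 ^ k. \<bar>y j\<bar> powr q) powr (1 / q))"
proof -
  define s where "s = 1 / (1 - 1 / p)"
  have is_eq: "1 / s = 1 - 1 / p" by (simp add: s_def)
  have s: "1 < s" "s \<le> 2" using p by (auto simp: s_def field_simps)
  have sq: "s \<le> q"
  proof -
    have "1 / q \<le> 1 / s" using p is_eq by simp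
    then show ?thesis using s p by (simp add: field_simps)
  qed
  let ?n = "2 ^ k :: nat"
  define z where "z i = (\<Sum>j<?n. haar k i j * y j)" for i
  have "\<bar>\<Sum>i<?n. \<Sum>j<?n. haar k i j * (x i * y j)\<bar> = \<bar>\<Sum>i<?n. x i * z i\<bar>"
    unfolding z_def by (simp add: sum_distrib_left mult_ac)
  also have "\<dots> \<le> (\<Sum>i<?n. \<bar>x i\<bar> * \<bar>z i\<bar>)" using sum_abs[of "\<lambda>i. x i * z i"] by (simp add: abs_mult)
  also have "\<dots> \<le> (\<Sum>i<?n. \<bar>x i\<bar> powr p) powr (1 / p) * (\<Sum>i<?n. \<bar>z i\<bar> powr s) powr (1 / s)"
    using s p is_eq by (intro holder_sum) auto
  finally have 1: "\<bar>\<Sum>i<?n. \<Sum>j<?n. haar k i j * (x i * y j)\<bar> \<le>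
    (\<Sum>i<?n. \<bar>x i\<bar> powr p) powr (1 / p) * (\<Sum>i<?n. \<bar>z i\<bar> powr s) powr (1 / s)" .
  have "(\<Sum>i<?n. \<bar>z i\<bar> powr s) powr (1 / s) \<le> (real k * (\<Sum>j<?n. \<bar>y j\<bar> powr s)) powr (1 / s)"
    unfolding z_def using s by (intro powr_mono2 haar_operator) (auto intro: sum_nonneg)
  also have "\<dots> = real k powr (1 / s) * (\<Sum>j<?n. \<bar>y j\<bar> powr s) powr (1 / s)"
    by (simp add: powr_mult sum_nonneg)
  also have "\<dots> \<le> real k powr (1 / s) * (card {..<?n} powr (1 / s - 1 / q) * (\<Sum>j<?n. \<bar>y j\<bar> powr q) powr (1 / q))"
    using s sq by (intro mult_left_mono powr_norm_le) (auto simp: lessThan_empty_iff)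
  finally have 2: "(\<Sum>i<?n. \<bar>z i\<bar> powr s) powr (1 / s) \<le>
    real k powr (1 / s) * ((2 ^ k) powr (1 / s - 1 / q) * (\<Sum>j<?n. \<bar>y j\<bar> powr q) powr (1 / q))" by simp
  show ?thesis
    by (rule order_trans[OF 1 order_trans[OF mult_left_mono[OF 2]]]) (simp_all add: is_eq mult_ac)
qed

text \<open>Real coordinates, not linear but bounded. Take a 1/2-net of the compact unit ball,
  approximate x by a net point, double the remainder and repeat. This writes x as a series of net
  points with coefficients \<open>(1 / 2) ^ k\<close>; collecting equal points gives coefficients of
  size at most 2.\<close>

lemma unit_ball_net:
  "\<exists>F :: 'a::{real_normed_vector, heine_borel} set. finite F \<and> (\<forall>f\<in>F. norm f \<le> 1) \<and>
    (\<forall>x. \<exists>c. (\<forall>f\<in>F. \<bar>c f\<bar> \<le> 2 * norm x) \<and> x = (\<Sum>f\<in>F. c f *\<^sub>R f))"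
proof -
  have "compact (cball (0 :: 'a) 1)" by simp
  then obtain F where F: "F \<subseteq> cball (0 :: 'a) 1" "finite F" "cball 0 1 \<subseteq> (\<Union>f\<in>F. ball f (1 / 2))"
    by (rule compactE_image[of _ "cball 0 1" "\<lambda>f. ball f (1 / 2)"]) auto
  have unit: "\<exists>c. (\<forall>f\<in>F. \<bar>c f\<bar> \<le> 2) \<and> x = (\<Sum>f\<in>F. c f *\<^sub>R f)" if x: "norm x \<le> 1" for x :: 'a
  proof -
    have "\<forall>v :: 'a. norm v \<le> 1 \<longrightarrow> (\<exists>f\<in>F. norm (2 *\<^sub>R (v - f)) \<le> 1)"
    proof (intro allI impI)
      fix v :: 'a assume "norm v \<le> 1"
      then obtain f where "f \<in> F" "v \<in> ball f (1 / 2)" using F(3) by auto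
      then show "\<exists>f\<in>F. norm (2 *\<^sub>R (v - f)) \<le> 1"
        by (intro bexI[of _ f]) (auto simp: dist_norm norm_minus_commute simp del: real_scaleR_def)
    qed
    then obtain \<phi> where \<phi>: "\<And>v :: 'a. norm v \<le> 1 \<Longrightarrow> \<phi> v \<in> F \<and> norm (2 *\<^sub>R (v - \<phi> v)) \<le> 1" by metis
    define r where "r k = ((\<lambda>v. 2 *\<^sub>R (v - \<phi> v)) ^^ k) x" for k
    have r: "norm (r k) \<le> 1" for k by (induction k) (auto simp: r_def x \<phi> simp del: norm_scaleR)
    have \<phi>r: "\<phi> (r k) \<in> F" for k using \<phi>[OF r] by blast
    have exp: "x = (\<Sum>k<n. (1 / 2) ^ k *\<^sub>R \<phi> (r k)) + (1 / 2) ^ n *\<^sub>R r n" for n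
    proof (induction n)
      case (Suc n)
      have "r (Suc n) = 2 *\<^sub>R (r n - \<phi> (r n))" by (simp add: r_def)
      then have "(1 / 2) ^ Suc n *\<^sub>R r (Suc n) = (1 / 2) ^ n *\<^sub>R r n - (1 / 2) ^ n *\<^sub>R \<phi> (r n)"
        by (simp add: scaleR_right_diff_distrib)
      then show ?case using Suc by (simp add: algebra_simps)
    qed (simp add: r_def)
    define a where "a f k = (if \<phi> (r k) = f then (1 / 2 :: real) ^ k else 0)" for f k
    have g: "summable (\<lambda>k. (1 / 2 :: real) ^ k)" by (rule summable_geometric) simp
    have sa: "summable (a f)" for f
      by (rule summable_comparison_test'[OF g, of 0]) (auto simp: a_def)
    have b1: "\<bar>suminf (a f)\<bar> \<le> 2" for f
    proof -
      have "0 \<le> suminf (a f)" by (rule suminf_nonneg[OF sa]) (auto simp: a_def)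
      moreover have "suminf (a f) \<le> (\<Sum>k. (1 / 2 :: real) ^ k)" by (rule suminf_le[OF _ sa g]) (auto simp: a_def)
      moreover have "(\<Sum>k. (1 / 2 :: real) ^ k) = 2" using suminf_geometric[of "1 / 2 :: real"] by simp
      ultimately show ?thesis by simp
    qed
    have b2: "x = (\<Sum>f\<in>F. suminf (a f) *\<^sub>R f)"
    proof -
      have 1: "(\<lambda>n. \<Sum>f\<in>F. (\<Sum>k<n. a f k) *\<^sub>R f) \<longlonglongrightarrow> (\<Sum>f\<in>F. suminf (a f) *\<^sub>R f)"
        by (intro tendsto_intros summable_LIMSEQ sa)
      have 2: "(\<Sum>f\<in>F. (\<Sum>k<n. a f k) *\<^sub>R f) = x - (1 / 2) ^ n *\<^sub>R r n" for n
      proof -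
        have "(\<Sum>f\<in>F. (\<Sum>k<n. a f k) *\<^sub>R f) = (\<Sum>k<n. \<Sum>f\<in>F. a f k *\<^sub>R f)"
          by (simp add: scaleR_sum_left) (rule sum.swap)
        also have "\<dots> = (\<Sum>k<n. (1 / 2) ^ k *\<^sub>R \<phi> (r k))"
        proof (rule sum.cong[OF refl])
          fix k
          have "(\<Sum>f\<in>F. a f k *\<^sub>R f) = (\<Sum>f\<in>F. if \<phi> (r k) = f then (1 / 2) ^ k *\<^sub>R f else 0)"
            by (rule sum.cong) (auto simp: a_def)
          then show "(\<Sum>f\<in>F. a f k *\<^sub>R f) = (1 / 2) ^ k *\<^sub>R \<phi> (r k)" using F(2) \<phi>r by simp
        qed
        also have "\<dots> = x - (1 / 2) ^ n *\<^sub>R r n" unfolding eq_diff_eq by (rule exp[symmetric])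
        finally show ?thesis .
      qed
      have "(\<lambda>n. (1 / 2) ^ n *\<^sub>R r n) \<longlonglongrightarrow> 0"
      proof (rule Lim_null_comparison)
        show "\<forall>\<^sub>F n in sequentially. norm ((1 / 2) ^ n *\<^sub>R r n) \<le> (1 / 2) ^ n"
          using r by (intro always_eventually allI) (simp add: mult_left_le)
        show "(\<lambda>n. (1 / 2 :: real) ^ n) \<longlonglongrightarrow> 0" by (rule LIMSEQ_realpow_zero) auto
      qed
      from tendsto_diff[OF tendsto_const[of x] this]
      have "(\<lambda>n. \<Sum>f\<in>F. (\<Sum>k<n. a f k) *\<^sub>R f) \<longlonglongrightarrow> x - 0" unfolding 2 .
      from LIMSEQ_unique[OF this 1] show ?thesis by (simp only: diff_0_right)
    qed
    show ?thesis by (intro exI[of _ "\<lambda>f. suminf (a f)"] conjI ballI b1 b2)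
  qed
  have "\<exists>c. (\<forall>f\<in>F. \<bar>c f\<bar> \<le> 2 * norm x) \<and> x = (\<Sum>f\<in>F. c f *\<^sub>R f)" for x :: 'a
  proof (cases "x = 0")
    case False
    then have "norm (x /\<^sub>R norm x) \<le> 1" by simp
    from unit[OF this] obtain c where c: "\<forall>f\<in>F. \<bar>c f\<bar> \<le> 2" "x /\<^sub>R norm x = (\<Sum>f\<in>F. c f *\<^sub>R f)" by blast
    have "x = norm x *\<^sub>R (x /\<^sub>R norm x)" using False by simp
    also have "\<dots> = (\<Sum>f\<in>F. (norm x * c f) *\<^sub>R f)" unfolding c(2) by (simp add: scaleR_sum_right)
    finally have e: "x = (\<Sum>f\<in>F. (norm x * c f) *\<^sub>R f)" .
    have b: "\<bar>norm x * c f\<bar> \<le> 2 * norm x" if "f \<in> F" for f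
      using mult_left_mono[of "\<bar>c f\<bar>" 2 "norm x"] c(1) that by (simp add: abs_mult mult.commute)
    show ?thesis by (intro exI[of _ "\<lambda>f. norm x * c f"] conjI ballI b e)
  next
    case True
    then show ?thesis by (intro exI[of _ "\<lambda>_. 0"]) simp
  qed
  then show ?thesis using F by (intro exI[of _ F]) (auto simp: subset_iff)
qed

text \<open>Both vectors are expanded over the net and the real estimate is applied to each pair of
  net points. Every coordinate costs a factor 2, whence the constant
  \<open>4 * (real (card F))\<^sup>2\<close>, which is uniform in p, q and k.\<close>

lemma haar_form:
  "\<exists>B \<ge> 0. \<forall>p q k. \<forall>x y :: nat \<Rightarrow> 'k::{real_normed_field, heine_borel}. 2 \<le> p \<longrightarrow> 1 < q \<longrightarrow> 1 / p + 1 / q \<le> 1 \<longrightarrow>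
    norm (\<Sum>i<2 ^ k. \<Sum>j<2 ^ k. haar k i j *\<^sub>R (x i * y j)) \<le>
    B * (real k powr (1 - 1 / p) * (2 ^ k) powr (1 - 1 / p - 1 / q)) *
    ((\<Sum>i<2 ^ k. norm (x i) powr p) powr (1 / p) * (\<Sum>j<2 ^ k. norm (y j) powr q) powr (1 / q))"
proof -
  obtain F :: "'k set" where F: "finite F" "\<And>f. f \<in> F \<Longrightarrow> norm f \<le> 1"
    and net: "\<And>x. \<exists>c. (\<forall>f\<in>F. \<bar>c f\<bar> \<le> 2 * norm x) \<and> x = (\<Sum>f\<in>F. c f *\<^sub>R f)"
    using unit_ball_net[where 'a = 'k] by blast
  from net obtain c where c: "\<And>x f. f \<in> F \<Longrightarrow> \<bar>c x f\<bar> \<le> 2 * norm x" "\<And>x. x = (\<Sum>f\<in>F. c x f *\<^sub>R f)" by metis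
  let ?B = "4 * (real (card F))\<^sup>2"
  show ?thesis
  proof (intro exI[of _ ?B] conjI allI impI)
    fix p q :: real and k :: nat and x y :: "nat \<Rightarrow> 'k"
    assume p: "2 \<le> p" "1 < q" "1 / p + 1 / q \<le> 1"
    let ?n = "2 ^ k :: nat" and ?K = "real k powr (1 - 1 / p) * (2 ^ k) powr (1 - 1 / p - 1 / q)"
    let ?X = "(\<Sum>i<?n. norm (x i) powr p) powr (1 / p)" and ?Y = "(\<Sum>j<?n. norm (y j) powr q) powr (1 / q)"
    let ?S = "\<lambda>f g. \<Sum>i<?n. \<Sum>j<?n. haar k i j * (c (x i) f * c (y j) g)"
    have coord: "(\<Sum>i<?n. \<bar>c (z i) f\<bar> powr t) powr (1 / t) \<le> 2 * (\<Sum>i<?n. norm (z i) powr t) powr (1 / t)"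
      if "f \<in> F" "1 < t" for f t and z :: "nat \<Rightarrow> 'k"
    proof -
      have "(\<Sum>i<?n. \<bar>c (z i) f\<bar> powr t) \<le> (\<Sum>i<?n. (2 * norm (z i)) powr t)"
        using that c(1) by (intro sum_mono powr_mono2) auto
      also have "\<dots> = 2 powr t * (\<Sum>i<?n. norm (z i) powr t)" by (simp add: powr_mult sum_distrib_left)
      finally have "(\<Sum>i<?n. \<bar>c (z i) f\<bar> powr t) powr (1 / t) \<le> (2 powr t * (\<Sum>i<?n. norm (z i) powr t)) powr (1 / t)"
        using that by (intro powr_mono2) (auto intro: sum_nonneg)
      also have "\<dots> = 2 * (\<Sum>i<?n. norm (z i) powr t) powr (1 / t)"
        using that by (simp add: powr_mult powr_powr sum_nonneg)
      finally show ?thesis .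
    qed
    have S: "\<bar>?S f g\<bar> \<le> 4 * (?K * (?X * ?Y))" if "f \<in> F" "g \<in> F" for f g
    proof -
      have "\<bar>?S f g\<bar> \<le> ?K * ((\<Sum>i<?n. \<bar>c (x i) f\<bar> powr p) powr (1 / p) * (\<Sum>i<?n. \<bar>c (y i) g\<bar> powr q) powr (1 / q))"
        by (rule haar_form_real[OF p])
      also have "\<dots> \<le> ?K * ((2 * ?X) * (2 * ?Y))"
        using p that by (intro mult_left_mono mult_mono coord) auto
      finally show ?thesis by (simp add: mult_ac)
    qed
    have "(\<Sum>i<?n. \<Sum>j<?n. haar k i j *\<^sub>R (x i * y j)) = (\<Sum>i<?n. \<Sum>j<?n. \<Sum>f\<in>F. \<Sum>g\<in>F. (haar k i j * (c (x i) f * c (y j) g)) *\<^sub>R (f * g))"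
    proof (intro sum.cong refl)
      fix i j
      have "x i * y j = (\<Sum>f\<in>F. c (x i) f *\<^sub>R f) * (\<Sum>g\<in>F. c (y j) g *\<^sub>R g)" using c(2) by metis
      then show "haar k i j *\<^sub>R (x i * y j) = (\<Sum>f\<in>F. \<Sum>g\<in>F. (haar k i j * (c (x i) f * c (y j) g)) *\<^sub>R (f * g))"
        by (simp add: sum_product scaleR_sum_right mult_ac)
    qed
    also have "\<dots> = (\<Sum>i<?n. \<Sum>f\<in>F. \<Sum>j<?n. \<Sum>g\<in>F. (haar k i j * (c (x i) f * c (y j) g)) *\<^sub>R (f * g))"
      by (intro sum.cong refl sum.swap)
    also have "\<dots> = (\<Sum>f\<in>F. \<Sum>i<?n. \<Sum>j<?n. \<Sum>g\<in>F. (haar k i j * (c (x i) f * c (y j) g)) *\<^sub>R (f * g))"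
      by (rule sum.swap)
    also have "\<dots> = (\<Sum>f\<in>F. \<Sum>i<?n. \<Sum>g\<in>F. \<Sum>j<?n. (haar k i j * (c (x i) f * c (y j) g)) *\<^sub>R (f * g))"
      by (intro sum.cong refl sum.swap)
    also have "\<dots> = (\<Sum>f\<in>F. \<Sum>g\<in>F. \<Sum>i<?n. \<Sum>j<?n. (haar k i j * (c (x i) f * c (y j) g)) *\<^sub>R (f * g))"
      by (intro sum.cong refl sum.swap)
    also have "\<dots> = (\<Sum>f\<in>F. \<Sum>g\<in>F. ?S f g *\<^sub>R (f * g))" by (simp only: scaleR_sum_left)
    finally have eq: "(\<Sum>i<?n. \<Sum>j<?n. haar k i j *\<^sub>R (x i * y j)) = (\<Sum>f\<in>F. \<Sum>g\<in>F. ?S f g *\<^sub>R (f * g))" .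
    have "norm (\<Sum>i<?n. \<Sum>j<?n. haar k i j *\<^sub>R (x i * y j)) \<le> (\<Sum>f\<in>F. \<Sum>g\<in>F. 4 * (?K * (?X * ?Y)))"
      unfolding eq
    proof (intro sum_norm_le)
      fix f g assume fg: "f \<in> F" "g \<in> F"
      have "norm (?S f g *\<^sub>R (f * g)) \<le> (4 * (?K * (?X * ?Y))) * (1 * 1)"
        unfolding norm_scaleR norm_mult using fg
        by (intro mult_mono S F(2)) (auto intro!: mult_nonneg_nonneg)
      then show "norm (?S f g *\<^sub>R (f * g)) \<le> 4 * (?K * (?X * ?Y))" by simp
    qed
    also have "\<dots> = ?B * ?K * (?X * ?Y)"
    proof -
      have "(\<Sum>f\<in>F. \<Sum>g\<in>F. 4 * z) = 4 * (real (card F))\<^sup>2 * z" for z :: real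
        by (simp only: sum_constant power2_eq_square mult_ac)
      then show ?thesis unfolding mult.assoc .
    qed
    finally show "norm (\<Sum>i<?n. \<Sum>j<?n. haar k i j *\<^sub>R (x i * y j)) \<le> ?B * ?K * (?X * ?Y)" .
  qed simp
qed

section \<open>Interchanging iterated diagonal limits\<close>

text \<open>Rows and columns are chosen alternately, the k-th row just before the k-th column. For
  \<open>k \<le> l\<close> the column comes later, so the entry is near the limit along its row; for
  \<open>l < k\<close> the row comes later, and the entry is near the limit along its column. These
  limits are kept near the iterated ones.\<close>

lemma interlaced_selection:
  fixes u :: "nat \<Rightarrow> nat \<Rightarrow> 'k::{real_normed_vector, heine_borel}"
  assumes K: "\<And>m n. norm (u m n) \<le> K" and e: "0 < e"
  shows "\<exists>m n. inj_on m {..<r::nat} \<and> inj_on n {..<r} \<and>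
    (\<forall>k<r. \<forall>l<r. norm (u (m k) (n l) -
      (if k \<le> l then ulim (\<lambda>m. ulim (u m)) else ulim (\<lambda>n. ulim (\<lambda>m. u m n)))) \<le> e)"
proof -
  define \<rho> where "\<rho> m = ulim (u m)" for m
  define \<sigma> where "\<sigma> n = ulim (\<lambda>m. u m n)" for n
  have near: "eventually (\<lambda>n. norm (f n - ulim f) < e / 2) ultra" if "\<And>n. norm (f n) \<le> K" for f :: "nat \<Rightarrow> 'k"
    using tendstoD[OF tendsto_ulim[OF that], of "e / 2"] e by (simp add: dist_norm)
  have \<rho>: "norm (\<rho> m) \<le> K" and \<sigma>: "norm (\<sigma> n) \<le> K" for m n
    unfolding \<rho>_def \<sigma>_def by (intro norm_ulim_le K)+
  have "\<exists>m n. inj_on m {..<r} \<and> inj_on n {..<r} \<and>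
    (\<forall>k<r. norm (\<rho> (m k) - ulim \<rho>) < e / 2 \<and> norm (\<sigma> (n k) - ulim \<sigma>) < e / 2) \<and>
    (\<forall>k<r. \<forall>l<r. (k \<le> l \<longrightarrow> norm (u (m k) (n l) - \<rho> (m k)) < e / 2) \<and> (l < k \<longrightarrow> norm (u (m k) (n l) - \<sigma> (n l)) < e / 2))" for r :: nat
  proof (induction r)
    case (Suc r)
    then obtain m n where inj: "inj_on m {..<r}" "inj_on n {..<r}"
      and lim: "\<And>k. k < r \<Longrightarrow> norm (\<rho> (m k) - ulim \<rho>) < e / 2" "\<And>k. k < r \<Longrightarrow> norm (\<sigma> (n k) - ulim \<sigma>) < e / 2"
      and ent: "\<And>k l. k < r \<Longrightarrow> l < r \<Longrightarrow> k \<le> l \<Longrightarrow> norm (u (m k) (n l) - \<rho> (m k)) < e / 2"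
        "\<And>k l. k < r \<Longrightarrow> l < r \<Longrightarrow> l < k \<Longrightarrow> norm (u (m k) (n l) - \<sigma> (n l)) < e / 2" by blast
    have "eventually (\<lambda>a. a \<notin> m ` {..<r} \<and> norm (\<rho> a - ulim \<rho>) < e / 2 \<and> (\<forall>l\<in>{..<r}. norm (u a (n l) - \<sigma> (n l)) < e / 2)) ultra"
      unfolding \<sigma>_def using K by (intro eventually_conj eventually_ultra_neq near \<rho> eventually_ball_finite ballI) auto
    then obtain a where a: "a \<notin> m ` {..<r}" "norm (\<rho> a - ulim \<rho>) < e / 2" "\<And>l. l < r \<Longrightarrow> norm (u a (n l) - \<sigma> (n l)) < e / 2"
      using eventually_happens'[OF ultra(1)] by fastforce
    \<comment> \<open>The new column has to suit the new row \<open>a\<close> as well, which puts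
      the diagonal case on the side of the row limits.\<close>
    have "eventually (\<lambda>b. b \<notin> n ` {..<r} \<and> norm (\<sigma> b - ulim \<sigma>) < e / 2 \<and>
        (\<forall>k\<in>{..<r}. norm (u (m k) b - \<rho> (m k)) < e / 2) \<and> norm (u a b - \<rho> a) < e / 2) ultra"
      unfolding \<rho>_def using K by (intro eventually_conj eventually_ultra_neq near \<sigma> eventually_ball_finite ballI) auto
    then obtain b where b: "b \<notin> n ` {..<r}" "norm (\<sigma> b - ulim \<sigma>) < e / 2"
      "\<And>k. k < r \<Longrightarrow> norm (u (m k) b - \<rho> (m k)) < e / 2" "norm (u a b - \<rho> a) < e / 2"
      using eventually_happens'[OF ultra(1)] by fastforce
    let ?m = "m(r := a)" and ?n = "n(r := b)"
    have "inj_on ?m {..<Suc r}" "inj_on ?n {..<Suc r}"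
      using inj a(1) b(1) by (auto simp: inj_on_def lessThan_Suc)
    moreover have "norm (\<rho> (?m k) - ulim \<rho>) < e / 2 \<and> norm (\<sigma> (?n k) - ulim \<sigma>) < e / 2" if "k < Suc r" for k
      using that lim a b by (auto simp: less_Suc_eq)
    moreover have "(k \<le> l \<longrightarrow> norm (u (?m k) (?n l) - \<rho> (?m k)) < e / 2) \<and> (l < k \<longrightarrow> norm (u (?m k) (?n l) - \<sigma> (?n l)) < e / 2)"
      if "k < Suc r" "l < Suc r" for k l
      using that ent a b by (auto simp: less_Suc_eq)
    ultimately show ?case by blast
  qed auto
  from this[of r] obtain m n where inj: "inj_on m {..<r}" "inj_on n {..<r}"
    and lim: "\<forall>k<r. norm (\<rho> (m k) - ulim \<rho>) < e / 2 \<and> norm (\<sigma> (n k) - ulim \<sigma>) < e / 2"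
    and ent: "\<forall>k<r. \<forall>l<r. (k \<le> l \<longrightarrow> norm (u (m k) (n l) - \<rho> (m k)) < e / 2) \<and> (l < k \<longrightarrow> norm (u (m k) (n l) - \<sigma> (n l)) < e / 2)"
    by (elim exE conjE)
  have "norm (u (m k) (n l) - (if k \<le> l then ulim \<rho> else ulim \<sigma>)) \<le> e" if "k < r" "l < r" for k l
  proof (cases "k \<le> l")
    case True
    have "norm (u (m k) (n l) - ulim \<rho>) \<le> norm (u (m k) (n l) - \<rho> (m k)) + norm (\<rho> (m k) - ulim \<rho>)"
      using norm_triangle_ineq[of "u (m k) (n l) - \<rho> (m k)" "\<rho> (m k) - ulim \<rho>"] by simp
    then show ?thesis using lim[rule_format, OF that(1)] ent[rule_format, OF that] True by fastforce
  next
    case False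
    have "norm (u (m k) (n l) - ulim \<sigma>) \<le> norm (u (m k) (n l) - \<sigma> (n l)) + norm (\<sigma> (n l) - ulim \<sigma>)"
      using norm_triangle_ineq[of "u (m k) (n l) - \<sigma> (n l)" "\<sigma> (n l) - ulim \<sigma>"] by simp
    then show ?thesis using lim[rule_format, OF that(2)] ent[rule_format, OF that] False by fastforce
  qed
  with inj show ?thesis unfolding \<rho>_def[abs_def] \<sigma>_def[abs_def] by blast
qed

text \<open>Boundedness of the Schur multiplier \<open>u\<close>, tested only on all-ones vectors, but along arbitrary
  rearrangements of finitely many rows and columns; this form passes to pointwise limits.\<close>

definition multiplier :: "real \<Rightarrow> real \<Rightarrow> real \<Rightarrow> (nat \<Rightarrow> nat \<Rightarrow> 'k::real_normed_field) \<Rightarrow> bool" where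
  "multiplier K p q u \<longleftrightarrow> (\<forall>(r::nat) m n M C. inj_on m {..<r} \<longrightarrow> inj_on n {..<r} \<longrightarrow> 0 \<le> C \<longrightarrow>
    (\<forall>x y :: nat \<Rightarrow> 'k. norm (\<Sum>k<r. \<Sum>l<r. M k l *\<^sub>R (x k * y l)) \<le>
      C * ((\<Sum>k<r. norm (x k) powr p) powr (1 / p) * (\<Sum>l<r. norm (y l) powr q) powr (1 / q))) \<longrightarrow>
    norm (\<Sum>k<r. \<Sum>l<r. M k l *\<^sub>R u (m k) (n l)) \<le> K * (C * (real r powr (1 / p) * real r powr (1 / q))))"

lemma multiplier_flip:
  assumes "multiplier K p q u" shows "multiplier K q p (\<lambda>n m. u m n)"
  unfolding multiplier_def
proof (intro allI impI)
  fix r :: nat and m n :: "nat \<Rightarrow> nat" and M :: "nat \<Rightarrow> nat \<Rightarrow> real" and C :: real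
  assume inj: "inj_on m {..<r}" "inj_on n {..<r}" and C: "0 \<le> C"
    and M: "\<forall>x y :: nat \<Rightarrow> 'a. norm (\<Sum>k<r. \<Sum>l<r. M k l *\<^sub>R (x k * y l)) \<le>
      C * ((\<Sum>k<r. norm (x k) powr q) powr (1 / q) * (\<Sum>l<r. norm (y l) powr p) powr (1 / p))"
  have "norm (\<Sum>k<r. \<Sum>l<r. M l k *\<^sub>R u (n k) (m l)) \<le> K * (C * (real r powr (1 / p) * real r powr (1 / q)))"
  proof (rule assms[unfolded multiplier_def, rule_format, OF inj(2,1) C])
    fix x y :: "nat \<Rightarrow> 'a"
    show "norm (\<Sum>k<r. \<Sum>l<r. M l k *\<^sub>R (x k * y l)) \<le>
      C * ((\<Sum>k<r. norm (x k) powr p) powr (1 / p) * (\<Sum>l<r. norm (y l) powr q) powr (1 / q))"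
      using M[rule_format, of y x] by (subst sum.swap) (simp add: mult.commute)
  qed
  then show "norm (\<Sum>k<r. \<Sum>l<r. M k l *\<^sub>R u (n l) (m k)) \<le> K * (C * (real r powr (1 / q) * real r powr (1 / p)))"
    by (subst sum.swap) (simp add: mult.commute)
qed

text \<open>If the iterated limits differed, compressing the multiplier would give the main triangle
  projection, which is not bounded on \<open>\<ell>\<^sub>p \<otimes> \<ell>\<^sub>q\<close> when \<open>1/p + 1/q \<le> 1\<close>: it inflates the pairing with
  the matrices \<open>haar k\<close> by a power of \<open>k\<close>.\<close>

lemma ulim_swap_aux:
  fixes u :: "nat \<Rightarrow> nat \<Rightarrow> 'k::{real_normed_field, heine_borel}"
  assumes p: "2 \<le> p" "1 < q" "1 / p + 1 / q \<le> 1" and K: "0 \<le> K" "\<And>m n. norm (u m n) \<le> K" and mult: "multiplier K p q u"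
  shows "ulim (\<lambda>m. ulim (u m)) = ulim (\<lambda>n. ulim (\<lambda>m. u m n))" (is "?\<mu> = ?\<nu>")
proof -
  obtain B where B: "0 \<le> B" and haar: "\<And>k (x :: nat \<Rightarrow> 'k) y. norm (\<Sum>i<2 ^ k. \<Sum>j<2 ^ k. haar k i j *\<^sub>R (x i * y j)) \<le>
    B * (real k powr (1 - 1 / p) * (2 ^ k) powr (1 - 1 / p - 1 / q)) *
    ((\<Sum>i<2 ^ k. norm (x i) powr p) powr (1 / p) * (\<Sum>j<2 ^ k. norm (y j) powr q) powr (1 / q))"
    using haar_form[where 'k = 'k] p by blast
  have main: "norm (?\<mu> - ?\<nu>) * (real k * 2 ^ k / 4) \<le> K * B * real k powr (1 - 1 / p) * 2 ^ k" for k
  proof (rule field_le_epsilon)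
    fix \<epsilon> :: real assume \<epsilon>: "0 < \<epsilon>"
    let ?n = "2 ^ k :: nat"
    define W where "W = (\<Sum>i<?n. \<Sum>j<?n. \<bar>haar k i j\<bar>)"
    have W: "0 \<le> W" unfolding W_def by (intro sum_nonneg) auto
    \<comment> \<open>Small against the absolute sum of the entries of \<open>haar k\<close>, so
      that replacing entries by their limits costs at most \<epsilon>.\<close>
    define e where "e = \<epsilon> / (W + 1)"
    have e: "0 < e" "W * e \<le> \<epsilon>" using \<epsilon> W by (auto simp: e_def field_simps)
    obtain m n where mn: "inj_on m {..<?n}" "inj_on n {..<?n}"
      and close: "\<And>i j. i < ?n \<Longrightarrow> j < ?n \<Longrightarrow> norm (u (m i) (n j) - (if i \<le> j then ?\<mu> else ?\<nu>)) \<le> e"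
      using interlaced_selection[where u = u and r = ?n, OF K(2) e(1)] by blast
    let ?C = "B * (real k powr (1 - 1 / p) * (2 ^ k) powr (1 - 1 / p - 1 / q))"
    let ?S = "\<Sum>i<?n. \<Sum>j<?n. haar k i j *\<^sub>R u (m i) (n j)"
    have "norm ?S \<le> K * (?C * (real ?n powr (1 / p) * real ?n powr (1 / q)))"
      by (rule mult[unfolded multiplier_def, rule_format, OF mn]) (use B haar in auto)
    also have "\<dots> = K * B * real k powr (1 - 1 / p) * 2 ^ k"
    proof -
      have "(2 ^ k) powr (1 - 1 / p - 1 / q) * (real ?n powr (1 / p) * real ?n powr (1 / q)) = (2 :: real) ^ k"
        by (simp flip: powr_add)
      then show ?thesis by (simp add: mult_ac)
    qed
    finally have S: "norm ?S \<le> K * B * real k powr (1 - 1 / p) * 2 ^ k" .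
    \<comment> \<open>The diagonal belongs to the triangle here, but its sum is 0.\<close>
    have tri: "(\<Sum>i<?n. \<Sum>j<?n. if i \<le> j then haar k i j else 0) = real k * 2 ^ k / 4"
    proof -
      have "(\<Sum>j<?n. if i \<le> j then haar k i j else 0) = (\<Sum>j<?n. if i < j then haar k i j else 0) + haar k i i"
        if i: "i < ?n" for i
      proof -
        have "(\<Sum>j<?n. if i \<le> j then haar k i j else 0) = (\<Sum>j<?n. (if i < j then haar k i j else 0) + (if i = j then haar k i i else 0))"
          by (intro sum.cong) auto
        then show ?thesis using i by (simp add: sum.distrib)
      qed
      then have "(\<Sum>i<?n. \<Sum>j<?n. if i \<le> j then haar k i j else 0) =
          (\<Sum>i<?n. (\<Sum>j<?n. if i < j then haar k i j else 0) + haar k i i)" by (intro sum.cong) auto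
      then show ?thesis using haar_upper[of k] haar_diag[of k] by (simp add: sum.distrib)
    qed
    \<comment> \<open>The two-valued matrix is the constant \<open>?\<nu>\<close> plus the triangle
      times the difference; the constant part is annihilated by \<open>haar_total\<close>.\<close>
    have "(\<Sum>i<?n. \<Sum>j<?n. haar k i j *\<^sub>R (if i \<le> j then ?\<mu> else ?\<nu>)) =
        (\<Sum>i<?n. \<Sum>j<?n. haar k i j *\<^sub>R ?\<nu> + (if i \<le> j then haar k i j else 0) *\<^sub>R (?\<mu> - ?\<nu>))"
      by (intro sum.cong refl) (auto simp: scaleR_right_diff_distrib)
    also have "\<dots> = (\<Sum>i<?n. \<Sum>j<?n. haar k i j) *\<^sub>R ?\<nu> + (\<Sum>i<?n. \<Sum>j<?n. if i \<le> j then haar k i j else 0) *\<^sub>R (?\<mu> - ?\<nu>)"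
      by (simp only: sum.distrib scaleR_sum_left)
    finally have v: "(\<Sum>i<?n. \<Sum>j<?n. haar k i j *\<^sub>R (if i \<le> j then ?\<mu> else ?\<nu>)) = (real k * 2 ^ k / 4) *\<^sub>R (?\<mu> - ?\<nu>)"
      unfolding haar_total tri by simp
    have "norm (?S - (\<Sum>i<?n. \<Sum>j<?n. haar k i j *\<^sub>R (if i \<le> j then ?\<mu> else ?\<nu>))) =
        norm (\<Sum>i<?n. \<Sum>j<?n. haar k i j *\<^sub>R (u (m i) (n j) - (if i \<le> j then ?\<mu> else ?\<nu>)))"
      by (simp only: sum_subtractf scaleR_right_diff_distrib)
    also have "\<dots> \<le> (\<Sum>i<?n. \<Sum>j<?n. \<bar>haar k i j\<bar> * e)"
    proof (intro sum_norm_le)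
      fix i j assume "i \<in> {..<?n}" "j \<in> {..<?n}"
      then show "norm (haar k i j *\<^sub>R (u (m i) (n j) - (if i \<le> j then ?\<mu> else ?\<nu>))) \<le> \<bar>haar k i j\<bar> * e"
        unfolding norm_scaleR by (intro mult_left_mono close) auto
    qed
    also have "\<dots> = W * e" by (simp add: W_def sum_distrib_right)
    finally have "norm (?S - (real k * 2 ^ k / 4) *\<^sub>R (?\<mu> - ?\<nu>)) \<le> \<epsilon>" unfolding v using e by simp
    then have "norm ((real k * 2 ^ k / 4) *\<^sub>R (?\<mu> - ?\<nu>)) \<le> norm ?S + \<epsilon>"
      using norm_triangle_ineq2[of "(real k * 2 ^ k / 4) *\<^sub>R (?\<mu> - ?\<nu>)" ?S] by (simp add: norm_minus_commute)
    then show "norm (?\<mu> - ?\<nu>) * (real k * 2 ^ k / 4) \<le> K * B * real k powr (1 - 1 / p) * 2 ^ k + \<epsilon>"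
      using S by (simp add: mult.commute)
  qed
  \<comment> \<open>Dividing by the triangle sum leaves a negative power of \<open>k\<close>, which
    tends to 0.\<close>
  have bound: "norm (?\<mu> - ?\<nu>) \<le> 4 * K * B * real k powr (- 1 / p)" if "1 \<le> k" for k
  proof -
    have "real k powr (1 - 1 / p) = real k * real k powr (- 1 / p)" using that powr_add[of "real k" 1 "- 1 / p"] by simp
    then show ?thesis using main[of k] that by (simp add: field_simps)
  qed
  have "(\<lambda>k. 4 * K * B * real k powr (- 1 / p)) \<longlonglongrightarrow> 4 * K * B * 0"
    using p by (intro tendsto_intros tendsto_neg_powr filterlim_real_sequentially) auto
  then have "norm (?\<mu> - ?\<nu>) \<le> 0"
    using bound by (intro LIMSEQ_le_const) auto
  then show ?thesis by simp
qed

text \<open>One of the exponents is at least 2, as otherwise both reciprocals would exceed 1/2.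
  Exchanging rows and columns exchanges the exponents.\<close>

lemma ulim_swap:
  fixes u :: "nat \<Rightarrow> nat \<Rightarrow> 'k::{real_normed_field, heine_borel}"
  assumes p: "1 < p" "1 < q" "1 / p + 1 / q \<le> 1" and K: "0 \<le> K" "\<And>m n. norm (u m n) \<le> K" and mult: "multiplier K p q u"
  shows "ulim (\<lambda>m. ulim (\<lambda>n. u m n)) = ulim (\<lambda>n. ulim (\<lambda>m. u m n))"
proof (cases "2 \<le> p")
  case True
  then show ?thesis using ulim_swap_aux[OF True p(2,3) K mult] by simp
next
  case False
  have "2 \<le> q"
  proof (rule ccontr)
    assume "\<not> 2 \<le> q"
    then have "1 / 2 < 1 / q" "1 / 2 < 1 / p" using False p by (auto simp: field_simps)
    then show False using p(3) by linarith
  qed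
  then show ?thesis
    using ulim_swap_aux[OF _ p(1) _ K(1) _ multiplier_flip[OF mult]] p K(2) by (simp add: add.commute)
qed

section \<open>Diagonal limits of matrices\<close>

lemma phase_exists:
  fixes z :: "'k::real_normed_field"
  shows "\<exists>c. norm c = 1 \<and> c * z = of_real (norm z)"
  by (cases "z = 0") (auto intro: exI[of _ 1] exI[of _ "of_real (norm z) / z"] simp: norm_divide)

lemma sum_norm_le_of_phases:
  fixes g :: "nat \<Rightarrow> 'k::real_normed_field"
  assumes "\<And>c. (\<And>n. norm (c n) = 1) \<Longrightarrow> norm (\<Sum>n\<in>F. c n * g n) \<le> B"
  shows "(\<Sum>n\<in>F. norm (g n)) \<le> B"
proof -
  obtain c where c: "\<And>n. norm (c n) = 1" "\<And>n. c n * g n = of_real (norm (g n))"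
    using phase_exists[of "g _"] by metis
  have "(\<Sum>n\<in>F. c n * g n) = of_real (\<Sum>n\<in>F. norm (g n))" using c(2) by simp
  then have "norm (\<Sum>n\<in>F. c n * g n) = (\<Sum>n\<in>F. norm (g n))"
    by (simp only: norm_of_real) (simp add: abs_of_nonneg sum_nonneg)
  then show ?thesis using assms[of c, OF c(1)] by simp
qed

text \<open>If infinitely many terms had norm at least e, then m of them would sum to at least m
  times e, more than \<open>K * m powr t\<close> for large m. So only finitely many are that
  large.\<close>

lemma ultra_null:
  fixes g :: "nat \<Rightarrow> 'a::real_normed_vector"
  assumes t: "t < 1" and bd: "\<And>F. finite F \<Longrightarrow> (\<Sum>n\<in>F. norm (g n)) \<le> K * real (card F) powr t"
  shows "(g \<longlongrightarrow> 0) ultra"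
proof (rule tendstoI)
  fix e :: real assume e: "0 < e"
  have "finite {n. e \<le> norm (g n)}"
  proof (rule ccontr)
    assume inf: "infinite {n. e \<le> norm (g n)}"
    have le: "real m powr (1 - t) \<le> K / e" if m: "1 \<le> m" for m
    proof -
      obtain F where F: "finite F" "card F = m" "F \<subseteq> {n. e \<le> norm (g n)}"
        using infinite_arbitrarily_large[OF inf] by metis
      have "real m * e = (\<Sum>n\<in>F. e)" using F by simp
      also have "\<dots> \<le> (\<Sum>n\<in>F. norm (g n))" using F by (intro sum_mono) auto
      also have "\<dots> \<le> K * real m powr t" using bd[OF F(1)] F(2) by simp
      finally have "real m * e \<le> K * real m powr t" .
      moreover have "real m powr (1 - t) * real m powr t = real m" using m by (simp flip: powr_add)
      ultimately have "(real m powr (1 - t) * e) * real m powr t \<le> K * real m powr t" by (simp only: mult_ac)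
      then have "real m powr (1 - t) * e \<le> K" by (rule mult_right_le_imp_le) (use m in simp)
      then show ?thesis using e by (simp only: pos_le_divide_eq)
    qed
    have "filterlim (\<lambda>m. real m powr (1 - t)) at_top sequentially"
      using t by (intro filterlim_compose[OF real_powr_at_top filterlim_real_sequentially]) auto
    then have "eventually (\<lambda>m. K / e < real m powr (1 - t)) sequentially" by (simp add: filterlim_at_top_dense)
    then have "eventually (\<lambda>m. False) sequentially" using eventually_ge_at_top[of 1]
      by eventually_elim (use le in force)
    then show False by simp
  qed
  from eventually_ultra_neq[OF this] show "eventually (\<lambda>n. dist (g n) 0 < e) ultra"
    by (rule eventually_mono) auto
qed

context
  fixes I :: "'i::linorder set" and p :: "'i \<Rightarrow> real" and K :: real
begin

text \<open>Matrices are indexed by total functions although only the coordinates in \<open>S\<close> matter. The properties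
  collected here hold for the entries of bounded operators and survive diagonal limits.\<close>

definition good :: "'i set \<Rightarrow> (('i \<Rightarrow> nat) \<Rightarrow> ('i \<Rightarrow> nat) \<Rightarrow> 'k::{real_normed_field, heine_borel}) \<Rightarrow> bool" where
  "good S f \<longleftrightarrow> (\<forall>\<alpha> \<beta>. norm (f \<alpha> \<beta>) \<le> K) \<and>
    (\<forall>\<alpha> \<alpha>' \<beta> \<beta>'. (\<forall>i\<in>S. \<alpha> i = \<alpha>' i \<and> \<beta> i = \<beta>' i) \<longrightarrow> f \<alpha> \<beta> = f \<alpha>' \<beta>') \<and>
    (\<forall>i\<in>S. \<forall>\<alpha> \<beta> F. finite F \<longrightarrow> (\<Sum>n\<in>F. norm (f (\<alpha>(i := n)) \<beta>)) \<le> K * real (card F) powr (1 / p i)) \<and>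
    (\<forall>i\<in>S. \<forall>\<alpha> \<beta> F. finite F \<longrightarrow> (\<Sum>n\<in>F. norm (f \<alpha> (\<beta>(i := n)))) \<le> K * real (card F) powr (1 - 1 / p i)) \<and>
    (\<forall>i\<in>S. \<forall>j\<in>S. \<forall>\<alpha> \<beta>. i \<noteq> j \<longrightarrow> multiplier K (p i) (p j) (\<lambda>m n. f (\<alpha>(i := m, j := n)) (\<beta>(i := m, j := n))))"

definition diag_lim :: "'i \<Rightarrow> (('i \<Rightarrow> nat) \<Rightarrow> ('i \<Rightarrow> nat) \<Rightarrow> 'k::{real_normed_field, heine_borel}) \<Rightarrow>
    ('i \<Rightarrow> nat) \<Rightarrow> ('i \<Rightarrow> nat) \<Rightarrow> 'k" where
  "diag_lim i f \<alpha> \<beta> = ulim (\<lambda>n. f (\<alpha>(i := n)) (\<beta>(i := n)))"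

lemma goodD:
  assumes "good S f"
  shows "norm (f \<alpha> \<beta>) \<le> K" "(\<And>i. i \<in> S \<Longrightarrow> \<alpha> i = \<alpha>' i \<and> \<beta> i = \<beta>' i) \<Longrightarrow> f \<alpha> \<beta> = f \<alpha>' \<beta>'"
    "i \<in> S \<Longrightarrow> finite F \<Longrightarrow> (\<Sum>n\<in>F. norm (f (\<alpha>(i := n)) \<beta>)) \<le> K * real (card F) powr (1 / p i)"
    "i \<in> S \<Longrightarrow> finite F \<Longrightarrow> (\<Sum>n\<in>F. norm (f \<alpha> (\<beta>(i := n)))) \<le> K * real (card F) powr (1 - 1 / p i)"
    "i \<in> S \<Longrightarrow> j \<in> S \<Longrightarrow> i \<noteq> j \<Longrightarrow> multiplier K (p i) (p j) (\<lambda>m n. f (\<alpha>(i := m, j := n)) (\<beta>(i := m, j := n)))"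
proof -
  note g = assms[unfolded good_def]
  show "norm (f \<alpha> \<beta>) \<le> K" by (rule g[THEN conjunct1, rule_format])
  show "f \<alpha> \<beta> = f \<alpha>' \<beta>'" if "\<And>i. i \<in> S \<Longrightarrow> \<alpha> i = \<alpha>' i \<and> \<beta> i = \<beta>' i"
    using that by (rule g[THEN conjunct2, THEN conjunct1, rule_format])
  show "i \<in> S \<Longrightarrow> finite F \<Longrightarrow> (\<Sum>n\<in>F. norm (f (\<alpha>(i := n)) \<beta>)) \<le> K * real (card F) powr (1 / p i)"
    by (rule g[THEN conjunct2, THEN conjunct2, THEN conjunct1, rule_format])
  show "i \<in> S \<Longrightarrow> finite F \<Longrightarrow> (\<Sum>n\<in>F. norm (f \<alpha> (\<beta>(i := n)))) \<le> K * real (card F) powr (1 - 1 / p i)"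
    by (rule g[THEN conjunct2, THEN conjunct2, THEN conjunct2, THEN conjunct1, rule_format])
  show "i \<in> S \<Longrightarrow> j \<in> S \<Longrightarrow> i \<noteq> j \<Longrightarrow> multiplier K (p i) (p j) (\<lambda>m n. f (\<alpha>(i := m, j := n)) (\<beta>(i := m, j := n)))"
    by (rule g[THEN conjunct2, THEN conjunct2, THEN conjunct2, THEN conjunct2, rule_format])
qed

lemma diag_lim_tendsto:
  assumes "good S f" shows "((\<lambda>n. f (\<alpha>(i := n)) (\<beta>(i := n))) \<longlongrightarrow> diag_lim i f \<alpha> \<beta>) ultra"
  unfolding diag_lim_def by (rule tendsto_ulim[OF goodD(1)[OF assms]])

text \<open>Every clause of \<open>good\<close> is a closed condition on finitely many entries at a
  time, or an independence of coordinates, and so survives pointwise limits.\<close>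

lemma good_diag_lim:
  assumes f: "good S f"
  shows "good (S - {i}) (diag_lim i f)"
  unfolding good_def
proof (intro conjI allI impI ballI)
  note lim = diag_lim_tendsto[OF f, of _ i]
  show "norm (diag_lim i f \<alpha> \<beta>) \<le> K" for \<alpha> \<beta>
    unfolding diag_lim_def by (rule norm_ulim_le[OF goodD(1)[OF f]])
  show "diag_lim i f \<alpha> \<beta> = diag_lim i f \<alpha>' \<beta>'" if "\<forall>h\<in>S - {i}. \<alpha> h = \<alpha>' h \<and> \<beta> h = \<beta>' h" for \<alpha> \<alpha>' \<beta> \<beta>'
  proof -
    have "f (\<alpha>(i := n)) (\<beta>(i := n)) = f (\<alpha>'(i := n)) (\<beta>'(i := n))" for n
      by (rule goodD(2)[OF f]) (use that in auto)
    then show ?thesis by (simp add: diag_lim_def)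
  qed
  show "(\<Sum>m\<in>F. norm (diag_lim i f (\<alpha>(h := m)) \<beta>)) \<le> K * real (card F) powr (1 / p h)"
    if h: "h \<in> S - {i}" and F: "finite F" for h \<alpha> \<beta> F
  proof (rule tendsto_upperbound[OF _ _ ultra(1)])
    show "((\<lambda>n. \<Sum>m\<in>F. norm (f (\<alpha>(h := m, i := n)) (\<beta>(i := n)))) \<longlongrightarrow> (\<Sum>m\<in>F. norm (diag_lim i f (\<alpha>(h := m)) \<beta>))) ultra"
      by (intro tendsto_sum tendsto_norm lim)
    have "\<alpha>(h := m, i := n) = \<alpha>(i := n, h := m)" for m n using h by (auto simp: fun_upd_twist)
    then show "\<forall>\<^sub>F n in ultra. (\<Sum>m\<in>F. norm (f (\<alpha>(h := m, i := n)) (\<beta>(i := n)))) \<le> K * real (card F) powr (1 / p h)"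
      using goodD(3)[OF f _ F] h by (intro always_eventually allI) simp
  qed
  show "(\<Sum>m\<in>F. norm (diag_lim i f \<alpha> (\<beta>(h := m)))) \<le> K * real (card F) powr (1 - 1 / p h)"
    if h: "h \<in> S - {i}" and F: "finite F" for h \<alpha> \<beta> F
  proof (rule tendsto_upperbound[OF _ _ ultra(1)])
    show "((\<lambda>n. \<Sum>m\<in>F. norm (f (\<alpha>(i := n)) (\<beta>(h := m, i := n)))) \<longlongrightarrow> (\<Sum>m\<in>F. norm (diag_lim i f \<alpha> (\<beta>(h := m))))) ultra"
      by (intro tendsto_sum tendsto_norm lim)
    have "\<beta>(h := m, i := n) = \<beta>(i := n, h := m)" for m n using h by (auto simp: fun_upd_twist)
    then show "\<forall>\<^sub>F n in ultra. (\<Sum>m\<in>F. norm (f (\<alpha>(i := n)) (\<beta>(h := m, i := n)))) \<le> K * real (card F) powr (1 - 1 / p h)"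
      using goodD(4)[OF f _ F] h by (intro always_eventually allI) simp
  qed
  show "multiplier K (p g) (p h) (\<lambda>m n. diag_lim i f (\<alpha>(g := m, h := n)) (\<beta>(g := m, h := n)))"
    if gh: "g \<in> S - {i}" "h \<in> S - {i}" "g \<noteq> h" for g h \<alpha> \<beta>
    unfolding multiplier_def
  proof (intro allI impI)
    fix r :: nat and m n :: "nat \<Rightarrow> nat" and M :: "nat \<Rightarrow> nat \<Rightarrow> real" and C :: real
    assume inj: "inj_on m {..<r}" "inj_on n {..<r}" and C: "0 \<le> C"
      and M: "\<forall>x y :: nat \<Rightarrow> 'a. norm (\<Sum>k<r. \<Sum>l<r. M k l *\<^sub>R (x k * y l)) \<le>
        C * ((\<Sum>k<r. norm (x k) powr p g) powr (1 / p g) * (\<Sum>l<r. norm (y l) powr p h) powr (1 / p h))"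
    let ?u = "\<lambda>\<nu> k l. f (\<alpha>(g := m k, h := n l, i := \<nu>)) (\<beta>(g := m k, h := n l, i := \<nu>))"
    show "norm (\<Sum>k<r. \<Sum>l<r. M k l *\<^sub>R diag_lim i f (\<alpha>(g := m k, h := n l)) (\<beta>(g := m k, h := n l)))
      \<le> K * (C * (real r powr (1 / p g) * real r powr (1 / p h)))"
    proof (rule tendsto_upperbound[OF _ _ ultra(1)])
      show "((\<lambda>\<nu>. norm (\<Sum>k<r. \<Sum>l<r. M k l *\<^sub>R ?u \<nu> k l)) \<longlongrightarrow>
        norm (\<Sum>k<r. \<Sum>l<r. M k l *\<^sub>R diag_lim i f (\<alpha>(g := m k, h := n l)) (\<beta>(g := m k, h := n l)))) ultra"
        by (intro tendsto_sum tendsto_norm tendsto_scaleR tendsto_const lim)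
      have tw: "\<gamma>(g := a, h := b, i := c) = \<gamma>(i := c, g := a, h := b)" for \<gamma> :: "'i \<Rightarrow> nat" and a b c
        using gh by (auto simp: fun_eq_iff)
      have "norm (\<Sum>k<r. \<Sum>l<r. M k l *\<^sub>R ?u \<nu> k l) \<le> K * (C * (real r powr (1 / p g) * real r powr (1 / p h)))" for \<nu>
        unfolding tw
        by (rule goodD(5)[OF f, of g h "\<alpha>(i := \<nu>)" "\<beta>(i := \<nu>)", unfolded multiplier_def, rule_format, OF _ _ gh(3) inj C])
          (use gh M in auto)
      then show "\<forall>\<^sub>F \<nu> in ultra. norm (\<Sum>k<r. \<Sum>l<r. M k l *\<^sub>R ?u \<nu> k l) \<le> K * (C * (real r powr (1 / p g) * real r powr (1 / p h)))"
        by (intro always_eventually allI)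
    qed
  qed
qed

lemma diag_lim_commute:
  assumes f: "good S f" and ij: "i \<in> S" "j \<in> S" and K: "0 \<le> K" and p: "\<And>i. i \<in> S \<Longrightarrow> 1 < p i"
    and dual: "\<And>i j. i \<in> S \<Longrightarrow> j \<in> S \<Longrightarrow> i \<noteq> j \<Longrightarrow> 1 / p i + 1 / p j \<le> 1"
  shows "diag_lim i (diag_lim j f) = diag_lim j (diag_lim i f)"
proof (cases "i = j")
  case False
  have tw: "\<gamma>(j := n, i := m) = \<gamma>(i := m, j := n)" for \<gamma> :: "'i \<Rightarrow> nat" and m n
    using False by (auto simp: fun_eq_iff)
  show ?thesis
  proof (intro ext)
    fix \<alpha> \<beta>
    show "diag_lim i (diag_lim j f) \<alpha> \<beta> = diag_lim j (diag_lim i f) \<alpha> \<beta>"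
      unfolding diag_lim_def tw
      by (rule ulim_swap[OF p[OF ij(1)] p[OF ij(2)] dual[OF ij False] K goodD(1)[OF f] goodD(5)[OF f ij False]])
  qed
qed simp

text \<open>\<open>L S\<close> takes diagonal limits in all coordinates outside \<open>S\<close>, in
  sorted order to make it depend on \<open>S\<close> alone. Removing a further coordinate inserts it
  into the sorted list, and \<open>diag_lim_commute\<close> moves the new limit past the smaller
  coordinates.\<close>

lemma limit_family:
  assumes f: "good I f" and fin: "finite I" and K: "0 \<le> K" and p: "\<And>i. i \<in> I \<Longrightarrow> 1 < p i"
    and dual: "\<And>i j. i \<in> I \<Longrightarrow> j \<in> I \<Longrightarrow> i \<noteq> j \<Longrightarrow> 1 / p i + 1 / p j \<le> 1"
  shows "\<exists>L. L I = f \<and> (\<forall>S\<subseteq>I. good S (L S)) \<and> (\<forall>S\<subseteq>I. \<forall>i\<in>S. L (S - {i}) = diag_lim i (L S))"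
proof -
  have good: "good (I - set xs) (foldr diag_lim xs f)" for xs
  proof (induction xs)
    case (Cons x xs)
    have "I - set (x # xs) = I - set xs - {x}" by auto
    then show ?case using good_diag_lim[OF Cons] by simp
  qed (use f in simp)
  have ins: "foldr diag_lim (insort i xs) f = diag_lim i (foldr diag_lim xs f)"
    if "distinct xs" "set xs \<subseteq> I" "i \<in> I - set xs" for i xs
    using that
  proof (induction xs)
    case (Cons x xs)
    show ?case
    proof (cases "i \<le> x")
      case False
      then have "foldr diag_lim (insort i (x # xs)) f = diag_lim x (diag_lim i (foldr diag_lim xs f))"
        using Cons by simp
      also have "\<dots> = diag_lim i (diag_lim x (foldr diag_lim xs f))"
        by (rule diag_lim_commute[OF good _ _ K]) (use Cons.prems p dual in auto)
      finally show ?thesis by simp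
    qed simp
  qed simp
  let ?L = "\<lambda>S. foldr diag_lim (sorted_list_of_set (I - S)) f"
  have "?L (S - {i}) = diag_lim i (?L S)" if S: "S \<subseteq> I" and i: "i \<in> S" for S i
  proof -
    have "I - (S - {i}) = insert i (I - S)" using S i by auto
    then have "sorted_list_of_set (I - (S - {i})) = insort i (sorted_list_of_set (I - S))"
      using i fin by simp
    then show ?thesis using ins[of "sorted_list_of_set (I - S)" i] S i fin by auto
  qed
  moreover have "good S (?L S)" if S: "S \<subseteq> I" for S
  proof -
    have "I - set (sorted_list_of_set (I - S)) = S" using S fin by auto
    then show ?thesis using good[of "sorted_list_of_set (I - S)"] by simp
  qed
  ultimately show ?thesis by (intro exI[of _ ?L]) simp
qed

end

section \<open>Compression to rapidly vanishing off-diagonal parts\<close>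

lemma moebius_inversion:
  fixes h :: "'a set \<Rightarrow> 'b::comm_ring_1"
  assumes "finite I"
  shows "(\<Sum>S\<in>Pow I. (-1) ^ card S * (\<Sum>R\<in>Pow S. (-1) ^ card R * h R)) = h I"
  by (rule inclusion_exclusion_symmetric[symmetric, where g = "\<lambda>S. \<Sum>R\<in>Pow S. (-1) ^ card R * h R"]) (use assms in auto)

lemma sum_Pow_insert:
  assumes "finite S" "i \<notin> S"
  shows "(\<Sum>R\<in>Pow (insert i S). g R) = (\<Sum>R\<in>Pow S. g R + g (insert i R))"
proof -
  have "inj_on (insert i) (Pow S)" using assms(2) by (auto simp: inj_on_def)
  then have "(\<Sum>R\<in>insert i ` Pow S. g R) = (\<Sum>R\<in>Pow S. g (insert i R))" by (simp add: sum.reindex)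
  moreover have "Pow S \<inter> insert i ` Pow S = {}" using assms(2) by auto
  ultimately show ?thesis unfolding Pow_insert using assms(1) by (subst sum.union_disjoint) (auto simp: sum.distrib)
qed

lemma sum_PiE_insert:
  assumes "i \<notin> S"
  shows "(\<Sum>a\<in>Pi\<^sub>E (insert i S) G. \<phi> a) = (\<Sum>y\<in>G i. \<Sum>g\<in>Pi\<^sub>E S G. \<phi> (g(i := y)))"
  unfolding PiE_insert_eq using assms
  by (subst sum.reindex[OF inj_combinator]) (auto simp: o_def case_prod_unfold sum.cartesian_product)

locale diagonal_limits =
  fixes I :: "'i::linorder set" and p :: "'i \<Rightarrow> real" and K :: real
    and L :: "'i set \<Rightarrow> ('i \<Rightarrow> nat) \<Rightarrow> ('i \<Rightarrow> nat) \<Rightarrow> 'k::{real_normed_field, heine_borel}"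
  assumes finite_I: "finite I" and p_gt_1: "\<And>i. i \<in> I \<Longrightarrow> 1 < p i"
    and good_L: "\<And>S. S \<subseteq> I \<Longrightarrow> good p K S (L S)"
    and step_L: "\<And>S i. S \<subseteq> I \<Longrightarrow> i \<in> S \<Longrightarrow> L (S - {i}) = diag_lim i (L S)"
begin

text \<open>The matrix \<open>M\<^sub>S\<close> of the overview. Equality of the indices is demanded
  on \<open>S - R\<close> only, so that it depends on the coordinates in \<open>S\<close>
  alone.\<close>

definition moebius :: "'i set \<Rightarrow> ('i \<Rightarrow> nat) \<Rightarrow> ('i \<Rightarrow> nat) \<Rightarrow> 'k" where
  "moebius S \<alpha> \<beta> = (-1) ^ card S * (\<Sum>R\<in>Pow S. (-1) ^ card R * (if \<forall>i\<in>S - R. \<alpha> i = \<beta> i then L R \<alpha> \<beta> else 0))"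

text \<open>If the multi-indices agree outside \<open>S\<close>, then agreeing on
  \<open>S - R\<close> and on \<open>I - R\<close> is the same; if they do not, all the inner terms
  of the inversion formula vanish. Either way Moebius inversion applies.\<close>

lemma moebius_sum:
  "(\<Sum>S\<in>Pow I. if \<forall>i\<in>I - S. \<alpha> i = \<beta> i then moebius S \<alpha> \<beta> else 0) = L I \<alpha> \<beta>"
proof -
  let ?h = "\<lambda>R. if \<forall>i\<in>I - R. \<alpha> i = \<beta> i then L R \<alpha> \<beta> else 0"
  have "(if \<forall>i\<in>I - S. \<alpha> i = \<beta> i then moebius S \<alpha> \<beta> else 0) = (-1) ^ card S * (\<Sum>R\<in>Pow S. (-1) ^ card R * ?h R)"
    if S: "S \<in> Pow I" for S
  proof (cases "\<forall>i\<in>I - S. \<alpha> i = \<beta> i")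
    case True
    have "(\<forall>i\<in>S - R. \<alpha> i = \<beta> i) \<longleftrightarrow> (\<forall>i\<in>I - R. \<alpha> i = \<beta> i)" if "R \<in> Pow S" for R
      using True that S by blast
    then have "moebius S \<alpha> \<beta> = (-1) ^ card S * (\<Sum>R\<in>Pow S. (-1) ^ card R * ?h R)"
      unfolding moebius_def by (intro arg_cong2[where f = "(*)"] sum.cong refl) auto
    with True show ?thesis by simp
  next
    case False
    have "?h R = 0" if "R \<in> Pow S" for R using False that by auto
    then have "(\<Sum>R\<in>Pow S. (-1) ^ card R * ?h R) = 0" by (intro sum.neutral) simp
    then show ?thesis using False by (simp only: if_not_P if_False mult_zero_right)
  qed
  then have "(\<Sum>S\<in>Pow I. if \<forall>i\<in>I - S. \<alpha> i = \<beta> i then moebius S \<alpha> \<beta> else 0) =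
      (\<Sum>S\<in>Pow I. (-1) ^ card S * (\<Sum>R\<in>Pow S. (-1) ^ card R * ?h R))"
    by (intro sum.cong refl)
  also have "\<dots> = ?h I" by (rule moebius_inversion[OF finite_I])
  finally show ?thesis by simp
qed

lemma moebius_cong:
  assumes S: "S \<subseteq> I" and eq: "\<And>i. i \<in> S \<Longrightarrow> \<alpha> i = \<alpha>' i" "\<And>i. i \<in> S \<Longrightarrow> \<beta> i = \<beta>' i"
  shows "moebius S \<alpha> \<beta> = moebius S \<alpha>' \<beta>'"
  unfolding moebius_def
proof (intro arg_cong2[where f = "(*)"] sum.cong refl)
  fix R assume R: "R \<in> Pow S"
  have "L R \<alpha> \<beta> = L R \<alpha>' \<beta>'" by (rule goodD(2)[OF good_L]) (use R S eq in auto)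
  moreover have "(\<forall>i\<in>S - R. \<alpha> i = \<beta> i) \<longleftrightarrow> (\<forall>i\<in>S - R. \<alpha>' i = \<beta>' i)" using eq by auto
  ultimately show "(if \<forall>i\<in>S - R. \<alpha> i = \<beta> i then L R \<alpha> \<beta> else 0) = (if \<forall>i\<in>S - R. \<alpha>' i = \<beta>' i then L R \<alpha>' \<beta>' else 0)"
    by simp
qed

text \<open>Pairing R with \<open>insert i R\<close> exhibits the differences that tend to zero in
  coordinate \<open>i\<close>.\<close>

lemma moebius_split:
  assumes S: "S \<subseteq> I" "i \<in> S"
  shows "moebius S \<alpha> \<beta> = (-1) ^ card S * (\<Sum>R\<in>Pow (S - {i}). (-1) ^ card R *
    ((if \<alpha> i = \<beta> i \<and> (\<forall>h\<in>S - {i} - R. \<alpha> h = \<beta> h) then L R \<alpha> \<beta> else 0) -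
     (if \<forall>h\<in>S - {i} - R. \<alpha> h = \<beta> h then L (insert i R) \<alpha> \<beta> else 0)))"
proof -
  let ?S = "S - {i}"
  have fS: "finite ?S" using S finite_I finite_subset by blast
  have SS: "insert i ?S = S" using S by auto
  let ?g = "\<lambda>R. (-1) ^ card R * (if \<forall>h\<in>S - R. \<alpha> h = \<beta> h then L R \<alpha> \<beta> else 0)"
  have "(\<Sum>R\<in>Pow S. ?g R) = (\<Sum>R\<in>Pow ?S. ?g R + ?g (insert i R))"
    using sum_Pow_insert[OF fS, of i ?g] SS by simp
  also have "\<dots> = (\<Sum>R\<in>Pow ?S. (-1) ^ card R *
    ((if \<alpha> i = \<beta> i \<and> (\<forall>h\<in>?S - R. \<alpha> h = \<beta> h) then L R \<alpha> \<beta> else 0) -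
     (if \<forall>h\<in>?S - R. \<alpha> h = \<beta> h then L (insert i R) \<alpha> \<beta> else 0)))"
  proof (rule sum.cong[OF refl])
    fix R assume R: "R \<in> Pow ?S"
    have "card (insert i R) = Suc (card R)" using R fS finite_subset by (subst card_insert_disjoint) auto
    moreover have "(\<forall>h\<in>S - R. \<alpha> h = \<beta> h) \<longleftrightarrow> \<alpha> i = \<beta> i \<and> (\<forall>h\<in>?S - R. \<alpha> h = \<beta> h)" using R S by auto
    moreover have "S - insert i R = ?S - R" by auto
    ultimately show "?g R + ?g (insert i R) = (-1) ^ card R *
      ((if \<alpha> i = \<beta> i \<and> (\<forall>h\<in>?S - R. \<alpha> h = \<beta> h) then L R \<alpha> \<beta> else 0) -
      (if \<forall>h\<in>?S - R. \<alpha> h = \<beta> h then L (insert i R) \<alpha> \<beta> else 0))"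
      by (simp add: algebra_simps)
  qed
  finally show ?thesis unfolding moebius_def by simp
qed

text \<open>The exponents \<open>1 / p i\<close> and \<open>1 - 1 / p i\<close> are both below 1, so
  \<open>ultra_null\<close> applies.\<close>

lemma L_null:
  assumes R: "R \<subseteq> I" "i \<in> R"
  shows "((\<lambda>n. L R (\<alpha>(i := n)) \<beta>) \<longlongrightarrow> 0) ultra" "((\<lambda>n. L R \<alpha> (\<beta>(i := n))) \<longlongrightarrow> 0) ultra"
proof -
  have p: "1 < p i" using p_gt_1 R by auto
  show "((\<lambda>n. L R (\<alpha>(i := n)) \<beta>) \<longlongrightarrow> 0) ultra"
    by (rule ultra_null[of "1 / p i"]) (use p goodD(3)[OF good_L[OF R(1)] R(2)] in auto)
  show "((\<lambda>n. L R \<alpha> (\<beta>(i := n))) \<longlongrightarrow> 0) ultra"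
    by (rule ultra_null[of "1 - 1 / p i"]) (use p goodD(4)[OF good_L[OF R(1)] R(2)] in auto)
qed

text \<open>When both i-th indices move together, the term of \<open>insert i R\<close> tends to
  that of R by \<open>step_L\<close>, and the differences cancel. When one moves alone, the two
  indices eventually differ, which kills the first term, and the second is null by
  \<open>L_null\<close>.\<close>

lemma moebius_null:
  assumes S: "S \<subseteq> I" and i: "i \<in> S"
  shows "((\<lambda>n. moebius S (\<alpha>(i := n)) (\<beta>(i := n))) \<longlongrightarrow> 0) ultra"
    "((\<lambda>n. moebius S (\<alpha>(i := n)) \<beta>) \<longlongrightarrow> 0) ultra" "((\<lambda>n. moebius S \<alpha> (\<beta>(i := n))) \<longlongrightarrow> 0) ultra"
proof -
  let ?S = "S - {i}"
  have zero: "(-1) ^ card S * (\<Sum>R\<in>Pow ?S. (-1) ^ card R * (0 :: 'k)) = 0" by simp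
  let ?d = "\<lambda>\<alpha> \<beta> R. (if \<alpha> i = \<beta> i \<and> (\<forall>h\<in>?S - R. \<alpha> h = \<beta> h) then L R \<alpha> \<beta> else 0) -
     (if \<forall>h\<in>?S - R. \<alpha> h = \<beta> h then L (insert i R) \<alpha> \<beta> else 0)"
  have red: "((\<lambda>n. moebius S (a n) (b n)) \<longlongrightarrow> 0) ultra"
    if "\<And>R. R \<subseteq> ?S \<Longrightarrow> ((\<lambda>n. ?d (a n) (b n) R) \<longlongrightarrow> 0) ultra" for a b
  proof -
    have "((\<lambda>n. (-1) ^ card S * (\<Sum>R\<in>Pow ?S. (-1) ^ card R * ?d (a n) (b n) R)) \<longlongrightarrow>
      (-1) ^ card S * (\<Sum>R\<in>Pow ?S. (-1) ^ card R * (0 :: 'k))) ultra"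
      by (intro tendsto_mult tendsto_sum tendsto_const that) auto
    then show ?thesis unfolding moebius_split[OF S i] zero .
  qed
  show "((\<lambda>n. moebius S (\<alpha>(i := n)) (\<beta>(i := n))) \<longlongrightarrow> 0) ultra"
  proof (rule red)
    fix R assume R: "R \<subseteq> ?S"
    then have RI: "insert i R \<subseteq> I" "R \<subseteq> I" "i \<notin> R" using S i by auto
    have "L R = diag_lim i (L (insert i R))" using step_L[OF RI(1), of i] RI(3) by simp
    then have lim: "((\<lambda>n. L (insert i R) (\<alpha>(i := n)) (\<beta>(i := n))) \<longlongrightarrow> L R \<alpha> \<beta>) ultra"
      using diag_lim_tendsto[OF good_L[OF RI(1)], of \<alpha> i \<beta>] by simp
    have "L R (\<alpha>(i := n)) (\<beta>(i := n)) = L R \<alpha> \<beta>" for n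
      by (rule goodD(2)[OF good_L[OF RI(2)]]) (use RI in auto)
    moreover have "(\<forall>h\<in>?S - R. (\<alpha>(i := n)) h = (\<beta>(i := n)) h) \<longleftrightarrow> (\<forall>h\<in>?S - R. \<alpha> h = \<beta> h)" for n by auto
    ultimately have E: "?d (\<alpha>(i := n)) (\<beta>(i := n)) R =
        (if \<forall>h\<in>?S - R. \<alpha> h = \<beta> h then L R \<alpha> \<beta> - L (insert i R) (\<alpha>(i := n)) (\<beta>(i := n)) else 0)" for n
      by simp
    show "((\<lambda>n. ?d (\<alpha>(i := n)) (\<beta>(i := n)) R) \<longlongrightarrow> 0) ultra"
    proof (cases "\<forall>h\<in>?S - R. \<alpha> h = \<beta> h")
      case True
      have "((\<lambda>n. L R \<alpha> \<beta> - L (insert i R) (\<alpha>(i := n)) (\<beta>(i := n))) \<longlongrightarrow> 0) ultra"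
        using tendsto_diff[OF tendsto_const[of "L R \<alpha> \<beta>"] lim] by simp
      then show ?thesis unfolding E if_P[OF True] .
    next
      case False
      show ?thesis unfolding E if_not_P[OF False] by (rule tendsto_const)
    qed
  qed
  have aux: "((\<lambda>n. ?d (a n) (b n) R) \<longlongrightarrow> 0) ultra"
    if ev: "eventually (\<lambda>n. a n i \<noteq> b n i) ultra" and l: "((\<lambda>n. L (insert i R) (a n) (b n)) \<longlongrightarrow> 0) ultra" for a b R
  proof (rule Lim_null_comparison)
    show "\<forall>\<^sub>F n in ultra. norm (?d (a n) (b n) R) \<le> norm (L (insert i R) (a n) (b n))"
      using ev by eventually_elim simp
    show "((\<lambda>n. norm (L (insert i R) (a n) (b n))) \<longlongrightarrow> 0) ultra" by (rule tendsto_norm_zero[OF l])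
  qed
  have neq: "eventually (\<lambda>n. n \<noteq> k) ultra" for k :: nat using eventually_ultra_neq[of "{k}"] by simp
  show "((\<lambda>n. moebius S (\<alpha>(i := n)) \<beta>) \<longlongrightarrow> 0) ultra"
    by (intro red aux L_null) (use neq S i in auto)
  show "((\<lambda>n. moebius S \<alpha> (\<beta>(i := n))) \<longlongrightarrow> 0) ultra"
  proof (intro red aux L_null)
    show "eventually (\<lambda>n. \<alpha> i \<noteq> (\<beta>(i := n)) i) ultra" using neq[of "\<alpha> i"] by (rule eventually_mono) auto
  qed (use S i in auto)
qed

text \<open>By \<open>block_operator_bound\<close> this controls how far the operator, compressed to
  the box \<open>G\<close>, is from a scalar multiple of the identity.\<close>

definition total :: "('i \<Rightarrow> nat set) \<Rightarrow> real" where
  "total G = (\<Sum>S\<in>Pow I - {{}}. \<Sum>a\<in>Pi\<^sub>E S G. \<Sum>b\<in>Pi\<^sub>E S G. norm (moebius S a b))"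

text \<open>A new index n in coordinate \<open>i\<close> adds finitely many terms, with n in the
  row, in the column or in both; each of them is null by \<open>moebius_null\<close>.\<close>

lemma total_step:
  assumes G: "\<And>i. i \<in> I \<Longrightarrow> finite (G i)" and i: "i \<in> I"
  shows "((\<lambda>n. total (G(i := insert n (G i)))) \<longlongrightarrow> total G) ultra"
  unfolding total_def
proof (rule tendsto_sum)
  fix S assume "S \<in> Pow I - {{}}"
  then have S: "S \<subseteq> I" by auto
  let ?m = "\<lambda>a b. norm (moebius S a b)"
  show "((\<lambda>n. \<Sum>a\<in>Pi\<^sub>E S (G(i := insert n (G i))). \<Sum>b\<in>Pi\<^sub>E S (G(i := insert n (G i))). ?m a b) \<longlongrightarrow>
    (\<Sum>a\<in>Pi\<^sub>E S G. \<Sum>b\<in>Pi\<^sub>E S G. ?m a b)) ultra"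
  proof (cases "i \<in> S")
    case False
    then have "Pi\<^sub>E S (G(i := insert n (G i))) = Pi\<^sub>E S G" for n by (intro PiE_cong) auto
    then show ?thesis by simp
  next
    case True
    let ?S = "S - {i}"
    have SS: "insert i ?S = S" using True by auto
    have rest: "Pi\<^sub>E ?S (G(i := insert n (G i))) = Pi\<^sub>E ?S G" for n by (intro PiE_cong) auto
    have sumS: "(\<Sum>a\<in>Pi\<^sub>E S H. \<phi> a) = (\<Sum>y\<in>H i. \<Sum>g\<in>Pi\<^sub>E ?S H. \<phi> (g(i := y)))" for H and \<phi> :: "('i \<Rightarrow> nat) \<Rightarrow> real"
      using sum_PiE_insert[of i ?S \<phi> H] SS by simp
    let ?old = "\<Sum>y\<in>G i. \<Sum>g\<in>Pi\<^sub>E ?S G. \<Sum>z\<in>G i. \<Sum>h\<in>Pi\<^sub>E ?S G. ?m (g(i := y)) (h(i := z))"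
    let ?new = "\<lambda>n. (\<Sum>g\<in>Pi\<^sub>E ?S G. (\<Sum>h\<in>Pi\<^sub>E ?S G. ?m (g(i := n)) (h(i := n))) +
        (\<Sum>z\<in>G i. \<Sum>h\<in>Pi\<^sub>E ?S G. ?m (g(i := n)) (h(i := z)))) +
      (\<Sum>y\<in>G i. \<Sum>g\<in>Pi\<^sub>E ?S G. (\<Sum>h\<in>Pi\<^sub>E ?S G. ?m (g(i := y)) (h(i := n))) +
        (\<Sum>z\<in>G i. \<Sum>h\<in>Pi\<^sub>E ?S G. ?m (g(i := y)) (h(i := z))))"
    have "eventually (\<lambda>n. n \<notin> G i) ultra" by (rule eventually_ultra_neq[OF G[OF i]])
    then have "eventually (\<lambda>n. (\<Sum>a\<in>Pi\<^sub>E S (G(i := insert n (G i))). \<Sum>b\<in>Pi\<^sub>E S (G(i := insert n (G i))). ?m a b) = ?new n) ultra"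
      by eventually_elim (simp only: sumS rest fun_upd_same sum.insert[OF G[OF i]] simp_thms)
    moreover have "(?new \<longlongrightarrow> (\<Sum>g\<in>Pi\<^sub>E ?S G. (\<Sum>h\<in>Pi\<^sub>E ?S G. 0) + (\<Sum>z\<in>G i. \<Sum>h\<in>Pi\<^sub>E ?S G. 0)) +
      (\<Sum>y\<in>G i. \<Sum>g\<in>Pi\<^sub>E ?S G. (\<Sum>h\<in>Pi\<^sub>E ?S G. 0) +
        (\<Sum>z\<in>G i. \<Sum>h\<in>Pi\<^sub>E ?S G. ?m (g(i := y)) (h(i := z))))) ultra"
      by (intro tendsto_add tendsto_sum tendsto_norm_zero moebius_null[OF S True] tendsto_const)
    ultimately show ?thesis
      by (simp add: tendsto_cong sumS)
  qed
qed

lemma total_empty: "total (\<lambda>_. {}) = 0"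
  unfolding total_def by (intro sum.neutral) (auto simp: PiE_eq_empty_iff)

text \<open>Indices are added to the coordinates in turn. Starting from total 0, the strict
  inequality in \<open>P\<close> is an open condition and hence survives a suitable choice of each
  new index by \<open>total_step\<close>.\<close>

theorem selection:
  assumes e: "0 < e"
  shows "\<exists>a :: 'i \<Rightarrow> nat \<Rightarrow> nat. (\<forall>i\<in>I. inj (a i)) \<and> (\<forall>n. total (\<lambda>i. if i \<in> I then a i ` {..<n} else {}) \<le> e)"
proof -
  define P where "P G \<longleftrightarrow> (\<forall>i. finite (G i)) \<and> total G < e" for G :: "'i \<Rightarrow> nat set"
  have step: "\<exists>G'. P G' \<and> (\<forall>i\<in>I. \<exists>n. n \<notin> G i \<and> G' i = insert n (G i)) \<and> (\<forall>i. i \<notin> I \<longrightarrow> G' i = G i)" if G: "P G" for G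
  proof -
    have "\<exists>G'. P G' \<and> (\<forall>i\<in>J. \<exists>n. n \<notin> G i \<and> G' i = insert n (G i)) \<and> (\<forall>i. i \<notin> J \<longrightarrow> G' i = G i)" if "J \<subseteq> I" for J
      using finite_subset[OF that finite_I] that
    proof (induction J)
      case empty
      then show ?case using G by auto
    next
      case (insert i J)
      then obtain G' where G': "P G'" "\<And>h. h \<in> J \<Longrightarrow> \<exists>n. n \<notin> G h \<and> G' h = insert n (G h)" "\<And>h. h \<notin> J \<Longrightarrow> G' h = G h"
        by blast
      have "eventually (\<lambda>n. total (G'(i := insert n (G' i))) < e \<and> n \<notin> G' i) ultra"
        using G'(1) insert.prems
        by (intro eventually_conj order_tendstoD(2)[OF total_step] eventually_ultra_neq) (auto simp: P_def)
      then obtain n where n: "total (G'(i := insert n (G' i))) < e" "n \<notin> G' i"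
        using eventually_happens'[OF ultra(1)] by blast
      have PG: "P (G'(i := insert n (G' i)))" using n G'(1) by (auto simp: P_def)
      have "G' i = G i" using G'(3) insert.hyps by blast
      then show ?case using G'(2,3) n(2) insert.hyps
        by (intro exI[of _ "G'(i := insert n (G' i))"] conjI PG ballI allI impI) (auto split: if_splits)
    qed
    from this[OF order_refl] show ?thesis .
  qed
  have "P (\<lambda>_. {})" using e by (simp add: P_def total_empty)
  then have "\<exists>G. \<forall>k. (P (G k) \<and> (k = 0 \<longrightarrow> G k = (\<lambda>_. {}))) \<and>
      ((\<forall>i\<in>I. \<exists>n. n \<notin> G k i \<and> G (Suc k) i = insert n (G k i)) \<and> (\<forall>i. i \<notin> I \<longrightarrow> G (Suc k) i = G k i))"
    using step by (intro dependent_nat_choice) auto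
  then obtain G where G: "\<And>k. P (G k)" "G 0 = (\<lambda>_. {})"
    and next_G: "\<And>k i. i \<in> I \<Longrightarrow> \<exists>n. n \<notin> G k i \<and> G (Suc k) i = insert n (G k i)" "\<And>k i. i \<notin> I \<Longrightarrow> G (Suc k) i = G k i"
    by metis
  \<comment> \<open>The index added to coordinate \<open>i\<close> at stage \<open>k\<close>; as it
    is new each time, \<open>a i\<close> is injective.\<close>
  define a where "a i k = (SOME n. n \<notin> G k i \<and> G (Suc k) i = insert n (G k i))" for i k
  have a: "a i k \<notin> G k i" "G (Suc k) i = insert (a i k) (G k i)" if "i \<in> I" for i k
    using someI_ex[OF next_G(1)[OF that, of k]] unfolding a_def by blast+
  have Ga: "G k i = (if i \<in> I then a i ` {..<k} else {})" for k i
    by (induction k) (auto simp: G(2) a next_G(2) lessThan_Suc)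
  have "inj (a i)" if i: "i \<in> I" for i
  proof (rule linorder_injI)
    fix k l :: nat assume "k < l"
    then have "a i k \<in> G l i" using i by (simp add: Ga)
    then show "a i k \<noteq> a i l" using a(1)[OF i, of l] by auto
  qed
  moreover have "total (\<lambda>i. if i \<in> I then a i ` {..<n} else {}) \<le> e" for n
  proof -
    have "G n = (\<lambda>i. if i \<in> I then a i ` {..<n} else {})" using Ga by blast
    then show ?thesis using G(1)[of n] by (simp add: P_def)
  qed
  ultimately show ?thesis by blast
qed

end

section \<open>Matrix entries of operators\<close>

text \<open>Test vectors; with distinct indices and unimodular coefficients their norm depends only
  on the number of terms.\<close>

definition fin_vec :: "'a set \<Rightarrow> ('a \<Rightarrow> nat) \<Rightarrow> ('a \<Rightarrow> 'k::real_normed_field) \<Rightarrow> nat \<Rightarrow> 'k"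
  where "fin_vec F m c = (\<Sum>k\<in>F. pointwise_scale (c k) (unit_vec (m k)))"

lemma fin_vec_lp:
  assumes p: "0 < p" and F: "finite F" "inj_on m F" and c: "\<And>k. k \<in> F \<Longrightarrow> norm (c k) = 1"
  shows "fin_vec F m c \<in> lp p" "lp_norm p (fin_vec F m c) = real (card F) powr (1 / p)"
proof -
  let ?f = "\<lambda>k. pointwise_scale (c k) (unit_vec (m k))"
  have f: "?f k \<in> lp p" "psum p (?f k) = 1" if "k \<in> F" for k
  proof -
    show "?f k \<in> lp p" by (rule lp_scale[OF unit_vec_lp(1)[OF p] p])
    have "lp_norm p (?f k) = 1" using c[OF that] by (simp add: lp_scale(2)[OF unit_vec_lp(1)[OF p] p] unit_vec_lp(2)[OF p])
    then show "psum p (?f k) = 1" using lp_norm_powr[OF \<open>?f k \<in> lp p\<close> p] by simp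
  qed
  have disj: "?f k n = 0 \<or> ?f l n = 0" if "k \<in> F" "l \<in> F" "k \<noteq> l" for k l n
    using that F(2) by (auto simp: pointwise_scale_def unit_vec_def inj_on_def)
  have "(\<Sum>k\<in>F. ?f k) \<in> lp p" "psum p (\<Sum>k\<in>F. ?f k) = (\<Sum>k\<in>F. psum p (?f k))"
    by (rule psum_disjoint[OF p F(1)]; use f(1) disj in blast)+
  then show "fin_vec F m c \<in> lp p" "lp_norm p (fin_vec F m c) = real (card F) powr (1 / p)"
    by (simp_all add: fin_vec_def lp_norm_psum f(2))
qed

context lp_tensor
begin

definition unit_tuple :: "('i \<Rightarrow> nat) \<Rightarrow> 'i \<Rightarrow> nat \<Rightarrow> 'k" where "unit_tuple \<alpha> = (\<lambda>i\<in>I. unit_vec (\<alpha> i))"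
definition basis :: "('i \<Rightarrow> nat) \<Rightarrow> 'x" where "basis \<alpha> = tau (unit_tuple \<alpha>)"

lemma unit_tuple_PE: "unit_tuple \<alpha> \<in> PE"
  by (auto simp: unit_tuple_def unit_vec_lp p0)

lemma unit_tuple_upd: "i \<in> I \<Longrightarrow> (unit_tuple \<alpha>)(i := unit_vec n) = unit_tuple (\<alpha>(i := n))"
  by (auto simp: unit_tuple_def)

lemma wt_upd:
  assumes "i \<in> I" shows "wt (x(i := v)) = lp_norm (p i) v * (\<Prod>h\<in>I-{i}. lp_norm (p h) (x h))"
proof -
  have "(\<Prod>h\<in>I-{i}. lp_norm (p h) ((x(i := v)) h)) = (\<Prod>h\<in>I-{i}. lp_norm (p h) (x h))"
    by (intro prod.cong) auto
  then show ?thesis unfolding wt_def prod.remove[OF fin assms] by simp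
qed

lemma wt_unit_tuple: "wt (unit_tuple \<alpha>) = 1"
  unfolding wt_def unit_tuple_def by (intro prod.neutral) (simp add: unit_vec_lp p0)

lemma unit_tuple_norm: "h \<in> I \<Longrightarrow> lp_norm (p h) (unit_tuple \<alpha> h) = 1"
  by (simp add: unit_tuple_def unit_vec_lp p0)

lemma basis_X: "basis \<alpha> \<in> X" unfolding basis_def by (rule tau_in_X[OF unit_tuple_PE])
lemma norm_basis: "norm (basis \<alpha>) \<le> 1"
  unfolding basis_def using norm_tau_le[OF unit_tuple_PE, of \<alpha>] by (simp add: wt_unit_tuple)

lemma basis_cong: "(\<And>i. i \<in> I \<Longrightarrow> \<alpha> i = \<alpha>' i) \<Longrightarrow> basis \<alpha> = basis \<alpha>'"
  unfolding basis_def unit_tuple_def by (simp cong: restrict_cong)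

lemma tau_fin_vec:
  assumes x: "x \<in> PE" and i: "i \<in> I"
  shows "tau (x(i := fin_vec F m c)) = (\<Sum>k\<in>F. smul (c k) (tau (x(i := unit_vec (m k)))))"
proof -
  have E: "unit_vec n \<in> lp (p i)" "pointwise_scale d (unit_vec n) \<in> lp (p i)" for n and d :: 'k
    using unit_vec_lp(1)[OF p0[OF i]] lp_scale(1)[OF unit_vec_lp(1)[OF p0[OF i]] p0[OF i]] by auto
  have lin: "linear_on pointwise_scale smul (lp (p i)) (\<lambda>v. tau (x(i := v)))"
    using tau_multilinear x i unfolding multilinear_map_def by blast
  have "tau (x(i := fin_vec F m c)) = (\<Sum>k\<in>F. tau (x(i := pointwise_scale (c k) (unit_vec (m k)))))"
    unfolding fin_vec_def by (rule linear_on_sum[OF lin subE[OF i] ptw.vector_space_axioms]) (rule E(2))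
  also have "\<dots> = (\<Sum>k\<in>F. smul (c k) (tau (x(i := unit_vec (m k)))))"
    by (intro sum.cong refl multilinear_mapD(2)[OF tau_multilinear x i E(1)])
  finally show ?thesis .
qed

definition coord_form :: "('i \<Rightarrow> nat) \<Rightarrow> ('i \<Rightarrow> nat \<Rightarrow> 'k) \<Rightarrow> 'k" where
  "coord_form \<beta> x = (\<Prod>i\<in>I. x i (\<beta> i))"

text \<open>The functional biorthogonal to \<open>basis \<beta>\<close>; it exists by the universal
  property.\<close>

definition coord :: "('i \<Rightarrow> nat) \<Rightarrow> 'x \<Rightarrow> 'k" where
  "coord \<beta> = (SOME F. linear_on smul (*) X F \<and> (\<forall>u\<in>X. norm (F u) \<le> norm u) \<and> (\<forall>x\<in>PE. F (tau x) = coord_form \<beta> x))"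

lemma coord_form_remove: "i \<in> I \<Longrightarrow> coord_form \<beta> x = x i (\<beta> i) * (\<Prod>h\<in>I-{i}. x h (\<beta> h))"
  unfolding coord_form_def by (rule prod.remove[OF fin])

lemma coord_form_upd:
  assumes "i \<in> I" shows "coord_form \<beta> (x(i := v)) = v (\<beta> i) * (\<Prod>h\<in>I-{i}. x h (\<beta> h))"
proof -
  have "(\<Prod>h\<in>I-{i}. (x(i := v)) h (\<beta> h)) = (\<Prod>h\<in>I-{i}. x h (\<beta> h))" by (intro prod.cong) auto
  then show ?thesis unfolding coord_form_remove[OF assms] by simp
qed

lemma coord:
  shows "linear_on smul (*) X (coord \<beta>)" "u \<in> X \<Longrightarrow> norm (coord \<beta> u) \<le> norm u"
    "x \<in> PE \<Longrightarrow> coord \<beta> (tau x) = coord_form \<beta> x"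
proof -
  have ml: "multilinear_map pointwise_scale (*) I (\<lambda>i. lp (p i)) (coord_form \<beta>)"
    unfolding multilinear_map_def linear_on_def
    by (simp add: coord_form_upd pointwise_scale_def algebra_simps)
  have "norm (coord_form \<beta> x) \<le> 1 * wt x" if "x \<in> PE" for x
    unfolding coord_form_def wt_def prod_norm[symmetric] using that
    by (auto intro!: prod_mono norm_le_lp_norm p0)
  from universal[OF normed_space_over_mult ml this]
  have "\<exists>F. linear_on smul (*) X F \<and> (\<forall>u\<in>X. norm (F u) \<le> norm u) \<and> (\<forall>x\<in>PE. F (tau x) = coord_form \<beta> x)"
    by (metis mult_1 zero_le_one)
  from someI_ex[OF this] show "linear_on smul (*) X (coord \<beta>)" "u \<in> X \<Longrightarrow> norm (coord \<beta> u) \<le> norm u"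
    "x \<in> PE \<Longrightarrow> coord \<beta> (tau x) = coord_form \<beta> x"
    unfolding coord_def by blast+
qed

lemma coord_cong:
  assumes "\<And>i. i \<in> I \<Longrightarrow> \<beta> i = \<beta>' i" shows "coord \<beta> = coord \<beta>'"
proof -
  have "coord_form \<beta> = coord_form \<beta>'" unfolding coord_form_def using assms by (intro ext prod.cong) auto
  then show ?thesis unfolding coord_def by simp
qed

lemma coord_arith:
  "u \<in> X \<Longrightarrow> v \<in> X \<Longrightarrow> coord \<beta> (u + v) = coord \<beta> u + coord \<beta> v" "u \<in> X \<Longrightarrow> coord \<beta> (smul c u) = c * coord \<beta> u"
  "u \<in> X \<Longrightarrow> coord \<beta> (r *\<^sub>R u) = r *\<^sub>R coord \<beta> u"
  "(\<And>k. k \<in> F \<Longrightarrow> f k \<in> X) \<Longrightarrow> coord \<beta> (\<Sum>k\<in>F. f k) = (\<Sum>k\<in>F. coord \<beta> (f k))"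
  by (simp_all add: linear_onD[OF coord(1)] scaleR_eq scaleR_conv_of_real) (rule lin_sum[OF coord(1)])

text \<open>\<open>\<alpha>\<close> belongs to the argument, \<open>\<beta>\<close> to the
  value.\<close>

definition entry :: "('x \<Rightarrow> 'x) \<Rightarrow> ('i \<Rightarrow> nat) \<Rightarrow> ('i \<Rightarrow> nat) \<Rightarrow> 'k" where
  "entry T \<alpha> \<beta> = coord \<beta> (T (basis \<alpha>))"

lemma functional_bound:
  assumes F: "finite F" and bd: "\<And>x. x \<in> PE \<Longrightarrow> norm (\<Sum>k\<in>F. c k * coord_form (\<beta> k) x) \<le> C * wt x" and C: "0 \<le> C"
    and u: "u \<in> X"
  shows "norm (\<Sum>k\<in>F. c k * coord (\<beta> k) u) \<le> C * norm u"
proof (rule lin_bound[OF normed_space_over_mult _ _ _ C u])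
  show "linear_on smul (*) X (\<lambda>u. \<Sum>k\<in>F. c k * coord (\<beta> k) u)"
    unfolding linear_on_def
    by (auto simp: coord_arith sum.distrib distrib_left sum_distrib_left mult_ac)
  show "norm (\<Sum>k\<in>F. c k * coord (\<beta> k) u) \<le> (\<Sum>k\<in>F. norm (c k)) * norm u" if "u \<in> X" for u
    unfolding sum_distrib_right
    by (intro sum_norm_le) (auto simp: norm_mult intro!: mult_left_mono coord that)
  show "norm (\<Sum>k\<in>F. c k * coord (\<beta> k) (tau x)) \<le> C * wt x" if "x \<in> PE" for x
    using bd[OF that] by (simp add: coord(3)[OF that])
qed

text \<open>Apply \<open>T\<close> to the tensor whose i-th factor is a unimodular combination of
  unit vectors over \<open>F\<close>, of norm \<open>card F powr (1 / p i)\<close>.\<close>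

lemma entry_row:
  assumes T: "bop K T" and i: "i \<in> I" and F: "finite F"
  shows "(\<Sum>n\<in>F. norm (entry T (\<alpha>(i := n)) \<beta>)) \<le> K * real (card F) powr (1 / p i)"
proof (rule sum_norm_le_of_phases)
  fix c :: "nat \<Rightarrow> 'k" assume c: "\<And>n. norm (c n) = 1"
  let ?x = "(unit_tuple \<alpha>)(i := fin_vec F (\<lambda>n. n) c)"
  note v = fin_vec_lp[OF p0[OF i] F inj_on_id2, of c, OF c]
  have x: "?x \<in> PE" by (intro PiE_upd unit_tuple_PE i v)
  have b: "smul (c n) (basis (\<alpha>(i := n))) \<in> X" for n by (intro X_closed basis_X)
  have "tau ?x = (\<Sum>n\<in>F. smul (c n) (basis (\<alpha>(i := n))))"
    unfolding tau_fin_vec[OF unit_tuple_PE i] basis_def unit_tuple_upd[OF i] ..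
  then have "coord \<beta> (T (tau ?x)) = (\<Sum>n\<in>F. c n * entry T (\<alpha>(i := n)) \<beta>)"
    by (simp add: bop_arith(5)[OF T b] bop_arith(2)[OF T basis_X] coord_arith bopD(2)[OF T] X_closed basis_X entry_def)
  moreover have "norm (coord \<beta> (T (tau ?x))) \<le> K * wt ?x"
    by (intro order_trans[OF coord(2)] order_trans[OF bopD(4)[OF T]] mult_left_mono norm_tau_le bopD(2)[OF T] tau_in_X x bopD(1)[OF T])
  moreover have "wt ?x = real (card F) powr (1 / p i)"
    unfolding wt_upd[OF i] v by (simp add: unit_tuple_norm)
  ultimately show "norm (\<Sum>n\<in>F. c n * entry T (\<alpha>(i := n)) \<beta>) \<le> K * real (card F) powr (1 / p i)" by simp
qed

lemma sum_coordinates_le: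
  assumes x: "x \<in> lp q" "0 < q" and F: "finite F" "inj_on m F"
  shows "(\<Sum>k\<in>F. norm (x (m k)) powr q) powr (1 / q) \<le> lp_norm q x"
proof -
  have "(\<Sum>k\<in>F. norm (x (m k)) powr q) = (\<Sum>n\<in>m ` F. norm (x n) powr q)" using F by (simp add: sum.reindex)
  also have "\<dots> \<le> psum q x" using F by (intro lp_sum_le x) auto
  finally show ?thesis unfolding lp_norm_psum using x by (intro powr_mono2 sum_nonneg) auto
qed

text \<open>Dual to \<open>entry_row\<close>: by Hoelder's inequality a unimodular combination of
  coordinate functionals in direction \<open>i\<close> has norm at most
  \<open>card F powr (1 - 1 / p i)\<close>.\<close>

lemma entry_col:
  assumes T: "bop K T" and i: "i \<in> I" and F: "finite F"
  shows "(\<Sum>n\<in>F. norm (entry T \<alpha> (\<beta>(i := n)))) \<le> K * real (card F) powr (1 - 1 / p i)"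
proof (rule sum_norm_le_of_phases)
  fix c :: "nat \<Rightarrow> 'k" assume c: "\<And>n. norm (c n) = 1"
  let ?C = "real (card F) powr (1 - 1 / p i)"
  have "norm (\<Sum>n\<in>F. c n * coord (\<beta>(i := n)) (T (basis \<alpha>))) \<le> ?C * norm (T (basis \<alpha>))"
  proof (rule functional_bound[OF F])
    fix x assume x: "x \<in> PE"
    have xi: "x i \<in> lp (p i)" using x i by auto
    let ?R = "\<Prod>h\<in>I-{i}. x h (\<beta> h)"
    have "(\<Prod>h\<in>I-{i}. x h ((\<beta>(i := n)) h)) = ?R" for n by (intro prod.cong) auto
    then have "(\<Sum>n\<in>F. c n * coord_form (\<beta>(i := n)) x) = (\<Sum>n\<in>F. c n * x i n) * ?R"
      by (simp add: coord_form_remove[OF i] sum_distrib_right mult_ac)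
    then have "norm (\<Sum>n\<in>F. c n * coord_form (\<beta>(i := n)) x) = norm (\<Sum>n\<in>F. c n * x i n) * norm ?R"
      by (simp add: norm_mult)
    also have "\<dots> \<le> (?C * lp_norm (p i) (x i)) * (\<Prod>h\<in>I-{i}. lp_norm (p h) (x h))"
    proof (rule mult_mono)
      have "norm (\<Sum>n\<in>F. c n * x i n) \<le> (\<Sum>n\<in>F. 1 * norm (x i n))"
        by (intro sum_norm_le) (simp add: norm_mult c)
      also have "\<dots> \<le> (\<Sum>n\<in>F. 1 powr (1 / (1 - 1 / p i))) powr (1 / (1 / (1 - 1 / p i))) * (\<Sum>n\<in>F. norm (x i n) powr p i) powr (1 / p i)"
        using p1[OF i] by (intro holder_sum) (auto simp: field_simps)
      also have "\<dots> \<le> ?C * lp_norm (p i) (x i)"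
        using sum_coordinates_le[OF xi p0[OF i] F inj_on_id2] by (simp add: mult_left_mono)
      finally show "norm (\<Sum>n\<in>F. c n * x i n) \<le> ?C * lp_norm (p i) (x i)" .
      show "norm ?R \<le> (\<Prod>h\<in>I-{i}. lp_norm (p h) (x h))"
        unfolding prod_norm[symmetric] using x by (auto intro!: prod_mono norm_le_lp_norm p0)
    qed (auto simp: lp_norm_nonneg)
    also have "\<dots> = ?C * wt x" unfolding wt_def prod.remove[OF fin i] by (simp add: mult.assoc)
    finally show "norm (\<Sum>n\<in>F. c n * coord_form (\<beta>(i := n)) x) \<le> ?C * wt x" .
  qed (auto intro: bopD(2)[OF T] basis_X)
  also have "\<dots> \<le> ?C * (K * 1)"
    using norm_basis bopD(1)[OF T] by (intro mult_left_mono order_trans[OF bopD(4)[OF T basis_X]]) auto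
  finally show "norm (\<Sum>n\<in>F. c n * entry T \<alpha> (\<beta>(i := n))) \<le> K * ?C" by (simp add: entry_def mult.commute)
qed

text \<open>Independent signs for coordinates \<open>i\<close> and \<open>h\<close> go into the test
  tensor, and the same signs, together with \<open>M\<close>, into the functional. This bounds a
  signed sum over pairs of row and column indices in both coordinates; passing to the diagonal twice
  leaves the entries whose multi-indices agree there.\<close>

lemma entry_multiplier:
  assumes T: "bop K T" and i: "i \<in> I" and j: "h \<in> I" "i \<noteq> h"
  shows "multiplier K (p i) (p h) (\<lambda>m n. entry T (\<alpha>(i := m, h := n)) (\<beta>(i := m, h := n)))"
  unfolding multiplier_def
proof (intro allI impI)
  fix r :: nat and m n :: "nat \<Rightarrow> nat" and M :: "nat \<Rightarrow> nat \<Rightarrow> real" and C :: real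
  assume inj: "inj_on m {..<r}" "inj_on n {..<r}" and C: "0 \<le> C"
    and M: "\<forall>x y :: nat \<Rightarrow> 'k. norm (\<Sum>k<r. \<Sum>l<r. M k l *\<^sub>R (x k * y l)) \<le>
      C * ((\<Sum>k<r. norm (x k) powr p i) powr (1 / p i) * (\<Sum>l<r. norm (y l) powr p h) powr (1 / p h))"
  let ?F = "{..<r}"
  let ?\<alpha> = "\<lambda>k l. \<alpha>(i := m k, h := n l)" and ?\<beta> = "\<lambda>k l. \<beta>(i := m k, h := n l)"
  let ?B = "K * (C * (real r powr (1 / p i) * real r powr (1 / p h)))"
  have hi: "h \<in> I - {i}" using j by auto
  have main: "norm (\<Sum>k<r. \<Sum>k'<r. (\<epsilon> k * \<epsilon> k') *\<^sub>R (\<Sum>l<r. \<Sum>l'<r. (\<delta> l * \<delta> l') *\<^sub>R (M k' l' *\<^sub>R entry T (?\<alpha> k l) (?\<beta> k' l')))) \<le> ?B"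
    if \<epsilon>: "\<And>k. \<epsilon> k \<in> {1, -1 :: real}" and \<delta>: "\<And>k. \<delta> k \<in> {1, -1 :: real}" for \<epsilon> \<delta>
  proof -
    let ?v = "fin_vec ?F m (\<lambda>k. of_real (\<epsilon> k)) :: nat \<Rightarrow> 'k" and ?w = "fin_vec ?F n (\<lambda>k. of_real (\<delta> k)) :: nat \<Rightarrow> 'k"
    have n1: "norm (of_real (\<epsilon> k) :: 'k) = 1" "norm (of_real (\<delta> k) :: 'k) = 1" for k using \<epsilon>[of k] \<delta>[of k] by auto
    have v: "?v \<in> lp (p i)" "lp_norm (p i) ?v = real r powr (1 / p i)"
      using fin_vec_lp[OF p0[OF i] finite_lessThan inj(1) n1(1)] by (simp_all only: card_lessThan)
    have w: "?w \<in> lp (p h)" "lp_norm (p h) ?w = real r powr (1 / p h)"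
      using fin_vec_lp[OF p0[OF j(1)] finite_lessThan inj(2) n1(2)] by (simp_all only: card_lessThan)
    let ?y = "(unit_tuple \<alpha>)(i := ?v)" and ?x = "(unit_tuple \<alpha>)(i := ?v, h := ?w)"
    have y: "?y \<in> PE" by (intro PiE_upd unit_tuple_PE i v)
    have x: "?x \<in> PE" by (intro PiE_upd y j w)
    have "tau ?x = (\<Sum>l<r. smul (of_real (\<delta> l)) (tau ((unit_tuple \<alpha>)(i := ?v, h := unit_vec (n l)))))"
      by (rule tau_fin_vec[OF y j(1)])
    also have "\<dots> = (\<Sum>l<r. smul (of_real (\<delta> l)) (\<Sum>k<r. smul (of_real (\<epsilon> k)) (basis (?\<alpha> k l))))"
    proof (intro sum.cong refl arg_cong[where f = "smul _"])
      fix l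
      have tw: "(unit_tuple \<alpha>)(i := a, h := unit_vec (n l)) = (unit_tuple \<alpha>)(h := unit_vec (n l), i := a)" for a
        using j by (auto simp: fun_upd_twist)
      have tw': "\<alpha>(h := n l, i := m k) = \<alpha>(i := m k, h := n l)" for k using j by (auto simp: fun_upd_twist)
      have "tau ((unit_tuple \<alpha>)(i := ?v, h := unit_vec (n l))) = tau ((unit_tuple (\<alpha>(h := n l)))(i := ?v))"
        by (simp only: tw unit_tuple_upd[OF j(1)])
      also have "\<dots> = (\<Sum>k<r. smul (of_real (\<epsilon> k)) (tau ((unit_tuple (\<alpha>(h := n l)))(i := unit_vec (m k)))))"
        by (rule tau_fin_vec[OF unit_tuple_PE i])
      also have "\<dots> = (\<Sum>k<r. smul (of_real (\<epsilon> k)) (basis (?\<alpha> k l)))"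
        by (simp only: unit_tuple_upd[OF i] basis_def tw')
      finally show "tau ((unit_tuple \<alpha>)(i := ?v, h := unit_vec (n l))) = (\<Sum>k<r. smul (of_real (\<epsilon> k)) (basis (?\<alpha> k l)))" .
    qed
    finally have tx: "tau ?x = (\<Sum>l<r. \<Sum>k<r. (\<epsilon> k * \<delta> l) *\<^sub>R basis (?\<alpha> k l))"
      by (simp add: smul_of_real scaleR_sum_right mult.commute)
    have bX: "(\<epsilon> k * \<delta> l) *\<^sub>R basis (?\<alpha> k l) \<in> X" for k l by (intro X_scaleR basis_X)
    have Tx: "T (tau ?x) = (\<Sum>l<r. \<Sum>k<r. (\<epsilon> k * \<delta> l) *\<^sub>R T (basis (?\<alpha> k l)))"
      unfolding tx by (subst bop_arith(5)[OF T], (intro X_closed bX)[1], subst bop_arith(5)[OF T], rule bX)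
        (simp add: scaleR_eq bop_arith(2)[OF T basis_X])
    have coordT: "coord (?\<beta> k' l') (T (tau ?x)) = (\<Sum>l<r. \<Sum>k<r. (\<epsilon> k * \<delta> l) *\<^sub>R entry T (?\<alpha> k l) (?\<beta> k' l'))" for k' l'
      unfolding Tx entry_def
      by (subst coord_arith(4), (intro X_closed X_scaleR bopD(2)[OF T] basis_X)[1], subst coord_arith(4), (intro X_closed X_scaleR bopD(2)[OF T] basis_X)[1])
        (simp add: coord_arith(3) bopD(2)[OF T] basis_X)
    let ?S = "\<Sum>z\<in>?F \<times> ?F. of_real (\<epsilon> (fst z) * \<delta> (snd z) * M (fst z) (snd z)) * coord (?\<beta> (fst z) (snd z)) (T (tau ?x))"
    have "norm ?S \<le> C * norm (T (tau ?x))"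
    proof (rule functional_bound)
      fix z assume z: "z \<in> PE"
      have zl: "z i \<in> lp (p i)" "z h \<in> lp (p h)" using z i j by auto
      let ?R = "\<Prod>g\<in>I-{i}-{h}. z g (\<beta> g)"
      have cf: "coord_form (?\<beta> k l) z = z i (m k) * (z h (n l) * ?R)" for k l
      proof -
        have "(\<Prod>g\<in>I-{i}-{h}. z g (?\<beta> k l g)) = ?R" by (intro prod.cong) auto
        then show ?thesis unfolding coord_form_remove[OF i] prod.remove[OF finite_Diff[OF fin] hi] using j(2) by simp
      qed
      have "(\<Sum>q\<in>?F \<times> ?F. of_real (\<epsilon> (fst q) * \<delta> (snd q) * M (fst q) (snd q)) * coord_form (?\<beta> (fst q) (snd q)) z) =
          (\<Sum>k<r. \<Sum>l<r. M k l *\<^sub>R ((\<epsilon> k *\<^sub>R z i (m k)) * (\<delta> l *\<^sub>R z h (n l)))) * ?R"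
        unfolding cf sum.cartesian_product' sum_distrib_right
        by (intro sum.cong refl) (simp add: scaleR_conv_of_real mult_ac)
      then have "norm (\<Sum>q\<in>?F \<times> ?F. of_real (\<epsilon> (fst q) * \<delta> (snd q) * M (fst q) (snd q)) * coord_form (?\<beta> (fst q) (snd q)) z) =
          norm (\<Sum>k<r. \<Sum>l<r. M k l *\<^sub>R ((\<epsilon> k *\<^sub>R z i (m k)) * (\<delta> l *\<^sub>R z h (n l)))) * norm ?R"
        by (simp add: norm_mult)
      also have "\<dots> \<le> (C * (lp_norm (p i) (z i) * lp_norm (p h) (z h))) * (\<Prod>g\<in>I-{i}-{h}. lp_norm (p g) (z g))"
      proof (rule mult_mono)
        have e1: "norm (\<epsilon> k *\<^sub>R a) = norm a" "norm (\<delta> k *\<^sub>R a) = norm a" for k and a :: 'k using \<epsilon>[of k] \<delta>[of k] by auto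
        have "norm (\<Sum>k<r. \<Sum>l<r. M k l *\<^sub>R ((\<epsilon> k *\<^sub>R z i (m k)) * (\<delta> l *\<^sub>R z h (n l)))) \<le>
          C * ((\<Sum>k<r. norm (\<epsilon> k *\<^sub>R z i (m k)) powr p i) powr (1 / p i) * (\<Sum>l<r. norm (\<delta> l *\<^sub>R z h (n l)) powr p h) powr (1 / p h))"
          by (rule M[rule_format])
        also have "\<dots> \<le> C * (lp_norm (p i) (z i) * lp_norm (p h) (z h))"
          unfolding e1 using C
          by (intro mult_left_mono mult_mono sum_coordinates_le zl p0 i j finite_lessThan inj) (auto simp: lp_norm_nonneg)
        finally show "norm (\<Sum>k<r. \<Sum>l<r. M k l *\<^sub>R ((\<epsilon> k *\<^sub>R z i (m k)) * (\<delta> l *\<^sub>R z h (n l)))) \<le> C * (lp_norm (p i) (z i) * lp_norm (p h) (z h))" .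
        show "norm ?R \<le> (\<Prod>g\<in>I-{i}-{h}. lp_norm (p g) (z g))"
          unfolding prod_norm[symmetric] using z by (auto intro!: prod_mono norm_le_lp_norm p0)
      qed (use C in \<open>auto simp: lp_norm_nonneg\<close>)
      also have "\<dots> = C * wt z"
        unfolding wt_def prod.remove[OF fin i] prod.remove[OF finite_Diff[OF fin] hi] by (simp add: mult_ac)
      finally show "norm (\<Sum>q\<in>?F \<times> ?F. of_real (\<epsilon> (fst q) * \<delta> (snd q) * M (fst q) (snd q)) * coord_form (?\<beta> (fst q) (snd q)) z) \<le> C * wt z" .
    qed (use C x in \<open>auto intro: bopD(2)[OF T] tau_in_X\<close>)
    also have "\<dots> \<le> C * (K * wt ?x)"
      using C by (intro mult_left_mono order_trans[OF bopD(4)[OF T tau_in_X[OF x]]] norm_tau_le x bopD(1)[OF T])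
    also have "wt ?x = real r powr (1 / p i) * real r powr (1 / p h)"
    proof -
      have "(\<Prod>g\<in>I-{h}. lp_norm (p g) (?y g)) = lp_norm (p i) ?v * (\<Prod>g\<in>I-{h}-{i}. lp_norm (p g) (?y g))"
        using i j fin by (subst prod.remove[of _ i]) auto
      moreover have "(\<Prod>g\<in>I-{h}-{i}. lp_norm (p g) (?y g)) = 1" by (intro prod.neutral) (auto simp: unit_tuple_norm)
      ultimately show ?thesis unfolding wt_upd[OF j(1)] by (simp add: v w mult.commute)
    qed
    finally have bd: "norm ?S \<le> ?B" unfolding mult.left_commute[of C K] .
    have "?S = (\<Sum>k'<r. \<Sum>l'<r. (\<epsilon> k' * \<delta> l' * M k' l') *\<^sub>R (\<Sum>l<r. \<Sum>k<r. (\<epsilon> k * \<delta> l) *\<^sub>R entry T (?\<alpha> k l) (?\<beta> k' l')))"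
      unfolding coordT sum.cartesian_product' by (simp only: scaleR_conv_of_real fst_conv snd_conv)
    also have "\<dots> = (\<Sum>k'<r. \<Sum>l'<r. \<Sum>l<r. \<Sum>k<r. (\<epsilon> k * \<epsilon> k') *\<^sub>R ((\<delta> l * \<delta> l') *\<^sub>R (M k' l' *\<^sub>R entry T (?\<alpha> k l) (?\<beta> k' l'))))"
      unfolding scaleR_sum_right by (intro sum.cong refl) (simp add: mult_ac)
    also have "\<dots> = (\<Sum>k'<r. \<Sum>l'<r. \<Sum>k<r. \<Sum>l<r. (\<epsilon> k * \<epsilon> k') *\<^sub>R ((\<delta> l * \<delta> l') *\<^sub>R (M k' l' *\<^sub>R entry T (?\<alpha> k l) (?\<beta> k' l'))))"
      by (intro sum.cong refl sum.swap)
    also have "\<dots> = (\<Sum>k'<r. \<Sum>k<r. \<Sum>l'<r. \<Sum>l<r. (\<epsilon> k * \<epsilon> k') *\<^sub>R ((\<delta> l * \<delta> l') *\<^sub>R (M k' l' *\<^sub>R entry T (?\<alpha> k l) (?\<beta> k' l'))))"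
      by (intro sum.cong refl sum.swap)
    also have "\<dots> = (\<Sum>k<r. \<Sum>k'<r. \<Sum>l'<r. \<Sum>l<r. (\<epsilon> k * \<epsilon> k') *\<^sub>R ((\<delta> l * \<delta> l') *\<^sub>R (M k' l' *\<^sub>R entry T (?\<alpha> k l) (?\<beta> k' l'))))"
      by (rule sum.swap)
    also have "\<dots> = (\<Sum>k<r. \<Sum>k'<r. \<Sum>l<r. \<Sum>l'<r. (\<epsilon> k * \<epsilon> k') *\<^sub>R ((\<delta> l * \<delta> l') *\<^sub>R (M k' l' *\<^sub>R entry T (?\<alpha> k l) (?\<beta> k' l'))))"
      by (intro sum.cong refl sum.swap)
    finally have eq: "?S = (\<Sum>k<r. \<Sum>k'<r. \<Sum>l<r. \<Sum>l'<r. (\<epsilon> k * \<epsilon> k') *\<^sub>R ((\<delta> l * \<delta> l') *\<^sub>R (M k' l' *\<^sub>R entry T (?\<alpha> k l) (?\<beta> k' l'))))" .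
    show ?thesis using bd unfolding eq by (simp only: scaleR_sum_right)
  qed
  let ?g = "\<lambda>\<delta> k k'. \<Sum>l<r. \<Sum>l'<r. (\<delta> l * \<delta> l') *\<^sub>R (M k' l' *\<^sub>R entry T (?\<alpha> k l) (?\<beta> k' l'))"
  \<comment> \<open>First average over the signs of coordinate \<open>i\<close>, with those of
    coordinate \<open>h\<close> fixed.\<close>
  have step: "norm (0 + (\<Sum>k<r. ?g \<delta> k k)) \<le> ?B" if \<delta>: "\<And>k. \<delta> k \<in> {1, -1 :: real}" for \<delta>
    by (rule sign_diagonal[OF finite_lessThan, where h = 0 and g = "?g \<delta>"]) (simp only: add_0_left, rule main[OF _ \<delta>])
  let ?f = "\<lambda>l l'. \<Sum>k<r. M k l' *\<^sub>R entry T (?\<alpha> k l) (?\<beta> k l')"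
  have "norm (0 + (\<Sum>l<r. ?f l l)) \<le> ?B"
  proof (rule sign_diagonal[OF finite_lessThan, where h = 0 and g = ?f])
    fix \<delta> :: "nat \<Rightarrow> real" assume \<delta>: "\<And>k. \<delta> k \<in> {1, -1}"
    have "(\<Sum>k<r. ?g \<delta> k k) = (\<Sum>l<r. \<Sum>k<r. \<Sum>l'<r. (\<delta> l * \<delta> l') *\<^sub>R (M k l' *\<^sub>R entry T (?\<alpha> k l) (?\<beta> k l')))"
      by (rule sum.swap)
    also have "\<dots> = (\<Sum>l<r. \<Sum>l'<r. \<Sum>k<r. (\<delta> l * \<delta> l') *\<^sub>R (M k l' *\<^sub>R entry T (?\<alpha> k l) (?\<beta> k l')))"
      by (intro sum.cong refl sum.swap)
    finally show "norm (0 + (\<Sum>l<r. \<Sum>l'<r. (\<delta> l * \<delta> l') *\<^sub>R ?f l l')) \<le> ?B"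
      using step[of \<delta>, OF \<delta>] by (simp only: scaleR_sum_right)
  qed
  moreover have "(\<Sum>l<r. ?f l l) = (\<Sum>k<r. \<Sum>l<r. M k l *\<^sub>R entry T (?\<alpha> k l) (?\<beta> k l))" by (rule sum.swap)
  ultimately show "norm (\<Sum>k<r. \<Sum>l<r. M k l *\<^sub>R entry T (?\<alpha> k l) (?\<beta> k l)) \<le> ?B" by simp
qed

end

text \<open>The order on \<open>I\<close> fixes the sequence in which \<open>limit_family\<close>
  takes its limits.\<close>

locale lp_tensor_dual = lp_tensor smul I p X j
  for smul :: "'k::{real_normed_field, heine_borel} \<Rightarrow> 'x::banach \<Rightarrow> 'x" and I :: "'i::linorder set"
    and p :: "'i \<Rightarrow> real" and X :: "'x set" and j +
  assumes dual: "\<And>i h. i \<in> I \<Longrightarrow> h \<in> I \<Longrightarrow> i \<noteq> h \<Longrightarrow> 1 / p i + 1 / p h \<le> 1"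
begin

lemma good_entry:
  assumes T: "bop K T" shows "good p K I (entry T)"
  unfolding good_def
proof (intro conjI allI impI ballI)
  fix \<alpha> \<beta>
  have "norm (entry T \<alpha> \<beta>) \<le> norm (T (basis \<alpha>))" unfolding entry_def by (rule coord(2)[OF bopD(2)[OF T basis_X]])
  also have "\<dots> \<le> K * norm (basis \<alpha>)" by (rule bopD(4)[OF T basis_X])
  also have "\<dots> \<le> K * 1" by (intro mult_left_mono norm_basis bopD(1)[OF T])
  finally show "norm (entry T \<alpha> \<beta>) \<le> K" by simp
next
  fix \<alpha> \<alpha>' \<beta> \<beta>' :: "'i \<Rightarrow> nat" assume "\<forall>i\<in>I. \<alpha> i = \<alpha>' i \<and> \<beta> i = \<beta>' i"
  then show "entry T \<alpha> \<beta> = entry T \<alpha>' \<beta>'" unfolding entry_def using basis_cong[of \<alpha> \<alpha>'] coord_cong[of \<beta> \<beta>'] by simp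
qed (use entry_row[OF T] entry_col[OF T] entry_multiplier[OF T] in auto)

lemma limits_exist:
  assumes T: "bop K T" shows "\<exists>L. diagonal_limits I p K L \<and> L I = entry T"
proof -
  from limit_family[OF good_entry[OF T] fin bopD(1)[OF T] p1 dual]
  obtain L where L: "L I = entry T \<and> (\<forall>S\<subseteq>I. good p K S (L S)) \<and> (\<forall>S\<subseteq>I. \<forall>i\<in>S. L (S - {i}) = diag_lim i (L S))"
    by (rule exE)
  have "diagonal_limits I p K L"
  proof
    show "good p K S (L S)" if "S \<subseteq> I" for S using L that by blast
    show "L (S - {i}) = diag_lim i (L S)" if "S \<subseteq> I" "i \<in> S" for S i using L that by blast
  qed (use fin p1 in auto)
  with L show ?thesis by blast
qed

end

section \<open>Coordinate truncations\<close>

definition merge :: "'a set \<Rightarrow> ('a \<Rightarrow> 'b) \<Rightarrow> ('a \<Rightarrow> 'b) \<Rightarrow> 'a \<Rightarrow> 'b" where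
  "merge S b c = (\<lambda>i. if i \<in> S then b i else c i)"

lemma sum_merge:
  assumes "S \<subseteq> I"
  shows "(\<Sum>\<beta>\<in>Pi\<^sub>E I G. \<phi> \<beta>) = (\<Sum>b\<in>Pi\<^sub>E S G. \<Sum>c\<in>Pi\<^sub>E (I - S) G. \<phi> (merge S b c))"
  unfolding sum.cartesian_product
proof (rule sum.reindex_bij_witness[of _ "\<lambda>(b, c). merge S b c" "\<lambda>\<beta>. (restrict \<beta> S, restrict \<beta> (I - S))"])
  fix \<beta> assume \<beta>: "\<beta> \<in> Pi\<^sub>E I G"
  have "merge S (restrict \<beta> S) (restrict \<beta> (I - S)) i = \<beta> i" for i
    using PiE_arb[OF \<beta>, of i] assms by (cases "i \<in> I") (auto simp: merge_def)
  then have eq: "merge S (restrict \<beta> S) (restrict \<beta> (I - S)) = \<beta>" by (rule ext)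
  show "(case (restrict \<beta> S, restrict \<beta> (I - S)) of (b, c) \<Rightarrow> merge S b c) = \<beta>"
    unfolding prod.case by (rule eq)
  show "(case (restrict \<beta> S, restrict \<beta> (I - S)) of (b, c) \<Rightarrow> \<phi> (merge S b c)) = \<phi> \<beta>"
    unfolding prod.case eq ..
  show "(restrict \<beta> S, restrict \<beta> (I - S)) \<in> Pi\<^sub>E S G \<times> Pi\<^sub>E (I - S) G" using \<beta> assms by auto
next
  fix z assume "z \<in> Pi\<^sub>E S G \<times> Pi\<^sub>E (I - S) G"
  then obtain b c where z: "z = (b, c)" "b \<in> Pi\<^sub>E S G" "c \<in> Pi\<^sub>E (I - S) G" by blast
  have "restrict (merge S b c) S i = b i" "restrict (merge S b c) (I - S) i = c i" for i
    using PiE_arb[OF z(2), of i] PiE_arb[OF z(3), of i] by (auto simp: merge_def restrict_def)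
  then have "restrict (merge S b c) S = b" "restrict (merge S b c) (I - S) = c" by blast+
  then show "(restrict (case z of (b, c) \<Rightarrow> merge S b c) S, restrict (case z of (b, c) \<Rightarrow> merge S b c) (I - S)) = z"
    unfolding z(1) prod.case by simp
  show "(case z of (b, c) \<Rightarrow> merge S b c) \<in> Pi\<^sub>E I G"
    using z assms by (auto simp: merge_def PiE_iff extensional_def)
qed

lemma push_unit_vec: "inj a \<Longrightarrow> push a (unit_vec n) = (unit_vec (a n) :: nat \<Rightarrow> 'k::zero_neq_one)"
  by (auto simp: push_def unit_vec_def fun_eq_iff inj_eq)

context lp_tensor
begin

definition cut :: "nat \<Rightarrow> 'x \<Rightarrow> 'x" where "cut n = tens (\<lambda>i. trunc n)"

lemma bop_cut: "bop 1 (cut n)"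
  unfolding cut_def by (rule tens(1)[OF contractions_trunc])

abbreviation "tuples n \<equiv> Pi\<^sub>E I (\<lambda>_. {..<n::nat})"

lemma finite_tuples: "finite (tuples n)" by (intro finite_PiE fin) simp

lemma trunc_sum: "trunc n x = (\<Sum>m<n. pointwise_scale (x m) (unit_vec m :: nat \<Rightarrow> 'k))"
proof
  fix k
  have "(\<Sum>m<n. x m * unit_vec m k) = (\<Sum>m<n. if k = m then x k else 0)"
    by (intro sum.cong) (auto simp: unit_vec_def)
  then show "trunc n x k = (\<Sum>m<n. pointwise_scale (x m) (unit_vec m)) k"
    by (simp add: trunc_def sum_fun_apply pointwise_scale_def)
qed

lemma cut_tau:
  assumes x: "x \<in> PE"
  shows "cut n (tau x) = (\<Sum>\<beta>\<in>tuples n. smul (coord_form \<beta> x) (basis \<beta>))"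
proof -
  have E: "pointwise_scale c (unit_vec k) \<in> lp (p i)" if "i \<in> I" for i c k
    by (intro lp_scale(1) unit_vec_lp p0 that)
  have "cut n (tau x) = tau (\<lambda>i\<in>I. trunc n (x i))" unfolding cut_def by (rule tens(2)[OF contractions_trunc x])
  also have "\<dots> = tau (\<lambda>i\<in>I. \<Sum>k<n. pointwise_scale (x i k) (unit_vec k))" by (simp add: trunc_sum cong: restrict_cong)
  also have "\<dots> = (\<Sum>\<beta>\<in>tuples n. tau (\<lambda>i\<in>I. pointwise_scale (x i (\<beta> i)) (unit_vec (\<beta> i))))"
    by (rule multilinear_expand[OF tau_multilinear]) (auto intro: E)
  also have "\<dots> = (\<Sum>\<beta>\<in>tuples n. smul (coord_form \<beta> x) (basis \<beta>))"
  proof (rule sum.cong[OF refl])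
    fix \<beta>
    have "(\<lambda>i\<in>I. pointwise_scale (x i (\<beta> i)) (unit_vec (\<beta> i))) = (\<lambda>i\<in>I. pointwise_scale (x i (\<beta> i)) (unit_tuple \<beta> i))"
      by (auto simp: unit_tuple_def)
    then show "tau (\<lambda>i\<in>I. pointwise_scale (x i (\<beta> i)) (unit_vec (\<beta> i))) = smul (coord_form \<beta> x) (basis \<beta>)"
      using multilinear_scale[OF tau_multilinear vs_smul unit_tuple_PE, of "\<lambda>i. x i (\<beta> i)" \<beta>] by (simp add: coord_form_def basis_def)
  qed
  finally show ?thesis .
qed

text \<open>Both sides are bounded operators of \<open>u\<close>, so elementary tensors
  suffice.\<close>

lemma cut_expand:
  assumes u: "u \<in> X"
  shows "cut n u = (\<Sum>\<beta>\<in>tuples n. smul (coord \<beta> u) (basis \<beta>))"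
proof (rule bop_unique[OF bop_cut _ _ u, where T = "\<lambda>u. \<Sum>\<beta>\<in>tuples n. smul (coord \<beta> u) (basis \<beta>)"])
  have "bop 1 (\<lambda>u. smul (coord \<beta> u) (basis \<beta>))" for \<beta>
  proof (rule bopI)
    fix u assume u: "u \<in> X"
    have "norm (coord \<beta> u) * norm (basis \<beta>) \<le> norm u * 1" using coord(2)[OF u] norm_basis by (intro mult_mono) auto
    then show "norm (smul (coord \<beta> u) (basis \<beta>)) \<le> 1 * norm u" by (simp add: norm_smul)
  qed (auto simp: X_closed basis_X coord_arith scale_left_distrib)
  then show "bop (\<Sum>\<beta>\<in>tuples n. 1) (\<lambda>u. \<Sum>\<beta>\<in>tuples n. smul (coord \<beta> u) (basis \<beta>))" by (rule bop_sum)
  show "cut n (tau x) = (\<Sum>\<beta>\<in>tuples n. smul (coord \<beta> (tau x)) (basis \<beta>))" if "x \<in> PE" for x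
    unfolding cut_tau[OF that] coord(3)[OF that] ..
qed

text \<open>One factor is truncated at a time. Each step changes the tensor by one having the tail
  of that factor in its place, while the other norms stay bounded.\<close>

lemma cut_tendsto_tau:
  assumes x: "x \<in> PE"
  shows "(\<lambda>n. cut n (tau x)) \<longlonglongrightarrow> tau x"
proof -
  have xi: "x i \<in> lp (p i)" if "i \<in> I" for i using x that by auto
  have "(\<lambda>n. tau (\<lambda>i\<in>I. if i \<in> J then trunc n (x i) else x i)) \<longlonglongrightarrow> tau x" if "J \<subseteq> I" for J
    using finite_subset[OF that fin] that
  proof (induction J)
    case empty
    have "restrict x I = x" using x by auto
    then show ?case by simp
  next
    case (insert h J)
    have h: "h \<in> I" "h \<notin> J" using insert by auto
    let ?y = "\<lambda>n. \<lambda>i\<in>I. if i \<in> J then trunc n (x i) else x i"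
    have y: "?y n \<in> PE" for n using xi trunc_lp(1)[OF xi p0] by auto
    have mem: "x h - trunc n (x h) \<in> lp (p h)" "trunc n (x h) \<in> lp (p h)" for n
      using ptw.subspace_diff[OF lp_subspace[OF p0[OF h(1)]] xi[OF h(1)]] trunc_lp(1)[OF xi[OF h(1)] p0[OF h(1)]] by auto
    have ins: "(\<lambda>i\<in>I. if i \<in> insert h J then trunc n (x i) else x i) = (?y n)(h := trunc n (x h))" for n
      using h by auto
    have yh: "(?y n)(h := x h) = ?y n" for n using h by auto
    have td: "trunc n (x h) + (x h - trunc n (x h)) = x h" for n
      by (simp only: add_diff_eq add_diff_cancel_left')
    have diff: "tau (\<lambda>i\<in>I. if i \<in> insert h J then trunc n (x i) else x i) =
        tau (?y n) - tau ((?y n)(h := x h - trunc n (x h)))" for n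
      using multilinear_mapD(1)[OF tau_multilinear y h(1) mem(2) mem(1), of n n n]
      unfolding td yh ins eq_diff_eq by (rule sym)
    have "(\<lambda>n. tau ((?y n)(h := x h - trunc n (x h)))) \<longlonglongrightarrow> 0"
    proof (rule Lim_null_comparison)
      show "\<forall>\<^sub>F n in sequentially. norm (tau ((?y n)(h := x h - trunc n (x h)))) \<le>
        lp_norm (p h) (x h - trunc n (x h)) * (\<Prod>i\<in>I-{h}. lp_norm (p i) (x i))"
      proof (intro always_eventually allI)
        fix n
        have "norm (tau ((?y n)(h := x h - trunc n (x h)))) \<le> wt ((?y n)(h := x h - trunc n (x h)))"
          by (intro norm_tau_le PiE_upd y h mem)
        also have "\<dots> \<le> lp_norm (p h) (x h - trunc n (x h)) * (\<Prod>i\<in>I-{h}. lp_norm (p i) (x i))"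
          unfolding wt_upd[OF h(1)]
          by (intro mult_left_mono prod_mono) (auto simp: lp_norm_nonneg intro: trunc_lp xi p0)
        finally show "norm (tau ((?y n)(h := x h - trunc n (x h)))) \<le> lp_norm (p h) (x h - trunc n (x h)) * (\<Prod>i\<in>I-{h}. lp_norm (p i) (x i))" .
      qed
      show "(\<lambda>n. lp_norm (p h) (x h - trunc n (x h)) * (\<Prod>i\<in>I-{h}. lp_norm (p i) (x i))) \<longlonglongrightarrow> 0"
        by (intro tendsto_mult_left_zero trunc_tendsto xi p0 h)
    qed
    from tendsto_diff[OF _ this, of "\<lambda>n. tau (?y n)" "tau x"] insert show ?case
      unfolding diff by (simp add: restrict_def)
  qed
  from this[OF order_refl] have "(\<lambda>n. tau (\<lambda>i\<in>I. trunc n (x i))) \<longlonglongrightarrow> tau x" by (simp cong: restrict_cong)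
  then show ?thesis by (simp add: cut_def tens(2)[OF contractions_trunc x])
qed

lemma cut_tendsto:
  assumes u: "u \<in> X" shows "(\<lambda>n. cut n u) \<longlonglongrightarrow> u"
proof -
  have conv: "convergent (\<lambda>n. cut n u)" if "u \<in> X" for u
    by (rule strong_convergence[OF bop_cut _ that]) (use cut_tendsto_tau in \<open>auto simp: convergent_def\<close>)
  then have lim: "(\<lambda>n. cut n u) \<longlonglongrightarrow> lim (\<lambda>n. cut n u)" if "u \<in> X" for u using that by (simp add: convergent_LIMSEQ_iff)
  have "bop 1 (\<lambda>u. lim (\<lambda>n. cut n u))" by (rule bop_limit[OF bop_cut lim])
  then have "lim (\<lambda>n. cut n u) = u"
    by (rule bop_unique[OF _ bop_id _ u, where S = "\<lambda>u. lim (\<lambda>n. cut n u)"]) (use limI cut_tendsto_tau in blast)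
  with lim[OF u] show ?thesis by simp
qed

text \<open>Compressing an operator along the injections \<open>a i\<close> merely reindexes its
  entries.\<close>

lemma compression_entry:
  fixes a :: "'i \<Rightarrow> nat \<Rightarrow> nat"
  assumes a: "\<And>i. i \<in> I \<Longrightarrow> inj (a i)"
  shows "tens (\<lambda>i. push (a i)) (basis \<alpha>) = basis (\<lambda>i. a i (\<alpha> i))"
    "u \<in> X \<Longrightarrow> coord \<beta> (tens (\<lambda>i. pull (a i)) u) = coord (\<lambda>i. a i (\<beta> i)) u"
proof -
  have "(\<lambda>i\<in>I. push (a i) (unit_tuple \<alpha> i)) = unit_tuple (\<lambda>i. a i (\<alpha> i))"
    unfolding unit_tuple_def by (intro restrict_ext) (simp add: push_unit_vec a)
  then show "tens (\<lambda>i. push (a i)) (basis \<alpha>) = basis (\<lambda>i. a i (\<alpha> i))"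
    using tens(2)[OF contractions_push[OF a] unit_tuple_PE[of \<alpha>]] by (simp add: basis_def)
  let ?Q = "tens (\<lambda>i. pull (a i))"
  have c: "contractions (\<lambda>i. pull (a i))" by (rule contractions_pull) (rule a)
  note Q = tens[OF c]
  show "coord \<beta> (?Q u) = coord (\<lambda>i. a i (\<beta> i)) u" if u: "u \<in> X"
  proof (rule lin_unique[OF _ _ coord(1) _ _ u, where F = "\<lambda>u. coord \<beta> (?Q u)"])
    show "linear_on smul (*) X (\<lambda>u. coord \<beta> (?Q u))"
      using coord_arith bopD(2)[OF Q(1)] by (simp add: linear_on_def bop_arith[OF Q(1)])
    show "norm (coord \<beta> (?Q u)) \<le> 1 * norm u" if "u \<in> X" for u
      using coord(2)[OF bopD(2)[OF Q(1) that], where \<beta> = \<beta>] bopD(4)[OF Q(1) that] by simp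
    show "norm (coord (\<lambda>i. a i (\<beta> i)) u) \<le> 1 * norm u" if "u \<in> X" for u using coord(2)[OF that] by simp
    fix x assume x: "x \<in> PE"
    have "coord_form \<beta> (\<lambda>i\<in>I. pull (a i) (x i)) = coord_form (\<lambda>i. a i (\<beta> i)) x"
      unfolding coord_form_def by (intro prod.cong) (auto simp: pull_def)
    then show "coord \<beta> (?Q (tau x)) = coord (\<lambda>i. a i (\<beta> i)) (tau x)"
      by (simp add: Q(2)[OF x] coord(3)[OF x] coord(3)[OF contractions_PE[OF c x]])
  qed
qed

text \<open>The operator 1 tensor M is a sum of pieces, one for each pair of multi-indices a, b on
  \<open>S\<close>: a matrix unit on the coordinates in \<open>S\<close>, the identity on the
  others. Each piece is a contraction up to the factor \<open>M a b\<close>, so the absolute sum of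
  the entries is a bound.\<close>

lemma block_operator_bound:
  assumes x: "x \<in> PE" and S: "S \<subseteq> I"
    and M: "\<And>\<alpha> \<alpha>' \<beta> \<beta>'. (\<And>i. i \<in> S \<Longrightarrow> \<alpha> i = \<alpha>' i) \<Longrightarrow> (\<And>i. i \<in> S \<Longrightarrow> \<beta> i = \<beta>' i) \<Longrightarrow> M \<alpha> \<beta> = M \<alpha>' \<beta>'"
  shows "norm (\<Sum>\<beta>\<in>tuples n. \<Sum>\<alpha>\<in>tuples n. smul (coord_form \<alpha> x * (if \<forall>i\<in>I - S. \<alpha> i = \<beta> i then M \<alpha> \<beta> else 0)) (basis \<beta>))
    \<le> (\<Sum>a\<in>Pi\<^sub>E S (\<lambda>_. {..<n}). \<Sum>b\<in>Pi\<^sub>E S (\<lambda>_. {..<n}). norm (M a b)) * wt x"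
proof -
  let ?B = "Pi\<^sub>E S (\<lambda>_. {..<n})" and ?C = "Pi\<^sub>E (I - S) (\<lambda>_. {..<n})"
  have fS: "finite S" using S fin finite_subset by blast
  have fC: "finite ?C" by (intro finite_PiE finite_Diff fin) simp
  have fB: "finite ?B" by (intro finite_PiE fS) simp
  define A where "A a = (\<Prod>i\<in>S. x i (a i))" for a
  define R where "R c = (\<Prod>i\<in>I-S. x i (c i))" for c
  define V where "V b = (\<Sum>c\<in>?C. smul (R c) (basis (merge S b c)))" for b
  have split: "(\<Prod>i\<in>I. f i) = (\<Prod>i\<in>S. f i) * (\<Prod>i\<in>I-S. f i)" for f :: "'i \<Rightarrow> 'c::comm_monoid_mult"
    using prod.subset_diff[OF S fin, of f] by (simp add: mult.commute)
  have cf: "coord_form (merge S a c) y = (\<Prod>i\<in>S. y i (a i)) * (\<Prod>i\<in>I-S. y i (c i))" for a c y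
    unfolding coord_form_def split by (intro arg_cong2[where f = "(*)"] prod.cong) (auto simp: merge_def)
  have V: "norm (V b) \<le> (\<Prod>i\<in>I-S. lp_norm (p i) (x i))" if b: "b \<in> ?B" for b
  proof -
    \<comment> \<open>\<open>V b\<close> is the truncation of this tensor, which has unit vectors on
      \<open>S\<close> and the factors of \<open>x\<close> elsewhere.\<close>
    let ?y = "\<lambda>i\<in>I. if i \<in> S then unit_vec (b i) else x i"
    have y: "?y \<in> PE" using x by (auto simp: unit_vec_lp p0)
    have one: "(\<Prod>i\<in>S. ?y i (b' i)) = (if b = b' then 1 else 0)" if b': "b' \<in> ?B" for b'
    proof (cases "b = b'")
      case True
      then show ?thesis using S by (auto simp: unit_vec_def intro!: prod.neutral)
    next
      case False
      then obtain i where "i \<in> S" "b i \<noteq> b' i" using PiE_ext[OF b b'] by blast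
      then show ?thesis using False fS S by (auto simp: unit_vec_def prod_zero_iff intro!: bexI[of _ i])
    qed
    have rest: "(\<Prod>i\<in>I-S. ?y i (c i)) = R c" for c unfolding R_def by (intro prod.cong) auto
    have "cut n (tau ?y) = (\<Sum>b'\<in>?B. \<Sum>c\<in>?C. smul (coord_form (merge S b' c) ?y) (basis (merge S b' c)))"
      unfolding cut_tau[OF y] by (rule sum_merge[OF S])
    also have "\<dots> = (\<Sum>b'\<in>?B. if b = b' then V b' else 0)"
    proof (intro sum.cong refl)
      fix b' assume b': "b' \<in> ?B"
      show "(\<Sum>c\<in>?C. smul (coord_form (merge S b' c) ?y) (basis (merge S b' c))) = (if b = b' then V b' else 0)"
        unfolding cf rest one[OF b'] V_def by simp
    qed
    also have "\<dots> = V b" using b fB by simp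
    finally have "norm (V b) \<le> wt ?y"
      using bopD(4)[OF bop_cut tau_in_X[OF y], of n] norm_tau_le[OF y] by simp
    also have "wt ?y = (\<Prod>i\<in>I-S. lp_norm (p i) (x i))"
    proof -
      have "(\<Prod>i\<in>S. lp_norm (p i) (?y i)) = 1" using S by (intro prod.neutral) (auto simp: unit_vec_lp p0)
      moreover have "(\<Prod>i\<in>I-S. lp_norm (p i) (?y i)) = (\<Prod>i\<in>I-S. lp_norm (p i) (x i))" by (intro prod.cong) auto
      ultimately show ?thesis unfolding wt_def split by simp
    qed
    finally show ?thesis .
  qed
  have "(\<Sum>\<beta>\<in>tuples n. \<Sum>\<alpha>\<in>tuples n. smul (coord_form \<alpha> x * (if \<forall>i\<in>I - S. \<alpha> i = \<beta> i then M \<alpha> \<beta> else 0)) (basis \<beta>)) =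
      (\<Sum>b\<in>?B. \<Sum>c\<in>?C. \<Sum>a\<in>?B. \<Sum>c'\<in>?C. smul (coord_form (merge S a c') x *
        (if \<forall>i\<in>I - S. merge S a c' i = merge S b c i then M (merge S a c') (merge S b c) else 0)) (basis (merge S b c)))"
    unfolding sum_merge[OF S, of _ "\<lambda>_. {..<n}"] ..
  also have "\<dots> = (\<Sum>b\<in>?B. \<Sum>c\<in>?C. \<Sum>a\<in>?B. smul (A a * M a b) (smul (R c) (basis (merge S b c))))"
  proof (intro sum.cong refl)
    fix b c a assume c: "c \<in> ?C"
    have "(\<Sum>c'\<in>?C. smul (coord_form (merge S a c') x *
        (if \<forall>i\<in>I - S. merge S a c' i = merge S b c i then M (merge S a c') (merge S b c) else 0)) (basis (merge S b c))) =
      (\<Sum>c'\<in>?C. if c = c' then smul (A a * M a b) (smul (R c) (basis (merge S b c))) else 0)"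
    proof (intro sum.cong refl)
      fix c' assume c': "c' \<in> ?C"
      have eq: "(\<forall>i\<in>I - S. merge S a c' i = merge S b c i) \<longleftrightarrow> c = c'"
        using PiE_ext[OF c c'] by (auto simp: merge_def)
      have "M (merge S a c') (merge S b c) = M a b" by (rule M) (auto simp: merge_def)
      then show "smul (coord_form (merge S a c') x *
        (if \<forall>i\<in>I - S. merge S a c' i = merge S b c i then M (merge S a c') (merge S b c) else 0)) (basis (merge S b c)) =
        (if c = c' then smul (A a * M a b) (smul (R c) (basis (merge S b c))) else 0)"
        unfolding eq cf by (auto simp: A_def R_def mult_ac)
    qed
    then show "(\<Sum>c'\<in>?C. smul (coord_form (merge S a c') x *
        (if \<forall>i\<in>I - S. merge S a c' i = merge S b c i then M (merge S a c') (merge S b c) else 0)) (basis (merge S b c))) =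
      smul (A a * M a b) (smul (R c) (basis (merge S b c)))" using c fC by simp
  qed
  also have "\<dots> = (\<Sum>b\<in>?B. \<Sum>a\<in>?B. \<Sum>c\<in>?C. smul (A a * M a b) (smul (R c) (basis (merge S b c))))"
    by (intro sum.cong refl sum.swap)
  also have "\<dots> = (\<Sum>b\<in>?B. \<Sum>a\<in>?B. smul (A a * M a b) (V b))"
    unfolding V_def scale_sum_right ..
  also have "\<dots> = (\<Sum>a\<in>?B. \<Sum>b\<in>?B. smul (A a * M a b) (V b))" by (rule sum.swap)
  finally have eq: "(\<Sum>\<beta>\<in>tuples n. \<Sum>\<alpha>\<in>tuples n. smul (coord_form \<alpha> x * (if \<forall>i\<in>I - S. \<alpha> i = \<beta> i then M \<alpha> \<beta> else 0)) (basis \<beta>)) =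
    (\<Sum>a\<in>?B. \<Sum>b\<in>?B. smul (A a * M a b) (V b))" .
  have "norm (\<Sum>a\<in>?B. \<Sum>b\<in>?B. smul (A a * M a b) (V b)) \<le> (\<Sum>a\<in>?B. \<Sum>b\<in>?B. norm (M a b) * wt x)"
  proof (intro sum_norm_le)
    fix a b assume "b \<in> ?B"
    have "norm (A a) \<le> (\<Prod>i\<in>S. lp_norm (p i) (x i))"
      unfolding A_def prod_norm[symmetric] using x S by (auto intro!: prod_mono norm_le_lp_norm p0)
    then have "norm (A a) * norm (V b) \<le> wt x"
      unfolding wt_def split using V[OF \<open>b \<in> ?B\<close>] by (intro mult_mono) (auto simp: lp_norm_nonneg intro: prod_nonneg)
    then have "norm (M a b) * (norm (A a) * norm (V b)) \<le> norm (M a b) * wt x" by (rule mult_left_mono) simp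
    then show "norm (smul (A a * M a b) (V b)) \<le> norm (M a b) * wt x"
      by (simp add: norm_smul norm_mult mult_ac)
  qed
  then show ?thesis unfolding eq by (simp add: sum_distrib_right)
qed

end

section \<open>Primarity\<close>

context lp_tensor_dual
begin

text \<open>The estimate is proved first for elementary tensors cut off at n, where everything is a
  finite sum over \<open>tuples n\<close>. Letting n tend to infinity and applying
  \<open>bop_bound\<close> extends it to \<open>X\<close>.\<close>

theorem compression_to_scalar:
  assumes T: "bop K T" and e: "0 < e"
  shows "\<exists>J Q \<mu>. bounded_op J \<and> bounded_op Q \<and> (\<forall>u\<in>X. Q (J u) = u) \<and>
    (\<forall>u\<in>X. norm (Q (T (J u)) - smul \<mu> u) \<le> e * norm u)"
proof -
  obtain L where "diagonal_limits I p K L" and LI: "L I = entry T" using limits_exist[OF T] by blast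
  interpret dl: diagonal_limits I p K L by fact
  obtain a :: "'i \<Rightarrow> nat \<Rightarrow> nat" where a: "\<And>i. i \<in> I \<Longrightarrow> inj (a i)"
    and tot: "\<And>n. dl.total (\<lambda>i. if i \<in> I then a i ` {..<n} else {}) \<le> e"
    using dl.selection[OF e] by blast
  define ix where "ix \<gamma> = (\<lambda>i. a i (\<gamma> i))" for \<gamma> :: "'i \<Rightarrow> nat"
  define J where "J = tens (\<lambda>i. push (a i))"
  define Q where "Q = tens (\<lambda>i. pull (a i))"
  have cpush: "contractions (\<lambda>i. push (a i))" by (rule contractions_push) (rule a)
  have cpull: "contractions (\<lambda>i. pull (a i))" by (rule contractions_pull) (rule a)
  have J: "bop 1 J" unfolding J_def by (rule tens(1)[OF cpush])
  have Q: "bop 1 Q" unfolding Q_def by (rule tens(1)[OF cpull])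
  have QJ: "Q (J u) = u" if u: "u \<in> X" for u
  proof (rule bop_unique[OF bop_comp[OF Q J] bop_id _ u])
    fix x assume x: "x \<in> PE"
    have "(\<lambda>i\<in>I. pull (a i) ((\<lambda>i\<in>I. push (a i) (x i)) i)) = x"
    proof
      fix i show "(\<lambda>i\<in>I. pull (a i) ((\<lambda>i\<in>I. push (a i) (x i)) i)) i = x i"
        using PiE_arb[OF x, of i] by (cases "i \<in> I") (simp_all add: pull_push[OF a])
    qed
    then show "Q (J (tau x)) = tau x"
      unfolding Q_def J_def by (simp only: tens(2)[OF cpush x] tens(2)[OF cpull contractions_PE[OF cpush x]])
  qed
  define R where "R u = Q (T (J u))" for u
  \<comment> \<open>With no coordinate left, the limit is a constant; the arguments are
    arbitrary.\<close>
  define \<mu> where "\<mu> = L {} (\<lambda>_. 0) (\<lambda>_. 0)"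
  have R: "bop (1 * (K * 1)) R" unfolding R_def[abs_def] by (intro bop_comp Q T J)
  have RX: "R (basis \<alpha>) \<in> X" for \<alpha> by (rule bopD(2)[OF R basis_X])
  have entR: "coord \<beta> (R (basis \<alpha>)) = entry T (ix \<alpha>) (ix \<beta>)" for \<alpha> \<beta>
    unfolding R_def entry_def Q_def J_def ix_def
    by (simp add: compression_entry(1)[OF a] compression_entry(2)[OF a] bopD(2)[OF T] basis_X)
  have m0: "dl.moebius {} \<alpha> \<beta> = \<mu>" for \<alpha> \<beta>
    unfolding \<mu>_def dl.moebius_def using goodD(2)[OF dl.good_L[of "{}"], of \<alpha> "\<lambda>_. 0" \<beta> "\<lambda>_. 0"] by simp
  let ?M = "\<lambda>S \<alpha> \<beta>. dl.moebius S (ix \<alpha>) (ix \<beta>)"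
  let ?P = "Pow I - {{}}"
  \<comment> \<open>The summand for the empty set is \<mu> on the diagonal, and removing it leaves
    the small part.\<close>
  have decomp: "entry T (ix \<alpha>) (ix \<beta>) - (if \<alpha> = \<beta> then \<mu> else 0) =
      (\<Sum>S\<in>?P. if \<forall>i\<in>I - S. \<alpha> i = \<beta> i then ?M S \<alpha> \<beta> else 0)"
    if "\<alpha> \<in> tuples n" "\<beta> \<in> tuples n" for \<alpha> \<beta> n
  proof -
    have ix_eq: "(\<forall>i\<in>I - S. ix \<alpha> i = ix \<beta> i) \<longleftrightarrow> (\<forall>i\<in>I - S. \<alpha> i = \<beta> i)" for S
      unfolding ix_def using a by (auto dest: injD)
    have all: "(\<forall>i\<in>I - {}. \<alpha> i = \<beta> i) \<longleftrightarrow> \<alpha> = \<beta>" using PiE_ext[OF that] by auto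
    have "entry T (ix \<alpha>) (ix \<beta>) = (\<Sum>S\<in>Pow I. if \<forall>i\<in>I - S. \<alpha> i = \<beta> i then ?M S \<alpha> \<beta> else 0)"
      using dl.moebius_sum[of "ix \<alpha>" "ix \<beta>"] unfolding LI ix_eq by (rule sym)
    also have "\<dots> = (if \<alpha> = \<beta> then \<mu> else 0) + (\<Sum>S\<in>?P. if \<forall>i\<in>I - S. \<alpha> i = \<beta> i then ?M S \<alpha> \<beta> else 0)"
      using sum.remove[of "Pow I" "{}" "\<lambda>S. if \<forall>i\<in>I - S. \<alpha> i = \<beta> i then ?M S \<alpha> \<beta> else 0"] fin
      unfolding all m0 by simp
    finally show ?thesis by simp
  qed
  have total_le: "(\<Sum>S\<in>?P. \<Sum>c\<in>Pi\<^sub>E S (\<lambda>_. {..<n}). \<Sum>b\<in>Pi\<^sub>E S (\<lambda>_. {..<n}). norm (?M S c b)) \<le> e" for n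
  proof -
    let ?G = "\<lambda>i. if i \<in> I then a i ` {..<n} else {}"
    have "(\<Sum>c\<in>Pi\<^sub>E S (\<lambda>_. {..<n}). \<Sum>b\<in>Pi\<^sub>E S (\<lambda>_. {..<n}). norm (?M S c b)) =
        (\<Sum>c\<in>Pi\<^sub>E S ?G. \<Sum>b\<in>Pi\<^sub>E S ?G. norm (dl.moebius S c b))" if S: "S \<in> ?P" for S
    proof -
      have SI: "i \<in> I" if "i \<in> S" for i using S that by auto
      let ?r = "\<lambda>c. restrict (ix c) S"
      have bij: "bij_betw ?r (Pi\<^sub>E S (\<lambda>_. {..<n})) (Pi\<^sub>E S ?G)"
      proof (rule bij_betwI[where g = "\<lambda>c. \<lambda>i\<in>S. inv (a i) (c i)"])
        show "?r \<in> Pi\<^sub>E S (\<lambda>_. {..<n}) \<rightarrow> Pi\<^sub>E S ?G" by (auto simp: ix_def SI PiE_iff)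
        show "(\<lambda>c. \<lambda>i\<in>S. inv (a i) (c i)) \<in> Pi\<^sub>E S ?G \<rightarrow> Pi\<^sub>E S (\<lambda>_. {..<n})"
        proof
          fix c assume c: "c \<in> Pi\<^sub>E S ?G"
          have "inv (a i) (c i) < n" if "i \<in> S" for i
          proof -
            have "c i \<in> a i ` {..<n}" using PiE_mem[OF c that] SI[OF that] by simp
            then show ?thesis using inv_f_f[OF a[OF SI[OF that]]] by auto
          qed
          then show "(\<lambda>i\<in>S. inv (a i) (c i)) \<in> Pi\<^sub>E S (\<lambda>_. {..<n})" by auto
        qed
        show "(\<lambda>i\<in>S. inv (a i) (?r c i)) = c" if c: "c \<in> Pi\<^sub>E S (\<lambda>_. {..<n})" for c
        proof
          fix i show "(\<lambda>i\<in>S. inv (a i) (?r c i)) i = c i"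
            using PiE_arb[OF c, of i] inv_f_f[OF a[OF SI], of i] by (cases "i \<in> S") (auto simp: ix_def)
        qed
        show "?r (\<lambda>i\<in>S. inv (a i) (c i)) = c" if c: "c \<in> Pi\<^sub>E S ?G" for c
        proof
          fix i show "?r (\<lambda>i\<in>S. inv (a i) (c i)) i = c i"
          proof (cases "i \<in> S")
            case True
            then have "c i \<in> a i ` {..<n}" using PiE_mem[OF c True] SI[OF True] by simp
            then have "a i (inv (a i) (c i)) = c i" by (intro f_inv_into_f) auto
            with True show ?thesis by (simp add: ix_def)
          next
            case False
            then show ?thesis using PiE_arb[OF c] by simp
          qed
        qed
      qed
      have "(\<Sum>c\<in>Pi\<^sub>E S ?G. \<Sum>b\<in>Pi\<^sub>E S ?G. norm (dl.moebius S c b)) =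
          (\<Sum>c\<in>Pi\<^sub>E S (\<lambda>_. {..<n}). \<Sum>b\<in>Pi\<^sub>E S (\<lambda>_. {..<n}). norm (dl.moebius S (?r c) (?r b)))"
        by (simp only: sum.reindex_bij_betw[OF bij, symmetric])
      moreover have "dl.moebius S (?r c) (?r b) = ?M S c b" for c b
        by (rule dl.moebius_cong) (use S in auto)
      ultimately show ?thesis by simp
    qed
    then have "(\<Sum>S\<in>?P. \<Sum>c\<in>Pi\<^sub>E S (\<lambda>_. {..<n}). \<Sum>b\<in>Pi\<^sub>E S (\<lambda>_. {..<n}). norm (?M S c b)) = dl.total ?G"
      unfolding dl.total_def by (rule sum.cong[OF refl])
    then show ?thesis using tot[of n] by simp
  qed
  have fd: "norm (cut n (R (cut n (tau x))) - smul \<mu> (cut n (tau x))) \<le> e * wt x" if x: "x \<in> PE" for x n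
  proof -
    let ?c = "\<lambda>\<alpha>. coord_form \<alpha> x"
    have cX: "smul (?c \<alpha>) (basis \<alpha>) \<in> X" for \<alpha> by (intro X_closed basis_X)
    have "R (cut n (tau x)) = (\<Sum>\<alpha>\<in>tuples n. smul (?c \<alpha>) (R (basis \<alpha>)))"
      unfolding cut_tau[OF x] by (simp add: bop_arith(5)[OF R cX] bop_arith(2)[OF R basis_X])
    then have "coord \<beta> (R (cut n (tau x))) = (\<Sum>\<alpha>\<in>tuples n. ?c \<alpha> * entry T (ix \<alpha>) (ix \<beta>))" for \<beta>
      by (simp add: coord_arith X_closed RX entR)
    then have 1: "cut n (R (cut n (tau x))) = (\<Sum>\<beta>\<in>tuples n. smul (\<Sum>\<alpha>\<in>tuples n. ?c \<alpha> * entry T (ix \<alpha>) (ix \<beta>)) (basis \<beta>))"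
      using cut_expand[OF bopD(2)[OF R bopD(2)[OF bop_cut tau_in_X[OF x]]]] by simp
    have "(\<Sum>\<alpha>\<in>tuples n. ?c \<alpha> * (if \<alpha> = \<beta> then \<mu> else 0)) = \<mu> * ?c \<beta>" if "\<beta> \<in> tuples n" for \<beta>
    proof -
      have "(\<Sum>\<alpha>\<in>tuples n. ?c \<alpha> * (if \<alpha> = \<beta> then \<mu> else 0)) = (\<Sum>\<alpha>\<in>tuples n. if \<beta> = \<alpha> then \<mu> * ?c \<beta> else 0)"
        by (intro sum.cong) auto
      then show ?thesis using that finite_tuples by simp
    qed
    then have 2: "smul \<mu> (cut n (tau x)) = (\<Sum>\<beta>\<in>tuples n. smul (\<Sum>\<alpha>\<in>tuples n. ?c \<alpha> * (if \<alpha> = \<beta> then \<mu> else 0)) (basis \<beta>))"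
      unfolding cut_tau[OF x] scale_sum_right scale_scale by (intro sum.cong) auto
    let ?W = "\<lambda>S \<alpha> \<beta>. smul (?c \<alpha> * (if \<forall>i\<in>I - S. \<alpha> i = \<beta> i then ?M S \<alpha> \<beta> else 0)) (basis \<beta>)"
    have "cut n (R (cut n (tau x))) - smul \<mu> (cut n (tau x)) =
        (\<Sum>\<beta>\<in>tuples n. smul (\<Sum>\<alpha>\<in>tuples n. ?c \<alpha> * (entry T (ix \<alpha>) (ix \<beta>) - (if \<alpha> = \<beta> then \<mu> else 0))) (basis \<beta>))"
      unfolding 1 2 by (simp only: sum_subtractf[symmetric] scale_left_diff_distrib[symmetric] right_diff_distrib[symmetric])
    also have "\<dots> = (\<Sum>\<beta>\<in>tuples n. \<Sum>\<alpha>\<in>tuples n. \<Sum>S\<in>?P. ?W S \<alpha> \<beta>)"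
    proof (intro sum.cong refl)
      fix \<beta> assume \<beta>: "\<beta> \<in> tuples n"
      have "(\<Sum>\<alpha>\<in>tuples n. ?c \<alpha> * (entry T (ix \<alpha>) (ix \<beta>) - (if \<alpha> = \<beta> then \<mu> else 0))) =
          (\<Sum>\<alpha>\<in>tuples n. \<Sum>S\<in>?P. ?c \<alpha> * (if \<forall>i\<in>I - S. \<alpha> i = \<beta> i then ?M S \<alpha> \<beta> else 0))"
        unfolding sum_distrib_left[symmetric] by (intro sum.cong refl arg_cong2[where f = "(*)"] decomp[OF _ \<beta>])
      then show "smul (\<Sum>\<alpha>\<in>tuples n. ?c \<alpha> * (entry T (ix \<alpha>) (ix \<beta>) - (if \<alpha> = \<beta> then \<mu> else 0))) (basis \<beta>) =
          (\<Sum>\<alpha>\<in>tuples n. \<Sum>S\<in>?P. ?W S \<alpha> \<beta>)"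
        by (simp only: scale_sum_left)
    qed
    also have "\<dots> = (\<Sum>\<beta>\<in>tuples n. \<Sum>S\<in>?P. \<Sum>\<alpha>\<in>tuples n. ?W S \<alpha> \<beta>)" by (intro sum.cong refl sum.swap)
    also have "\<dots> = (\<Sum>S\<in>?P. \<Sum>\<beta>\<in>tuples n. \<Sum>\<alpha>\<in>tuples n. ?W S \<alpha> \<beta>)" by (rule sum.swap)
    finally have eq: "cut n (R (cut n (tau x))) - smul \<mu> (cut n (tau x)) = (\<Sum>S\<in>?P. \<Sum>\<beta>\<in>tuples n. \<Sum>\<alpha>\<in>tuples n. ?W S \<alpha> \<beta>)" .
    have "norm (\<Sum>S\<in>?P. \<Sum>\<beta>\<in>tuples n. \<Sum>\<alpha>\<in>tuples n. ?W S \<alpha> \<beta>) \<le>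
        (\<Sum>S\<in>?P. (\<Sum>c\<in>Pi\<^sub>E S (\<lambda>_. {..<n}). \<Sum>b\<in>Pi\<^sub>E S (\<lambda>_. {..<n}). norm (?M S c b)) * wt x)"
    proof (intro sum_norm_le block_operator_bound x)
      show "S \<subseteq> I" if "S \<in> ?P" for S using that by auto
      show "?M S \<alpha> \<beta> = ?M S \<alpha>' \<beta>'"
        if "S \<in> ?P" "\<And>i. i \<in> S \<Longrightarrow> \<alpha> i = \<alpha>' i" "\<And>i. i \<in> S \<Longrightarrow> \<beta> i = \<beta>' i" for S \<alpha> \<alpha>' \<beta> \<beta>'
        by (rule dl.moebius_cong) (use that in \<open>auto simp: ix_def\<close>)
    qed
    also have "\<dots> = (\<Sum>S\<in>?P. \<Sum>c\<in>Pi\<^sub>E S (\<lambda>_. {..<n}). \<Sum>b\<in>Pi\<^sub>E S (\<lambda>_. {..<n}). norm (?M S c b)) * wt x"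
      by (rule sum_distrib_right[symmetric])
    also have "\<dots> \<le> e * wt x" by (intro mult_right_mono total_le wt_nonneg)
    finally show ?thesis unfolding eq .
  qed
  \<comment> \<open>A crude bound, enough for \<open>bop_bound\<close> to improve it to
    \<open>e\<close>.\<close>
  have diff: "bop (1 * (K * 1) + norm \<mu> * 1) (\<lambda>u. R u - smul \<mu> u)" by (intro bop_diff R bop_smul bop_id)
  have "norm (R (tau x) - smul \<mu> (tau x)) \<le> e * wt x" if x: "x \<in> PE" for x
  proof -
    let ?u = "tau x" and ?w = "\<lambda>n. cut n (tau x)"
    have u: "?u \<in> X" and w: "?w n \<in> X" for n using tau_in_X[OF x] bopD(2)[OF bop_cut] by auto
    have lw: "?w \<longlonglongrightarrow> ?u" by (rule cut_tendsto[OF u])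
    have "(\<lambda>n. R (?w n)) \<longlonglongrightarrow> R ?u" by (rule bop_tendsto[OF R lw w u])
    then have d0: "(\<lambda>n. norm (R (?w n) - R ?u)) \<longlonglongrightarrow> 0" by (intro tendsto_norm_zero LIM_zero)
    have "(\<lambda>n. cut n (R (?w n)) - cut n (R ?u)) \<longlonglongrightarrow> 0"
    proof (rule Lim_null_comparison[OF always_eventually d0], rule allI)
      fix n
      show "norm (cut n (R (?w n)) - cut n (R ?u)) \<le> norm (R (?w n) - R ?u)"
        using bopD(4)[OF bop_cut, of "R (?w n) - R ?u" n] bopD(2)[OF R u] bopD(2)[OF R w[of n]]
        by (simp add: bop_arith(3)[OF bop_cut] X_closed)
    qed
    from tendsto_add[OF this cut_tendsto[OF bopD(2)[OF R u]]] have "(\<lambda>n. cut n (R (?w n))) \<longlonglongrightarrow> R ?u" by simp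
    then have "(\<lambda>n. norm (cut n (R (?w n)) - smul \<mu> (?w n))) \<longlonglongrightarrow> norm (R ?u - smul \<mu> ?u)"
      by (intro tendsto_norm tendsto_diff continuous_smul lw)
    then show ?thesis by (rule Lim_bounded[where M = 0]) (use fd[OF x] in blast)
  qed
  then have "bop e (\<lambda>u. R u - smul \<mu> u)" using e by (intro bop_bound[OF diff]) auto
  from bopD(4)[OF this] show ?thesis
    using J Q QJ unfolding R_def bounded_op_def by blast
qed

lemma bounded_of_continuous:
  assumes lin: "linear_on smul smul X P" and PX: "\<And>u. u \<in> X \<Longrightarrow> P u \<in> X" and cont: "continuous_on X P"
  shows "\<exists>K. bop K P"
proof -
  note P = linear_onD[OF lin] and P0 = lin0[OF lin]
  obtain d where d: "0 < d" "\<And>u. u \<in> X \<Longrightarrow> dist u 0 < d \<Longrightarrow> dist (P u) (P 0) < 1"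
    using cont X_closed(1) unfolding continuous_on_iff by (metis zero_less_one)
  have "norm (P u) \<le> 2 / d * norm u" if u: "u \<in> X" for u
  proof (cases "u = 0")
    case False
    define r where "r = d / (2 * norm u)"
    have r: "0 < r" using False d by (simp add: r_def)
    have "norm (r *\<^sub>R u) < d" using False d(1) by (simp add: r_def)
    then have "norm (P (r *\<^sub>R u)) < 1" using d(2)[OF X_scaleR[OF u, of r]] P0 by simp
    then have "r * norm (P u) < 1" using r by (simp add: scaleR_eq P(2)[OF u] norm_smul)
    then have "norm (P u) < 1 / r" using r by (simp add: field_simps)
    also have "1 / r = 2 / d * norm u" using False d(1) by (simp add: r_def)
    finally show ?thesis by simp
  qed (simp add: P0)
  then have "bop (2 / d) P" using d(1) PX P by (intro bopI) auto
  then show ?thesis by blast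
qed

theorem primary_X: "primary smul X"
  unfolding primary_def
proof (intro allI impI)
  fix Y Z assume YZ: "topological_direct_sum smul X Y Z"
  then obtain g where g: "homeomorphism (Y \<times> Z) X (\<lambda>(y, z). y + z) g"
    and Y: "subspace Y" and Z: "subspace Z" unfolding topological_direct_sum_def by blast
  have gX: "fst (g u) \<in> Y" "snd (g u) \<in> Z" "fst (g u) + snd (g u) = u" if "u \<in> X" for u
  proof -
    have "g u \<in> Y \<times> Z" using homeomorphism_image2[OF g] that by blast
    then show "fst (g u) \<in> Y" "snd (g u) \<in> Z" by auto
    show "fst (g u) + snd (g u) = u" using homeomorphism_apply2[OF g that] by (simp add: case_prod_unfold)
  qed
  have g_add: "y + z \<in> X" "g (y + z) = (y, z)" if "y \<in> Y" "z \<in> Z" for y z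
    using homeomorphism_apply1[OF g, of "(y, z)"] homeomorphism_image1[OF g] that by force+
  \<comment> \<open>The projection onto \<open>Y\<close> along \<open>Z\<close>, continuous because
    the inverse of addition is.\<close>
  define P where "P u = fst (g u)" for u
  have YX: "y \<in> X" "P y = y" if "y \<in> Y" for y
    using g_add[OF that subspace_0[OF Z]] by (auto simp: P_def)
  have ZX: "z \<in> X" "P z = 0" if "z \<in> Z" for z
    using g_add[OF subspace_0[OF Y] that] by (auto simp: P_def)
  have PX: "P u \<in> Y" "u - P u \<in> Z" if "u \<in> X" for u
    using gX[OF that] by (auto simp: P_def) (metis add_diff_cancel_left')
  have P_sum: "P (y + z) = y" if "y \<in> Y" "z \<in> Z" for y z using g_add(2)[OF that] by (simp add: P_def)
  have lin: "linear_on smul smul X P" unfolding linear_on_def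
  proof (intro conjI ballI allI)
    fix u v c assume u: "u \<in> X"
    have "smul c u = smul c (P u) + smul c (u - P u)" by (simp flip: scale_right_distrib)
    then show "P (smul c u) = smul c (P u)"
      using P_sum[OF subspace_scale[OF Y PX(1)[OF u]] subspace_scale[OF Z PX(2)[OF u]]] by metis
    assume v: "v \<in> X"
    have "u + v = (P u + P v) + ((u - P u) + (v - P v))" by simp
    then show "P (u + v) = P u + P v"
      using P_sum[OF subspace_add[OF Y PX(1)[OF u] PX(1)[OF v]] subspace_add[OF Z PX(2)[OF u] PX(2)[OF v]]] by metis
  qed
  have "continuous_on X P" unfolding P_def by (intro continuous_on_fst homeomorphism_cont2[OF g])
  then obtain K where K: "bop K P" using bounded_of_continuous[OF lin] PX(1) YX(1) by blast
  then have P: "bounded_op P" unfolding bounded_op_def by blast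
  have PP: "P (P u) = P u" if "u \<in> X" for u using YX(2)[OF PX(1)[OF that]] .
  have rangeP: "{u \<in> X. P u = u} = Y" using YX PX(1) by force
  let ?P' = "\<lambda>u. u - P u"
  have P': "bounded_op ?P'" by (rule bounded_op_rules(4)[OF bounded_op_rules(1) P])
  have PP': "?P' (?P' u) = ?P' u" if "u \<in> X" for u using ZX(2)[OF PX(2)[OF that]] by simp
  have rangeP': "{u \<in> X. ?P' u = u} = Z" using ZX PX(2) by force
  \<comment> \<open>Any value below 1/2 would do, because one of \<mu> and \<open>1 - \<mu>\<close>
    has norm at least 1/2.\<close>
  have "(0 :: real) < 1 / 4" by simp
  from compression_to_scalar[OF K this] obtain J Q \<mu> where J: "bounded_op J" and Q: "bounded_op Q" and QJ: "\<And>u. u \<in> X \<Longrightarrow> Q (J u) = u"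
    and near: "\<And>u. u \<in> X \<Longrightarrow> norm (Q (P (J u)) - smul \<mu> u) \<le> 1 / 4 * norm u"
    by blast
  have factor: "isomorphic smul X {u \<in> X. S u = u}"
    if S: "bounded_op S" "\<And>u. u \<in> X \<Longrightarrow> S (S u) = S u"
      and n: "\<And>u. u \<in> X \<Longrightarrow> norm (Q (S (J u)) - smul c u) \<le> 1 / 4 * norm u" and c: "1 / 4 < norm c" for S c
  proof -
    have "bounded_op (\<lambda>u. Q (S (J u)))"
      by (rule bounded_op_rules(2)[OF Q bounded_op_rules(2)[OF S(1) J]])
    from neumann[OF this n _ c] obtain G where G: "bounded_op G" "\<And>u. u \<in> X \<Longrightarrow> G (Q (S (J u))) = u" by auto
    show ?thesis by (rule isomorphic_of_factorization[OF S J bounded_op_rules(2)[OF G(1) Q] G(2)])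
  qed
  show "isomorphic smul X Y \<or> isomorphic smul X Z"
  proof (cases "1 / 4 < norm \<mu>")
    case True
    then show ?thesis using factor[OF P PP near] rangeP by simp
  next
    case False
    have "1 \<le> norm (1 - \<mu>) + norm \<mu>" using norm_triangle_ineq[of "1 - \<mu>" \<mu>] by simp
    then have c: "1 / 4 < norm (1 - \<mu>)" using False by simp
    have "norm (Q (?P' (J u)) - smul (1 - \<mu>) u) \<le> 1 / 4 * norm u" if u: "u \<in> X" for u
    proof -
      have "Q (?P' (J u)) - smul (1 - \<mu>) u = - (Q (P (J u)) - smul \<mu> u)"
        using bounded_opD(4)[OF Q, of "J u" "P (J u)"] bounded_opD(1)[OF J u] bounded_opD(1)[OF P] QJ[OF u]
        by (simp add: scale_left_diff_distrib)
      then show ?thesis using near[OF u] by (simp only: norm_minus_cancel)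
    qed
    from factor[OF P' PP' this c] show ?thesis using rangeP' by simp
  qed
qed

end

theorem theorem3p1:
  fixes N :: nat and p :: "nat \<Rightarrow> real"
    and smul :: "'k::{real_normed_field, heine_borel} \<Rightarrow> 'x::banach \<Rightarrow> 'x"
    and X :: "'x set"
  assumes "N \<ge> 1"
    and "\<forall>i\<in>{1..N}. 1 < p i"
    and "\<forall>i\<in>{1..N}. \<forall>j\<in>{1..N}. i \<noteq> j \<longrightarrow> 1 / p i + 1 / p j \<le> 1"
    and "normed_space_over smul"
    and "is_projective_tensor_product pointwise_scale {1..N}
           (\<lambda>i. lp (p i)) (\<lambda>i. lp_norm (p i)) smul X"
  shows "primary smul X"
proof -
  interpret normed_space_over smul by fact
  obtain j where j: "linear_on pointwise_scale smul (algebraic_tensor pointwise_scale {1..N} (\<lambda>i. lp (p i))) j"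
    "\<forall>u\<in>algebraic_tensor pointwise_scale {1..N} (\<lambda>i. lp (p i)).
      norm (j u) = projective_norm pointwise_scale {1..N} (\<lambda>i. lp (p i)) (\<lambda>i. lp_norm (p i)) u"
    "X = closure (j ` algebraic_tensor pointwise_scale {1..N} (\<lambda>i. lp (p i)))"
    using assms(5) unfolding is_projective_tensor_product_def by blast
  have p: "1 < p i" if "i \<in> {1..N}" for i using assms(2) that by blast
  interpret lp_tensor_dual smul "{1..N}" p X j
  proof
    show "ptw.subspace (lp (p i) :: (nat \<Rightarrow> 'k) set)" if "i \<in> {1..N}" for i
      by (rule lp_subspace) (use p[OF that] in simp)
    show "lp_norm (p i) (pointwise_scale c v) = norm c * lp_norm (p i) v"
      if "i \<in> {1..N}" "v \<in> lp (p i)" for i c and v :: "nat \<Rightarrow> 'k"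
      using lp_scale(2)[OF that(2)] p[OF that(1)] by simp
  qed (use assms j p in \<open>auto simp: lp_norm_nonneg\<close>)
  show ?thesis by (rule primary_X)
qed

end
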